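(* Let $n \ge 2$, let $u\in \mathbb{S}^{n-1}$, and let $C\subset u^{\perp}$ be an $(n-1)$-dimensional convex body. If $C$ is a Cheeger set, then $$\sup\left\{ \frac{\mathcal{H}^n(K)}{\mathcal{H}^{n-1}(\partial K)}:\ K\in \mathcal{K}_C \right\}= \frac{\mathcal{H}^{n-1}(C)}{\mathcal{H}^{n-2}(\partial C)}.$$
   Context: A convex body is a nonempty compact convex subset of $\mathbb{R}^n$; its dimension is that of its affine hull. $\mathcal{H}^k$ is the $k$-dimensional Hausdorff measure ($\mathcal{H}^0$ is counting measure). $\mathbb{S}^{n-1}$ is the Euclidean unit sphere, $u^\perp$ is the hyperplane through the origin orthogonal to $u$, and $P_{u^\perp}$ is the orthogonal projection onto $u^\perp$. For a convex body $K$, $\partial K$ denotes the boundary relative to the affine hull of $K$. For an $(n-1)$-dimensional convex body $C\subset u^\perp$, the canal class of $C$ (with respect to $u$) is $\mathcal{K}_C=\{K\subset\mathbb{R}^n \text{ convex body with nonempty interior}:\ P_{u^\perp}(K)=C\}$. For a convex body $C$ of dimension $k\ge 1$, the Cheeger constant is $h(C)=\sup\{\mathcal{H}^k(D)/\mathcal{H}^{k-1}(\partial D):\ D\subset C \text{ closed},\ \mathcal{H}^{k-1}(\partial D)>0\}$, with boundaries taken relative to the affine hull of $C$. $C$ is said to be a Cheeger set if $h(C)=\mathcal{H}^k(C)/\mathcal{H}^{k-1}(\partial C)$. *)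

theory Defs
  imports "HOL-Analysis.Analysis"
begin

text \<open>
  Hausdorff measure, as a Caratheodory outer measure on all sets. The weight of a covering set is
  the volume of the \<open>k\<close>-ball of the same diameter, so that the measure in dimension \<open>n\<close> is
  normalised as Lebesgue measure on Euclidean \<open>n\<close>-space. The empty set weighs \<open>0\<close> also for \<open>k = 0\<close>,
  where any other bounded set weighs \<open>1\<close> (as \<open>0 ^ 0 = 1\<close>).
\<close>

definition hausdorff_weight :: "nat \<Rightarrow> 'a::metric_space set \<Rightarrow> ennreal" where
  "hausdorff_weight k S =
     (if S = {} then 0 else ennreal (unit_ball_vol (real k) * (diameter S / 2) ^ k))"

text \<open>Boundedness is required of the covering sets since \<^const>\<open>diameter\<close> is unspecified otherwise.\<close>

definition hausdorff_pre :: "nat \<Rightarrow> real \<Rightarrow> 'a::metric_space set \<Rightarrow> ennreal" where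
  "hausdorff_pre k \<delta> A =
     (INF F \<in> {F :: nat \<Rightarrow> 'a set. A \<subseteq> (\<Union>i. F i) \<and> (\<forall>i. bounded (F i) \<and> diameter (F i) \<le> \<delta>)}.
        \<Sum>i. hausdorff_weight k (F i))"

definition hausdorff :: "nat \<Rightarrow> 'a::metric_space set \<Rightarrow> ennreal" where
  "hausdorff k A = (SUP \<delta>\<in>{0<..}. hausdorff_pre k \<delta> A)"

lemma hausdorff_0: "hausdorff 0 A = emeasure (count_space UNIV) A"
proof (rule antisym)
  show "hausdorff 0 A \<le> emeasure (count_space UNIV) A"
  proof (cases "finite A")
    case True
    then obtain f :: "nat \<Rightarrow> 'a" where f: "bij_betw f {..<card A} A"
      using ex_bij_betw_nat_finite[of A] by (auto simp: lessThan_atLeast0)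
    define F where "F i = (if i < card A then {f i} else {})" for i
    have cov: "A \<subseteq> (\<Union>i. F i)"
      using f by (force simp: F_def bij_betw_def)
    have "(\<Sum>i. hausdorff_weight 0 (F i)) = (\<Sum>i<card A. hausdorff_weight 0 (F i))"
      by (rule suminf_finite) (auto simp: F_def hausdorff_weight_def)
    also have "\<dots> = of_nat (card A)"
      by (simp add: F_def hausdorff_weight_def)
    finally have s: "(\<Sum>i. hausdorff_weight 0 (F i)) = of_nat (card A)" .
    show ?thesis
      unfolding hausdorff_def
    proof (rule SUP_least)
      fix \<delta> :: real assume "\<delta> \<in> {0<..}"
      then have "hausdorff_pre 0 \<delta> A \<le> (\<Sum>i. hausdorff_weight 0 (F i))"
        unfolding hausdorff_pre_def by (intro INF_lower) (use cov in \<open>auto simp: F_def\<close>)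
      then show "hausdorff_pre 0 \<delta> A \<le> emeasure (count_space UNIV) A"
        using True s by simp
    qed
  qed simp
next
  have fin: "of_nat (card B) \<le> hausdorff 0 A" if B: "finite B" "B \<subseteq> A" for B
  proof -
    obtain d where d: "d > 0" "\<And>x y. x \<in> B \<Longrightarrow> y \<in> B \<Longrightarrow> x \<noteq> y \<Longrightarrow> d < dist x y"
    proof -
      define Q where "Q = insert 1 ((\<lambda>(x, y). dist x y) ` {p \<in> B \<times> B. fst p \<noteq> snd p})"
      have Q: "finite Q" "Q \<noteq> {}" "\<forall>q\<in>Q. q > 0"
        using B(1) by (auto simp: Q_def)
      have "Min Q > 0" using Q by simp
      show ?thesis
      proof (rule that[of "Min Q / 2"])
        fix x y assume "x \<in> B" "y \<in> B" "x \<noteq> y"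
        then have "dist x y \<in> Q" by (force simp: Q_def)
        then have "Min Q \<le> dist x y" using Q by simp
        then show "Min Q / 2 < dist x y" using \<open>Min Q > 0\<close> by linarith
      qed (use \<open>Min Q > 0\<close> in simp)
    qed
    have "of_nat (card B) \<le> hausdorff_pre 0 d A"
      unfolding hausdorff_pre_def
    proof (rule INF_greatest, clarify)
      fix F :: "nat \<Rightarrow> 'a set"
      assume F: "A \<subseteq> (\<Union>i. F i)" "\<forall>i. bounded (F i) \<and> diameter (F i) \<le> d"
      obtain g where g: "\<And>x. x \<in> B \<Longrightarrow> x \<in> F (g x)"
        using F(1) B(2) by (metis UN_E subsetD)
      have "inj_on g B"
      proof (rule inj_onI, rule ccontr)
        fix x y assume xy: "x \<in> B" "y \<in> B" "g x = g y" "x \<noteq> y"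
        then have "dist x y \<le> diameter (F (g x))"
          using F(2) g by (metis diameter_bounded_bound)
        then show False using d(2)[of x y] xy F(2) by (meson leD order_trans)
      qed
      then have "of_nat (card B) = (\<Sum>i\<in>g ` B. 1 :: ennreal)"
        by (simp add: card_image)
      also have "\<dots> = (\<Sum>i\<in>g ` B. hausdorff_weight 0 (F i))"
        by (rule sum.cong) (use g in \<open>auto simp: hausdorff_weight_def\<close>)
      also have "\<dots> \<le> (\<Sum>i. hausdorff_weight 0 (F i))"
        by (rule sum_le_suminf) (use B in auto)
      finally show "of_nat (card B) \<le> (\<Sum>i. hausdorff_weight 0 (F i))" .
    qed
    also have "\<dots> \<le> hausdorff 0 A"
      unfolding hausdorff_def by (rule SUP_upper) (use d in simp)
    finally show ?thesis .
  qed
  show "emeasure (count_space UNIV) A \<le> hausdorff 0 A"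
  proof (cases "finite A")
    case False
    have "hausdorff 0 A = top"
    proof (rule ccontr)
      assume "hausdorff 0 A \<noteq> top"
      then obtain n :: nat where n: "hausdorff 0 A < of_nat n"
        using ennreal_Ex_less_of_nat by (auto simp: less_top)
      obtain B where "finite B" "card B = n" "B \<subseteq> A"
        using infinite_arbitrarily_large[OF False] by blast
      then show False using fin[of B] n by auto
    qed
    then show ?thesis by simp
  qed (use fin[of A] in simp)
qed

definition convex_body :: "'a::euclidean_space set \<Rightarrow> bool" where
  "convex_body K \<longleftrightarrow> K \<noteq> {} \<and> compact K \<and> convex K"

text \<open>For a unit vector \<open>u\<close>, the orthogonal projection onto the hyperplane \<open>{u}\<^sup>\<bottom>\<close>.\<close>

definition proj_perp :: "'a::euclidean_space \<Rightarrow> 'a \<Rightarrow> 'a" where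
  "proj_perp u x = x - (u \<bullet> x) *\<^sub>R u"

lemma proj_perp_closest_point:
  assumes "norm u = 1"
  shows "proj_perp u x = closest_point ({u}\<^sup>\<bottom>) x"
proof -
  have uu: "u \<bullet> u = 1" using assms by (simp add: dot_square_norm)
  have mem: "proj_perp u x \<in> {u}\<^sup>\<bottom>"
    using uu by (simp add: proj_perp_def orthogonal_comp_def orthogonal_def inner_diff_right)
  have "dist x (proj_perp u x) \<le> dist x y" if "y \<in> {u}\<^sup>\<bottom>" for y
  proof -
    have "u \<bullet> y = 0" using that by (simp add: orthogonal_comp_def orthogonal_def)
    then have "\<bar>u \<bullet> x\<bar> = \<bar>u \<bullet> (x - y)\<bar>" by (simp add: inner_diff_right)
    also have "\<dots> \<le> norm (x - y)" using Cauchy_Schwarz_ineq2[of u "x - y"] assms by simp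
    finally show ?thesis using assms by (simp add: proj_perp_def dist_norm)
  qed
  then show ?thesis
    by (intro closest_point_unique[OF _ _ mem])
      (auto simp: closed_subspace subspace_orthogonal_comp subspace_imp_convex)
qed

definition canal_class :: "'a::euclidean_space \<Rightarrow> 'a set \<Rightarrow> 'a set set" where
  "canal_class u C = {K. convex_body K \<and> interior K \<noteq> {} \<and> proj_perp u ` K = C}"

text \<open>
  The boundary of \<open>D\<close> is taken in the affine hull of \<open>C\<close>, not in that of \<open>D\<close>, hence not
  \<^const>\<open>rel_frontier\<close>; for \<open>D = C\<close> the two agree. The definition is meaningful for convex bodies
  \<open>C\<close> of dimension at least 1.
\<close>

definition cheeger_constant :: "'a::euclidean_space set \<Rightarrow> ennreal" where
  "cheeger_constant C =
     (let k = nat (aff_dim C);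
          bd = (\<lambda>D. top_of_set (affine hull C) frontier_of D)
      in SUP D \<in> {D. D \<subseteq> C \<and> closed D \<and> hausdorff (k - 1) (bd D) > 0}.
           hausdorff k D / hausdorff (k - 1) (bd D))"

definition cheeger_set :: "'a::euclidean_space set \<Rightarrow> bool" where
  "cheeger_set C \<longleftrightarrow>
     (let k = nat (aff_dim C)
      in cheeger_constant C = hausdorff k C / hausdorff (k - 1) (rel_frontier C))"

lemma rel_frontier_eq_frontier_of:
  fixes C :: "'a::euclidean_space set"
  shows "rel_frontier C = top_of_set (affine hull C) frontier_of C"
proof -
  have "top_of_set (affine hull C) closure_of C = affine hull C \<inter> closure C"
    by (simp add: closure_of_subtopology Int_absorb1 hull_subset)
  also have "\<dots> = closure C"
    by (rule Int_absorb1) (rule closure_affine_hull)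
  finally have "top_of_set (affine hull C) closure_of C = closure C" .
  moreover have "top_of_set (affine hull C) interior_of C = rel_interior C"
    by (auto simp: interior_of_def rel_interior_def)
  ultimately show ?thesis
    by (simp add: rel_frontier_def frontier_of_def)
qed

end

theory Submission
  imports Defs
begin

text \<open>
  Write \<open>S(D)\<close> for the Hausdorff measure of the boundary, \<open>B\<close> for the unit ball, and identify the
  space with the product of the hyperplane \<open>u\<close>-perpendicular and the line. For a convex body \<open>D\<close>
  containing a ball of radius \<open>r\<close> in dimension \<open>d\<close>, comparison with circumscribed polytopes gives
  \<open>|D| + \<epsilon> S(D) \<le> |D + \<epsilon> B| \<le> |D| + \<epsilon> (1 + \<epsilon>/r)^(d-1) S(D)\<close>. Let \<open>h = |C| / S(C)\<close>.

  For \<open>K\<close> in the canal class let \<open>D(t)\<close> be the set of those points of \<open>C\<close> over which \<open>K\<close> contains two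
  points at vertical distance \<open>t\<close>. These sets are convex, \<open>|K|\<close> is the integral of \<open>|D(t)|\<close> over
  \<open>t \<ge> 0\<close>, and fattening \<open>K\<close> fattens every \<open>D(t)\<close>. As \<open>C\<close> is a Cheeger set, \<open>|D(t)| \<le> h S(D(t))\<close>,
  so \<open>|D(t) + \<epsilon> B| \<ge> (1 + \<epsilon>/h) |D(t)|\<close>. Integrating, \<open>|K + \<epsilon> B| \<ge> (1 + \<epsilon>/h) |K|\<close>, and \<open>\<epsilon> \<rightarrow> 0\<close>
  yields \<open>|K| \<le> h S(K)\<close>. Cylinders over \<open>C\<close> of growing height show that \<open>h\<close> cannot be improved.

  The normalisation of the Hausdorff measures matters, as three dimensions occur: they agree with
  Lebesgue measure by the isodiametric inequality and Vitali's covering theorem.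
\<close>

section \<open>Hausdorff measures\<close>

text \<open>The boundary of a convex body has a Hausdorff measure but comes with no parametrisation,
  and relating the boundary of \<open>K\<close> directly to those of the D(t) would call for a
  coarea formula. Volumes of parallel bodies avoid both difficulties: they are subject to Fubini's
  theorem, and surface area enters only through the two bounds, the lower one for the D(t) and the
  upper one for \<open>K\<close>. The D(t) are the superlevel sets of the vertical length of
  \<open>K\<close>, a concave function on \<open>C\<close>; described by pairs of points of
  \<open>K\<close>, they follow every horizontal shift of \<open>K\<close>. So the Cheeger property
  is applied to convex sets only.

  For polytopes the two bounds compare facets with prisms erected on them. The transfer to convex
  bodies rests on monotonicity: the nearest-point map onto a convex body is 1-Lipschitz and maps the
  boundary of any bounded set around it over its own. The factor 1 + \<epsilon>/r is due to the fact
  that moving all facets outwards by \<epsilon> enlarges a polytope around the ball of radius r by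
  no more than this dilation.\<close>

lemma hausdorff_weight_empty [simp]: "hausdorff_weight k {} = 0"
  by (simp add: hausdorff_weight_def)

lemma bounded_image_lipschitz:
  fixes f :: "'a::metric_space \<Rightarrow> 'b::metric_space"
  assumes "bounded S" and lip: "\<And>x y. x \<in> S \<Longrightarrow> y \<in> S \<Longrightarrow> dist (f x) (f y) \<le> c * dist x y" "c \<ge> 0"
  shows "bounded (f ` S)" "diameter (f ` S) \<le> c * diameter S"
proof -
  have *: "dist (f x) (f y) \<le> c * diameter S" if "x \<in> S" "y \<in> S" for x y
    using lip(1)[OF that] mult_left_mono[OF diameter_bounded_bound[OF assms(1) that] lip(2)] by linarith
  then show "bounded (f ` S)"
    by (subst bounded_two_points) auto
  show "diameter (f ` S) \<le> c * diameter S"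
    by (cases "S = {}") (auto simp: diameter_def[of "f ` S"] intro!: cSUP_least *)
qed

lemma hausdorff_weight_image_le:
  fixes f :: "'a::metric_space \<Rightarrow> 'b::metric_space"
  assumes "bounded S" and "\<And>x y. x \<in> S \<Longrightarrow> y \<in> S \<Longrightarrow> dist (f x) (f y) \<le> c * dist x y" "c \<ge> 0"
  shows "hausdorff_weight k (f ` S) \<le> ennreal (c ^ k) * hausdorff_weight k S"
proof (cases "S = {}")
  case False
  have "(diameter (f ` S) / 2) ^ k \<le> (c * (diameter S / 2)) ^ k"
    using bounded_image_lipschitz[OF assms]
    by (intro power_mono) (auto simp: diameter_ge_0)
  then have "unit_ball_vol (real k) * (diameter (f ` S) / 2) ^ k
      \<le> c ^ k * (unit_ball_vol (real k) * (diameter S / 2) ^ k)"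
    using mult_left_mono[of _ _ "unit_ball_vol (real k)"]
    unfolding power_mult_distrib by (metis mult.left_commute unit_ball_vol_nonneg of_nat_0_le_iff)
  then show ?thesis
    using False assms(3) diameter_ge_0[OF assms(1)]
    by (simp add: hausdorff_weight_def flip: ennreal_mult)
qed simp

lemma hausdorff_weight_mono:
  fixes S :: "'a::metric_space set"
  assumes "bounded T" "S \<subseteq> T"
  shows "hausdorff_weight k S \<le> hausdorff_weight k T"
proof (cases "S = {}")
  case False
  have "0 \<le> diameter S" "diameter S \<le> diameter T"
    using assms diameter_subset diameter_ge_0 bounded_subset by blast+
  then have "(diameter S / 2) ^ k \<le> (diameter T / 2) ^ k"
    by (intro power_mono) auto
  then show ?thesis
    using False assms by (auto simp: hausdorff_weight_def intro!: ennreal_leI mult_left_mono)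
qed simp

text \<open>The definition admits only sequences of covering sets. A countable family is spread over
  the naturals and the remaining places are filled with empty sets, which weigh nothing and have
  diameter 0. The integral against the counting measure sums over finite and infinite index sets
  alike.\<close>

lemma hausdorff_pre_le_cover:
  fixes F :: "'i \<Rightarrow> 'a::metric_space set"
  assumes I: "countable I" and A: "A \<subseteq> (\<Union>i\<in>I. F i)"
    and F: "\<And>i. i \<in> I \<Longrightarrow> bounded (F i)" "\<And>i. i \<in> I \<Longrightarrow> diameter (F i) \<le> \<delta>" and "\<delta> \<ge> 0"
  shows "hausdorff_pre k \<delta> A \<le> (\<integral>\<^sup>+i. hausdorff_weight k (F i) \<partial>count_space I)"
proof -
  define J where "J = to_nat_on I ` I"
  define G where "G n = (if n \<in> J then F (from_nat_into I n) else {})" for n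
  have J: "bij_betw (to_nat_on I) I J"
    using I by (simp add: J_def inj_on_to_nat_on bij_betw_imageI)
  have GF: "G (to_nat_on I i) = F i" if "i \<in> I" for i
    using I that by (simp add: G_def J_def)
  have "hausdorff_pre k \<delta> A \<le> (\<Sum>n. hausdorff_weight k (G n))"
    unfolding hausdorff_pre_def
  proof (rule INF_lower, safe)
    fix x assume "x \<in> A"
    then obtain i where "i \<in> I" "x \<in> F i" using A by auto
    then show "x \<in> (\<Union>n. G n)" using GF by (intro UN_I[of "to_nat_on I i"]) auto
  next
    fix n show "bounded (G n)" "diameter (G n) \<le> \<delta>"
      using F GF \<open>\<delta> \<ge> 0\<close> by (cases "n \<in> J"; auto simp: J_def G_def)+
  qed
  also have "\<dots> = (\<integral>\<^sup>+n. hausdorff_weight k (G n) * indicator J n \<partial>count_space UNIV)"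
    by (subst nn_integral_count_space_nat[symmetric], rule nn_integral_cong) (simp add: G_def)
  also have "\<dots> = (\<integral>\<^sup>+n. hausdorff_weight k (G n) \<partial>count_space J)"
    by (subst nn_integral_count_space_indicator) auto
  also have "\<dots> = (\<integral>\<^sup>+i. hausdorff_weight k (G (to_nat_on I i)) \<partial>count_space I)"
    by (rule nn_integral_bij_count_space[OF J, symmetric])
  also have "\<dots> = (\<integral>\<^sup>+i. hausdorff_weight k (F i) \<partial>count_space I)"
    by (rule nn_integral_cong) (simp add: GF)
  finally show ?thesis .
qed

lemma hausdorff_pre_less_cover:
  assumes "hausdorff_pre k \<delta> A < c"
  obtains F :: "nat \<Rightarrow> 'a::metric_space set" where "A \<subseteq> (\<Union>i. F i)" "\<And>i. bounded (F i)"
    "\<And>i. diameter (F i) \<le> \<delta>" "(\<Sum>i. hausdorff_weight k (F i)) < c"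
  using assms unfolding hausdorff_pre_def INF_less_iff by auto

lemma hausdorff_pre_antimono:
  assumes "\<delta> \<le> \<epsilon>" shows "hausdorff_pre k \<epsilon> A \<le> hausdorff_pre k \<delta> A"
  unfolding hausdorff_pre_def by (rule INF_superset_mono) (use assms in \<open>auto intro: order_trans\<close>)

lemma hausdorff_pre_mono:
  assumes "A \<subseteq> B" shows "hausdorff_pre k \<delta> A \<le> hausdorff_pre k \<delta> B"
  unfolding hausdorff_pre_def by (rule INF_superset_mono) (use assms in auto)

lemma hausdorff_mono:
  assumes "A \<subseteq> B" shows "hausdorff k A \<le> hausdorff k B"
  unfolding hausdorff_def by (intro SUP_mono' hausdorff_pre_mono assms)

lemma hausdorff_pre_le_hausdorff: "\<delta> > 0 \<Longrightarrow> hausdorff_pre k \<delta> A \<le> hausdorff k A"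
  unfolding hausdorff_def by (rule SUP_upper) simp

lemma hausdorff_empty [simp]: "hausdorff k {} = 0"
proof -
  have "hausdorff_pre k \<delta> {} \<le> 0" if "\<delta> > 0" for \<delta>
    using hausdorff_pre_le_cover[of "{}" "{}" "\<lambda>_::nat. {}" \<delta> k] that
    by (simp add: nn_integral_empty)
  then have "hausdorff k {} \<le> (0 :: ennreal)"
    unfolding hausdorff_def by (intro SUP_least) auto
  then show ?thesis by simp
qed

text \<open>A cover of \<open>A\<close> of mesh \<open>\<delta> / c\<close> is mapped to a cover of
  the image of mesh \<delta>, and each weight grows by at most the factor \<open>c ^ k\<close>.
  Isometries, dilations and nearest-point maps are all instances.\<close>

lemma hausdorff_lipschitz_image:
  fixes f :: "'a::metric_space \<Rightarrow> 'b::metric_space"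
  assumes lip: "\<And>x y. x \<in> A \<Longrightarrow> y \<in> A \<Longrightarrow> dist (f x) (f y) \<le> c * dist x y" and "c > 0"
  shows "hausdorff k (f ` A) \<le> ennreal (c ^ k) * hausdorff k A"
  unfolding hausdorff_def[of k "f ` A"]
proof (rule SUP_least)
  fix \<delta> :: real assume "\<delta> \<in> {0<..}"
  then have \<delta>: "\<delta> > 0" by simp
  have ck: "ennreal (c ^ k) > 0" using \<open>c > 0\<close> by simp
  have "hausdorff_pre k \<delta> (f ` A) \<le> ennreal (c ^ k) * hausdorff_pre k (\<delta> / c) A"
  proof (rule ccontr)
    assume "\<not> ?thesis"
    then have "ennreal (1 / c ^ k) * (ennreal (c ^ k) * hausdorff_pre k (\<delta> / c) A)
        < ennreal (1 / c ^ k) * hausdorff_pre k \<delta> (f ` A)"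
      using \<open>c > 0\<close> by (intro ennreal_mult_strict_left_mono) (auto simp: not_le)
    then have "hausdorff_pre k (\<delta> / c) A < ennreal (1 / c ^ k) * hausdorff_pre k \<delta> (f ` A)"
      using \<open>c > 0\<close> by (simp add: mult.assoc[symmetric] flip: ennreal_mult)
    then obtain F where F: "A \<subseteq> (\<Union>i. F i)" "\<And>i. bounded (F i)" "\<And>i. diameter (F i) \<le> \<delta> / c"
        and less: "(\<Sum>i. hausdorff_weight k (F i)) < ennreal (1 / c ^ k) * hausdorff_pre k \<delta> (f ` A)"
      using hausdorff_pre_less_cover by blast
    \<comment> \<open>The Lipschitz bound holds on \<open>A\<close> only, so the covering sets are
      trimmed to \<open>A\<close> before they are mapped.\<close>
    define G where "G i = F i \<inter> A" for i
    have G: "bounded (G i)" "G i \<subseteq> F i" for i using F(2) by (auto simp: G_def bounded_Int)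
    have l: "dist (f x) (f y) \<le> c * dist x y" if "x \<in> G i" "y \<in> G i" for x y i
      using that lip by (auto simp: G_def)
    have c0: "c \<ge> 0" using \<open>c > 0\<close> by simp
    have dG: "diameter (G i) \<le> \<delta> / c" for i
      using diameter_subset[OF G(2) F(2)] F(3) order_trans by blast
    have "hausdorff_pre k \<delta> (f ` A) \<le> (\<integral>\<^sup>+i. hausdorff_weight k (f ` G i) \<partial>count_space (UNIV::nat set))"
    proof (rule hausdorff_pre_le_cover)
      fix i show "bounded (f ` G i)" by (rule bounded_image_lipschitz(1)[OF G(1) l c0])
      have "diameter (f ` G i) \<le> c * diameter (G i)" by (rule bounded_image_lipschitz(2)[OF G(1) l c0])
      then show "diameter (f ` G i) \<le> \<delta>" using dG[of i] \<open>c > 0\<close> by (simp add: field_simps)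
    qed (use F(1) \<delta> in \<open>auto simp: G_def subset_iff intro!: imageI\<close>)
    also have "\<dots> \<le> (\<integral>\<^sup>+i. ennreal (c ^ k) * hausdorff_weight k (F i) \<partial>count_space (UNIV::nat set))"
    proof (rule nn_integral_mono)
      fix i
      have "hausdorff_weight k (f ` G i) \<le> ennreal (c ^ k) * hausdorff_weight k (G i)"
        by (rule hausdorff_weight_image_le[OF G(1) l c0])
      also have "\<dots> \<le> ennreal (c ^ k) * hausdorff_weight k (F i)"
        using hausdorff_weight_mono[OF F(2) G(2)] by (rule mult_left_mono) simp
      finally show "hausdorff_weight k (f ` G i) \<le> ennreal (c ^ k) * hausdorff_weight k (F i)" .
    qed
    also have "\<dots> = ennreal (c ^ k) * (\<Sum>i. hausdorff_weight k (F i))"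
      by (simp add: nn_integral_cmult nn_integral_count_space_nat)
    also have "\<dots> < ennreal (c ^ k) * (ennreal (1 / c ^ k) * hausdorff_pre k \<delta> (f ` A))"
      using less ck by (intro ennreal_mult_strict_left_mono) auto
    also have "\<dots> = hausdorff_pre k \<delta> (f ` A)"
      using \<open>c > 0\<close> by (simp add: mult.assoc[symmetric] flip: ennreal_mult)
    finally show False by simp
  qed
  also have "\<dots> \<le> ennreal (c ^ k) * hausdorff k A"
    using \<delta> \<open>c > 0\<close> by (intro mult_left_mono hausdorff_pre_le_hausdorff) auto
  finally show "hausdorff_pre k \<delta> (f ` A) \<le> ennreal (c ^ k) * hausdorff k A" .
qed

lemma hausdorff_isometry:
  fixes f :: "'a::metric_space \<Rightarrow> 'b::metric_space"
  assumes "\<And>x y. x \<in> A \<Longrightarrow> y \<in> A \<Longrightarrow> dist (f x) (f y) = dist x y"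
  shows "hausdorff k (f ` A) = hausdorff k A"
proof (rule antisym)
  show "hausdorff k (f ` A) \<le> hausdorff k A"
    using hausdorff_lipschitz_image[of A f 1 k] assms by simp
  have inj: "inj_on f A"
    using assms by (metis dist_eq_0_iff inj_onI)
  have "dist (inv_into A f x) (inv_into A f y) \<le> 1 * dist x y" if "x \<in> f ` A" "y \<in> f ` A" for x y
    using that assms inj by auto
  from hausdorff_lipschitz_image[OF this, where k = k]
  have "hausdorff k (inv_into A f ` f ` A) \<le> hausdorff k (f ` A)"
    by simp
  then show "hausdorff k A \<le> hausdorff k (f ` A)"
    using inj by (simp add: image_inv_into_cancel)
qed

section \<open>Subadditivity, and additivity on separated sets\<close>

lemma hausdorff_pre_Un:
  assumes "\<delta> \<ge> 0"
  shows "hausdorff_pre k \<delta> (A \<union> B) \<le> hausdorff_pre k \<delta> A + hausdorff_pre k \<delta> (B :: 'a::metric_space set)"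
proof (rule ennreal_le_epsilon)
  fix e :: real assume fin: "hausdorff_pre k \<delta> A + hausdorff_pre k \<delta> B < top" and "e > 0"
  have "hausdorff_pre k \<delta> A < hausdorff_pre k \<delta> A + ennreal (e/2)"
       "hausdorff_pre k \<delta> B < hausdorff_pre k \<delta> B + ennreal (e/2)"
    using fin \<open>e > 0\<close> by (auto simp: ennreal_add_eq_top less_top)
  from hausdorff_pre_less_cover[OF this(1)] hausdorff_pre_less_cover[OF this(2)]
  obtain F G where F: "A \<subseteq> (\<Union>i. F i)" "\<And>i. bounded (F i)" "\<And>i. diameter (F i) \<le> \<delta>"
        "(\<Sum>i. hausdorff_weight k (F i)) < hausdorff_pre k \<delta> A + ennreal (e/2)"
    and G: "B \<subseteq> (\<Union>i. G i)" "\<And>i. bounded (G i)" "\<And>i. diameter (G i) \<le> \<delta>"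
        "(\<Sum>i. hausdorff_weight k (G i)) < hausdorff_pre k \<delta> B + ennreal (e/2)"
    by metis
  define H where "H p = (if fst p then F (snd p) else G (snd p))" for p :: "bool \<times> nat"
  have "hausdorff_pre k \<delta> (A \<union> B) \<le> (\<integral>\<^sup>+p. hausdorff_weight k (H p) \<partial>count_space UNIV)"
  proof (rule hausdorff_pre_le_cover)
    show "A \<union> B \<subseteq> (\<Union>p\<in>UNIV. H p)"
    proof
      fix x assume "x \<in> A \<union> B"
      then obtain i where "x \<in> F i \<or> x \<in> G i" using F(1) G(1) by blast
      then have "x \<in> H (True, i) \<or> x \<in> H (False, i)" by (auto simp: H_def)
      then show "x \<in> (\<Union>p\<in>UNIV. H p)" by blast
    qed
  qed (use F G assms in \<open>auto simp: H_def\<close>)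
  also have "\<dots> = (\<integral>\<^sup>+b. (\<integral>\<^sup>+i. hausdorff_weight k (H (b, i)) \<partial>count_space UNIV) \<partial>count_space UNIV)"
    by (rule nn_integral_fst_count_space[symmetric])
  also have "\<dots> = (\<Sum>i. hausdorff_weight k (F i)) + (\<Sum>i. hausdorff_weight k (G i))"
    by (simp add: nn_integral_count_space_finite UNIV_bool H_def nn_integral_count_space_nat add.commute)
  also have "\<dots> \<le> hausdorff_pre k \<delta> A + ennreal (e/2) + (hausdorff_pre k \<delta> B + ennreal (e/2))"
    using F(4) G(4) by (intro add_mono) auto
  also have "\<dots> = hausdorff_pre k \<delta> A + hausdorff_pre k \<delta> B + (ennreal (e/2) + ennreal (e/2))"
    by (simp add: add_ac)
  also have "ennreal (e/2) + ennreal (e/2) = ennreal e"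
    using \<open>e > 0\<close> by (simp flip: ennreal_plus)
  finally show "hausdorff_pre k \<delta> (A \<union> B) \<le> hausdorff_pre k \<delta> A + hausdorff_pre k \<delta> B + ennreal e" .
qed

lemma hausdorff_Un: "hausdorff k (A \<union> B) \<le> hausdorff k A + hausdorff k (B :: 'a::metric_space set)"
  unfolding hausdorff_def[of k "A \<union> B"]
proof (rule SUP_least)
  fix \<delta> :: real assume \<delta>: "\<delta> \<in> {0<..}"
  then have "hausdorff_pre k \<delta> (A \<union> B) \<le> hausdorff_pre k \<delta> A + hausdorff_pre k \<delta> B"
    by (intro hausdorff_pre_Un) auto
  also have "\<dots> \<le> hausdorff k A + hausdorff k B"
    using \<delta> by (intro add_mono hausdorff_pre_le_hausdorff) auto
  finally show "hausdorff_pre k \<delta> (A \<union> B) \<le> hausdorff k A + hausdorff k B" .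
qed

lemma hausdorff_UN_finite:
  fixes A :: "'i \<Rightarrow> 'a::metric_space set"
  assumes "finite I"
  shows "hausdorff k (\<Union>i\<in>I. A i) \<le> (\<Sum>i\<in>I. hausdorff k (A i))"
  using assms
proof induction
  case (insert i I)
  have "hausdorff k (\<Union>j\<in>insert i I. A j) \<le> hausdorff k (A i) + hausdorff k (\<Union>j\<in>I. A j)"
    using hausdorff_Un[of k "A i" "\<Union>j\<in>I. A j"] by simp
  also have "\<dots> \<le> hausdorff k (A i) + (\<Sum>j\<in>I. hausdorff k (A j))"
    using insert.IH by (rule add_left_mono)
  finally show ?case using insert.hyps by simp
qed simp

text \<open>A set of diameter less than \<sigma> cannot meet both \<open>A\<close> and
  \<open>B\<close>, so every fine cover splits into a cover of \<open>A\<close> and one of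
  \<open>B\<close>. This metric form of additivity involves no measurability; facets come into its
  scope once they are shrunk apart.\<close>

lemma hausdorff_pre_Un_separated:
  fixes A :: "'a::metric_space set"
  assumes sep: "\<And>x y. x \<in> A \<Longrightarrow> y \<in> B \<Longrightarrow> \<sigma> \<le> dist x y" and \<delta>: "\<delta> < \<sigma>" "\<delta> \<ge> 0"
  shows "hausdorff_pre k \<delta> A + hausdorff_pre k \<delta> B \<le> hausdorff_pre k \<delta> (A \<union> B)"
  unfolding hausdorff_pre_def[of k \<delta> "A \<union> B"]
proof (rule INF_greatest, safe)
  fix F :: "nat \<Rightarrow> 'a set"
  assume cov: "A \<union> B \<subseteq> (\<Union>i. F i)" and F: "\<forall>i. bounded (F i) \<and> diameter (F i) \<le> \<delta>"
  define I where "I = {i. F i \<inter> A \<noteq> {}}"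
  define J where "J = {i. F i \<inter> B \<noteq> {}}"
  have IJ: "I \<inter> J = {}"
  proof (rule ccontr)
    assume "I \<inter> J \<noteq> {}"
    then obtain i x y where "x \<in> A" "y \<in> B" "x \<in> F i" "y \<in> F i" by (auto simp: I_def J_def)
    then have "\<sigma> \<le> dist x y" "dist x y \<le> diameter (F i)"
      using sep F diameter_bounded_bound by blast+
    then show False using F \<delta> by (meson le_less_trans not_le order_trans)
  qed
  have "hausdorff_pre k \<delta> A + hausdorff_pre k \<delta> B \<le>
      (\<integral>\<^sup>+i. hausdorff_weight k (F i) \<partial>count_space I) + (\<integral>\<^sup>+i. hausdorff_weight k (F i) \<partial>count_space J)"
    by (intro add_mono hausdorff_pre_le_cover) (use cov F \<delta> in \<open>auto 4 4 simp: I_def J_def subset_iff\<close>)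
  also have "\<dots> = (\<integral>\<^sup>+i. hausdorff_weight k (F i) * indicator I i + hausdorff_weight k (F i) * indicator J i \<partial>count_space UNIV)"
    by (subst nn_integral_add) (auto simp: nn_integral_count_space_indicator)
  also have "\<dots> \<le> (\<integral>\<^sup>+i. hausdorff_weight k (F i) \<partial>count_space UNIV)"
    using IJ by (intro nn_integral_mono) (auto simp: indicator_def)
  also have "\<dots> = (\<Sum>i. hausdorff_weight k (F i))"
    by (rule nn_integral_count_space_nat)
  finally show "hausdorff_pre k \<delta> A + hausdorff_pre k \<delta> B \<le> (\<Sum>i. hausdorff_weight k (F i))" .
qed

lemma hausdorff_Un_separated:
  fixes A :: "'a::metric_space set"
  assumes sep: "\<And>x y. x \<in> A \<Longrightarrow> y \<in> B \<Longrightarrow> \<sigma> \<le> dist x y" and \<sigma>: "\<sigma> > 0"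
  shows "hausdorff k A + hausdorff k B \<le> hausdorff k (A \<union> B)"
proof -
  have "hausdorff k A + hausdorff k B = (SUP \<delta>\<in>{0<..}. hausdorff_pre k \<delta> A + hausdorff_pre k \<delta> B)"
    unfolding hausdorff_def
  proof (rule SUP_add_directed_ennreal[symmetric])
    \<comment> \<open>Both premeasures increase as \<delta> decreases, so the two suprema can be
      taken along the same \<delta>.\<close>
    fix i j :: real assume "i \<in> {0<..}" "j \<in> {0<..}"
    then show "\<exists>l\<in>{0<..}. hausdorff_pre k i A + hausdorff_pre k j B \<le> hausdorff_pre k l A + hausdorff_pre k l B"
      by (intro bexI[of _ "min i j"] add_mono hausdorff_pre_antimono) auto
  qed
  also have "\<dots> \<le> hausdorff k (A \<union> B)"
  proof (rule SUP_least)
    fix \<delta> :: real assume "\<delta> \<in> {0<..}"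
    define d where "d = min \<delta> (\<sigma> / 2)"
    have d: "d > 0" "d < \<sigma>" "d \<le> \<delta>" using \<open>\<delta> \<in> {0<..}\<close> \<sigma> by (auto simp: d_def)
    have "hausdorff_pre k \<delta> A + hausdorff_pre k \<delta> B \<le> hausdorff_pre k d A + hausdorff_pre k d B"
      using d by (intro add_mono hausdorff_pre_antimono)
    also have "\<dots> \<le> hausdorff_pre k d (A \<union> B)"
      using sep d by (intro hausdorff_pre_Un_separated) auto
    also have "\<dots> \<le> hausdorff k (A \<union> B)" using d by (intro hausdorff_pre_le_hausdorff)
    finally show "hausdorff_pre k \<delta> A + hausdorff_pre k \<delta> B \<le> hausdorff k (A \<union> B)" .
  qed
  finally show ?thesis .
qed

lemma hausdorff_UN_separated:
  fixes A :: "'i \<Rightarrow> 'a::metric_space set"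
  assumes "finite I" and \<sigma>: "\<sigma> > 0"
    and "\<And>i j x y. i \<in> I \<Longrightarrow> j \<in> I \<Longrightarrow> i \<noteq> j \<Longrightarrow> x \<in> A i \<Longrightarrow> y \<in> A j \<Longrightarrow> \<sigma> \<le> dist x y"
  shows "(\<Sum>i\<in>I. hausdorff k (A i)) \<le> hausdorff k (\<Union>i\<in>I. A i)"
  using assms(1,3)
proof induction
  case (insert i I)
  have IH: "(\<Sum>j\<in>I. hausdorff k (A j)) \<le> hausdorff k (\<Union>j\<in>I. A j)"
    by (rule insert.IH) (use insert.prems in blast)
  have "(\<Sum>j\<in>insert i I. hausdorff k (A j)) = hausdorff k (A i) + (\<Sum>j\<in>I. hausdorff k (A j))"
    using insert.hyps by simp
  also have "\<dots> \<le> hausdorff k (A i) + hausdorff k (\<Union>j\<in>I. A j)"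
    using IH by (rule add_left_mono)
  also have "\<dots> \<le> hausdorff k (A i \<union> (\<Union>j\<in>I. A j))"
    by (rule hausdorff_Un_separated[OF _ \<sigma>]) (use insert.prems insert.hyps in blast)
  finally show ?case by simp
qed simp

section \<open>The isodiametric inequality\<close>

text \<open>The map sending x to (x + b) / 2 halves lengths.\<close>

lemma emeasure_midpoint_le:
  fixes A E :: "real set"
  assumes [measurable]: "A \<in> sets borel" "E \<in> sets borel" and "\<And>x. x \<in> A \<Longrightarrow> (x + b) / 2 \<in> E"
  shows "emeasure lborel A \<le> 2 * emeasure lborel E"
proof -
  have "ennreal (2 * \<bar>1/2\<bar>) = ennreal 2 * ennreal \<bar>1/2\<bar>"
    by (rule ennreal_mult) auto
  then have two: "2 * ennreal \<bar>1/2\<bar> = 1" by simp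
  have "emeasure lborel A = (\<integral>\<^sup>+x. indicator A x \<partial>lborel)" by simp
  also have "\<dots> \<le> (\<integral>\<^sup>+x. indicator E (b/2 + (1/2) * x) \<partial>lborel)"
    using assms(3) by (intro nn_integral_mono) (auto simp: indicator_def field_simps)
  also have "\<dots> = 2 * (ennreal \<bar>1/2\<bar> * (\<integral>\<^sup>+x. indicator E (b/2 + (1/2) * x) \<partial>lborel))"
    by (simp only: mult.assoc[symmetric] two mult_1_left)
  also have "\<dots> = 2 * emeasure lborel E"
    by (subst nn_integral_real_affine[symmetric]) auto
  finally show ?thesis .
qed

text \<open>Midpoints of \<open>A\<close> with a point \<open>b\<close> near the infimum of
  \<open>B\<close> form a half-size copy of \<open>A\<close> on the left, midpoints of
  \<open>B\<close> with a point \<open>a\<close> near the supremum of \<open>A\<close> form one of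
  \<open>B\<close> on the right. The two copies overlap in an interval of length at most
  \<open>e / 2\<close>, and \<open>C\<close> contains both.\<close>

lemma brunn_minkowski_real:
  fixes A B C :: "real set"
  assumes [measurable]: "A \<in> sets borel" "B \<in> sets borel" "C \<in> sets borel"
    and ne: "A \<noteq> {}" "B \<noteq> {}" and bdd: "bounded A" "bounded B"
    and mid: "\<And>x y. x \<in> A \<Longrightarrow> y \<in> B \<Longrightarrow> (x + y) / 2 \<in> C"
  shows "emeasure lborel A + emeasure lborel B \<le> 2 * emeasure lborel C"
proof (rule ennreal_le_epsilon)
  fix e :: real assume e: "e > 0"
  have bA: "bdd_above A" and bB: "bdd_below B"
    using bdd by (auto simp: bounded_imp_bdd_above bounded_imp_bdd_below)
  obtain a where a: "a \<in> A" "Sup A - e/2 < a"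
    using less_cSupE[of "Sup A - e/2" A] ne e by auto
  obtain b where b: "b \<in> B" "b < Inf B + e/2"
    using cInf_lessD[of B "Inf B + e/2"] ne e by auto
  define U where "U = C \<inter> {..(Sup A + b) / 2}"
  define V where "V = C \<inter> {(Inf B + a) / 2..}"
  have [measurable]: "U \<in> sets borel" "V \<in> sets borel" by (auto simp: U_def V_def)
  have "x \<le> Sup A" if "x \<in> A" for x using that bA by (rule cSup_upper)
  then have "emeasure lborel A \<le> 2 * emeasure lborel U"
    using b mid by (intro emeasure_midpoint_le[where b = b]) (auto simp: U_def)
  moreover have "Inf B \<le> y" if "y \<in> B" for y using that bB by (rule cInf_lower)
  then have "emeasure lborel B \<le> 2 * emeasure lborel V"
    using a mid[of a] by (intro emeasure_midpoint_le[where b = a]) (auto simp: V_def add.commute)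
  ultimately have "emeasure lborel A + emeasure lborel B \<le> 2 * (emeasure lborel U + emeasure lborel V)"
    by (simp add: distrib_left add_mono)
  also have "emeasure lborel U + emeasure lborel V = emeasure lborel (U \<union> V) + emeasure lborel (U \<inter> V)"
    by (rule emeasure_Un_Int) auto
  also have "\<dots> \<le> emeasure lborel C + emeasure lborel {(Inf B + a) / 2 .. (Sup A + b) / 2}"
    by (intro add_mono emeasure_mono) (auto simp: U_def V_def)
  also have "\<dots> \<le> emeasure lborel C + ennreal (e / 2)"
  proof (intro add_left_mono)
    have "(Sup A + b) / 2 - (Inf B + a) / 2 \<le> e / 2"
      using a b e by (simp add: field_simps)
    then show "emeasure lborel {(Inf B + a) / 2 .. (Sup A + b) / 2} \<le> ennreal (e / 2)"
      by (auto simp: emeasure_lborel_Icc_eq simp del: emeasure_lborel_Icc intro!: ennreal_leI)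
  qed
  also have "2 * (emeasure lborel C + ennreal (e / 2)) = 2 * emeasure lborel C + ennreal e"
    using e by (simp add: distrib_left ennreal_numeral[symmetric] ennreal_mult[symmetric] del: ennreal_numeral)
  finally show "emeasure lborel A + emeasure lborel B \<le> 2 * emeasure lborel C + ennreal e"
    by (simp add: mult_left_mono)
qed

section \<open>The Prekopa-Leindler inequality\<close>

text \<open>Layer-cake formula. The levels are confined to the open unit interval, since there the
  level sets of a function with supremum 1 are nonempty.\<close>

lemma nn_integral_layer_unit:
  fixes f :: "real \<Rightarrow> real"
  assumes [measurable]: "f \<in> borel_measurable borel" and f: "\<And>x. 0 \<le> f x" "\<And>x. f x \<le> 1"
  shows "(\<integral>\<^sup>+x. ennreal (f x) \<partial>lborel) = (\<integral>\<^sup>+t. emeasure lborel {x. t < f x} * indicator {0<..<1} t \<partial>lborel)"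
proof -
  have "emeasure lborel {0<..<f x} = ennreal (f x)" for x
    using f by simp
  then have "ennreal (f x) = (\<integral>\<^sup>+t. indicator {0<..<f x} t \<partial>lborel)" for x
    by (subst nn_integral_indicator) auto
  then have "(\<integral>\<^sup>+x. ennreal (f x) \<partial>lborel) = (\<integral>\<^sup>+x. \<integral>\<^sup>+t. indicator {p \<in> space (lborel \<Otimes>\<^sub>M lborel). snd p < f (fst p) \<and> 0 < snd p \<and> snd p < 1} (x, t) \<partial>lborel \<partial>lborel)"
    using f(2) by (auto intro!: nn_integral_cong simp: indicator_def space_pair_measure dest: less_le_trans[OF _ f(2)])
  also have "\<dots> = (\<integral>\<^sup>+t. \<integral>\<^sup>+x. indicator {p \<in> space (lborel \<Otimes>\<^sub>M lborel). snd p < f (fst p) \<and> 0 < snd p \<and> snd p < 1} (x, t) \<partial>lborel \<partial>lborel)"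
    by (rule lborel_pair.Fubini'[symmetric]) measurable
  also have "\<dots> = (\<integral>\<^sup>+t. \<integral>\<^sup>+x. indicator {x. t < f x} x * indicator {0<..<1} t \<partial>lborel \<partial>lborel)"
    by (intro nn_integral_cong) (auto simp: indicator_def space_pair_measure)
  also have "\<dots> = (\<integral>\<^sup>+t. emeasure lborel {x. t < f x} * indicator {0<..<1} t \<partial>lborel)"
    by (intro nn_integral_cong) (simp add: nn_integral_multc)
  finally show ?thesis .
qed

text \<open>Only levels below \<open>k\<close> are counted, so the left-hand side is the integral of
  the minimum of \<open>h\<close> and \<open>k\<close>. Infinite values of \<open>h\<close> cause no
  trouble in this form.\<close>

lemma nn_integral_layer_le:
  fixes h :: "real \<Rightarrow> ennreal"
  assumes [measurable]: "h \<in> borel_measurable borel" and k: "k > 0"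
  shows "ennreal k * (\<integral>\<^sup>+t. emeasure lborel {x. ennreal (k * t) < h x} * indicator {0<..<1} t \<partial>lborel) \<le> (\<integral>\<^sup>+x. h x \<partial>lborel)"
proof -
  have *: "ennreal k * (\<integral>\<^sup>+t. indicator {t. ennreal (k * t) < v \<and> 0 < t \<and> t < 1} t \<partial>lborel) \<le> v" for v
  proof (cases v rule: ennreal_cases)
    case (real r)
    have "emeasure lborel {t. ennreal (k * t) < v \<and> 0 < t \<and> t < 1} \<le> emeasure lborel {0..r/k}"
      using real k by (intro emeasure_mono) (auto simp: ennreal_less_iff field_simps)
    also have "\<dots> = ennreal (r / k)" using real k by simp
    finally have "ennreal k * emeasure lborel {t. ennreal (k * t) < v \<and> 0 < t \<and> t < 1} \<le> ennreal k * ennreal (r / k)"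
      by (rule mult_left_mono) simp
    also have "\<dots> = v" using k real by (simp flip: ennreal_mult)
    finally show ?thesis by simp
  qed simp
  have "(\<integral>\<^sup>+t. emeasure lborel {x. ennreal (k * t) < h x} * indicator {0<..<1} t \<partial>lborel)
      = (\<integral>\<^sup>+t. \<integral>\<^sup>+x. indicator {x. ennreal (k * t) < h x} x * indicator {0<..<1} t \<partial>lborel \<partial>lborel)"
    by (intro nn_integral_cong) (simp add: nn_integral_multc)
  also have "\<dots> = (\<integral>\<^sup>+t. \<integral>\<^sup>+x. indicator {p \<in> space (lborel \<Otimes>\<^sub>M lborel). ennreal (k * snd p) < h (fst p) \<and> 0 < snd p \<and> snd p < 1} (x, t) \<partial>lborel \<partial>lborel)"
    by (intro nn_integral_cong) (auto simp: indicator_def space_pair_measure)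
  also have "\<dots> = (\<integral>\<^sup>+x. \<integral>\<^sup>+t. indicator {p \<in> space (lborel \<Otimes>\<^sub>M lborel). ennreal (k * snd p) < h (fst p) \<and> 0 < snd p \<and> snd p < 1} (x, t) \<partial>lborel \<partial>lborel)"
    by (rule lborel_pair.Fubini') measurable
  also have "\<dots> = (\<integral>\<^sup>+x. \<integral>\<^sup>+t. indicator {t. ennreal (k * t) < h x \<and> 0 < t \<and> t < 1} t \<partial>lborel \<partial>lborel)"
    by (intro nn_integral_cong) (auto simp: indicator_def space_pair_measure)
  finally have "ennreal k * (\<integral>\<^sup>+t. emeasure lborel {x. ennreal (k * t) < h x} * indicator {0<..<1} t \<partial>lborel)
      = (\<integral>\<^sup>+x. ennreal k * (\<integral>\<^sup>+t. indicator {t. ennreal (k * t) < h x \<and> 0 < t \<and> t < 1} t \<partial>lborel) \<partial>lborel)"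
    by (subst nn_integral_cmult) auto
  also have "\<dots> \<le> (\<integral>\<^sup>+x. h x \<partial>lborel)"
    by (intro nn_integral_mono *)
  finally show ?thesis .
qed

text \<open>After division by their suprema \<open>a\<close> and \<open>b\<close>, both functions
  have nonempty level sets at every \<open>t\<close> between 0 and 1, as the one-dimensional
  Brunn-Minkowski inequality requires; bounded supports make these sets bounded. The hypothesis
  places the midpoints of \<open>A t\<close> and \<open>B t\<close> in \<open>C t\<close>.
  Integration over \<open>t\<close> bounds the sum of the two normalised integrals, whence their
  product. The squared form avoids roots of extended reals.\<close>

lemma prekopa_leindler_real:
  fixes f g h :: "real \<Rightarrow> ennreal"
  assumes [measurable]: "f \<in> borel_measurable borel" "g \<in> borel_measurable borel" "h \<in> borel_measurable borel"
    and bound: "\<And>x. f x \<le> ennreal M" "\<And>x. g x \<le> ennreal M"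
    and supp: "\<And>x. R < \<bar>x\<bar> \<Longrightarrow> f x = 0" "\<And>x. R < \<bar>x\<bar> \<Longrightarrow> g x = 0"
    and h: "\<And>x y. f x * g y \<le> (h ((x + y) / 2))\<^sup>2"
  shows "(\<integral>\<^sup>+x. f x \<partial>lborel) * (\<integral>\<^sup>+x. g x \<partial>lborel) \<le> (\<integral>\<^sup>+x. h x \<partial>lborel)\<^sup>2"
proof -
  define f' where "f' x = enn2real (f x)" for x
  define g' where "g' x = enn2real (g x)" for x
  have ff: "f x = ennreal (f' x)" and gg: "g x = ennreal (g' x)" for x
    using le_less_trans[OF bound(1) ennreal_less_top] le_less_trans[OF bound(2) ennreal_less_top]
    by (simp_all add: f'_def g'_def)
  have nn: "0 \<le> f' x" "0 \<le> g' x" for x by (auto simp: f'_def g'_def)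
  have [measurable]: "f' \<in> borel_measurable borel" "g' \<in> borel_measurable borel"
    unfolding f'_def g'_def by measurable
  define a where "a = (SUP x. f' x)"
  define b where "b = (SUP x. g' x)"
  have bdd: "bdd_above (range f')" "bdd_above (range g')"
  proof -
    have "f' x \<le> max 0 M" "g' x \<le> max 0 M" for x
      unfolding f'_def g'_def
      by (intro enn2real_leI order_trans[OF bound(1)] order_trans[OF bound(2)] ennreal_leI; simp)+
    then show "bdd_above (range f')" "bdd_above (range g')"
      by (auto simp: bdd_above_def)
  qed
  have le_a: "f' x \<le> a" and le_b: "g' x \<le> b" for x
    by (auto simp: a_def b_def intro!: cSUP_upper bdd)
  show ?thesis
  proof (cases "a \<le> 0 \<or> b \<le> 0")
    case True
    then have "(\<forall>x. f x = 0) \<or> (\<forall>x. g x = 0)"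
      using le_a le_b nn ff gg by (metis antisym ennreal_0 order_trans)
    then show ?thesis by auto
  next
    case False
    then have ab: "a > 0" "b > 0" by auto
    \<comment> \<open>The geometric mean: levels \<open>t * a\<close> of \<open>f\<close> and
      \<open>t * b\<close> of \<open>g\<close> have the product \<open>(k * t)\<^sup>2\<close>,
      which is level \<open>k * t\<close> for \<open>h\<close>.\<close>
    define k where "k = sqrt (a * b)"
    have k: "k > 0" "k * k = a * b" using ab by (auto simp: k_def)
    define A where "A t = {x. t < f' x / a}" for t
    define B where "B t = {x. t < g' x / b}" for t
    define C where "C t = {x. ennreal (k * t) < h x}" for t
    have [measurable]: "A t \<in> sets borel" "B t \<in> sets borel" "C t \<in> sets borel" for t
      unfolding A_def B_def C_def by measurable
    have bm: "emeasure lborel (A t) + emeasure lborel (B t) \<le> 2 * emeasure lborel (C t)" if t: "0 < t" "t < 1" for t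
    proof (rule brunn_minkowski_real)
      have "t * a < a" "t * b < b" using t ab by auto
      then obtain x y where "t * a < f' x" "t * b < g' y"
        unfolding a_def b_def using less_cSUP_iff[OF _ bdd(1)] less_cSUP_iff[OF _ bdd(2)] by (metis UNIV_not_empty)
      then show "A t \<noteq> {}" "B t \<noteq> {}" using ab by (auto simp: A_def B_def field_simps)
      have "A t \<subseteq> {-R..R}" "B t \<subseteq> {-R..R}"
        using supp t by (force simp: A_def B_def f'_def g'_def abs_le_iff not_less[symmetric])+
      then show "bounded (A t)" "bounded (B t)" using bounded_closed_interval bounded_subset by blast+
    next
      fix x y assume "x \<in> A t" "y \<in> B t"
      then have "t * a < f' x" "t * b < g' y" using ab by (auto simp: A_def B_def field_simps)
      then have "(t * a) * (t * b) < f' x * g' y"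
        using mult_pos_pos[OF t(1) ab(1)] mult_pos_pos[OF t(1) ab(2)]
        by (intro mult_strict_mono) auto
      then have "(k * t)\<^sup>2 < f' x * g' y"
        using k(2) by (simp add: power2_eq_square mult_ac) (simp add: mult.assoc[symmetric])
      then have "ennreal ((k * t)\<^sup>2) < f x * g y"
        using nn by (simp add: ff gg ennreal_less_iff flip: ennreal_mult)
      then have "(ennreal (k * t))\<^sup>2 < (h ((x + y) / 2))\<^sup>2"
        using h[of x y] k t by (simp add: ennreal_power)
      then show "(x + y) / 2 \<in> C t"
        using power_mono[of "h ((x + y) / 2)" "ennreal (k * t)" 2] by (auto simp: C_def not_less[symmetric])
    qed auto
    define X where "X = (\<integral>\<^sup>+x. ennreal (f' x / a) \<partial>lborel)"
    define Y where "Y = (\<integral>\<^sup>+x. ennreal (g' x / b) \<partial>lborel)"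
    define Z where "Z = (\<integral>\<^sup>+x. h x \<partial>lborel)"
    have X: "(\<integral>\<^sup>+x. f x \<partial>lborel) = ennreal a * X"
      unfolding X_def using ab nn by (subst nn_integral_cmult[symmetric]) (auto simp: ff[abs_def] ennreal_mult[symmetric])
    have Y: "(\<integral>\<^sup>+x. g x \<partial>lborel) = ennreal b * Y"
      unfolding Y_def using ab nn by (subst nn_integral_cmult[symmetric]) (auto simp: gg[abs_def] ennreal_mult[symmetric])
    have "X + Y = (\<integral>\<^sup>+t. emeasure lborel (A t) * indicator {0<..<1} t \<partial>lborel)
        + (\<integral>\<^sup>+t. emeasure lborel (B t) * indicator {0<..<1} t \<partial>lborel)"
      unfolding X_def Y_def A_def B_def using ab nn le_a le_b by (subst (1 2) nn_integral_layer_unit) auto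
    also have "\<dots> = (\<integral>\<^sup>+t. emeasure lborel (A t) * indicator {0<..<1} t + emeasure lborel (B t) * indicator {0<..<1} t \<partial>lborel)"
      unfolding A_def B_def by (rule nn_integral_add[symmetric]) measurable
    also have "\<dots> \<le> (\<integral>\<^sup>+t. 2 * (emeasure lborel (C t) * indicator {0<..<1} t) \<partial>lborel)"
      using bm by (intro nn_integral_mono) (auto simp: indicator_def)
    also have "\<dots> = 2 * (\<integral>\<^sup>+t. emeasure lborel (C t) * indicator {0<..<1} t \<partial>lborel)"
      unfolding C_def by (rule nn_integral_cmult) measurable
    finally have XY: "X + Y \<le> 2 * (\<integral>\<^sup>+t. emeasure lborel (C t) * indicator {0<..<1} t \<partial>lborel)" .
    have "ennreal k * (X + Y) \<le> 2 * (ennreal k * (\<integral>\<^sup>+t. emeasure lborel (C t) * indicator {0<..<1} t \<partial>lborel))"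
      using mult_left_mono[OF XY, of "ennreal k"] by (simp add: mult.left_commute)
    also have "\<dots> \<le> 2 * Z"
      unfolding C_def Z_def using k by (intro mult_left_mono nn_integral_layer_le) auto
    finally have main: "ennreal k * (X + Y) \<le> 2 * Z" .
    show ?thesis
    proof (cases "Z = top")
      case False
      then have "X + Y \<noteq> top"
        using main k by (auto simp: ennreal_mult_eq_top_iff top_unique ennreal_mult_top)
      then obtain x y z where r: "X = ennreal x" "Y = ennreal y" "Z = ennreal z" "x \<ge> 0" "y \<ge> 0" "z \<ge> 0"
        using False by (cases X; cases Y; cases Z) auto
      have "ennreal (k * (x + y)) \<le> ennreal (2 * z)"
        using main r k by (simp add: ennreal_mult ennreal_plus)
      then have "k * (x + y) \<le> 2 * z" using r by (simp add: ennreal_le_iff)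
      then have "(k * (x + y))\<^sup>2 \<le> (2 * z)\<^sup>2" using k r by (intro power_mono) auto
      \<comment> \<open>The inequality of arithmetic and geometric means turns the bound on the sum
        into one on the product.\<close>
      moreover have "4 * (x * y) \<le> (x + y)\<^sup>2"
        using zero_le_power2[of "x - y"] by (simp add: power2_eq_square algebra_simps)
      then have "k * k * (4 * (x * y)) \<le> k * k * (x + y)\<^sup>2"
        by (intro mult_left_mono) simp_all
      moreover have "(k * (x + y))\<^sup>2 = k * k * (x + y)\<^sup>2" "(2 * z)\<^sup>2 = 4 * z\<^sup>2"
        by (simp_all add: power2_eq_square algebra_simps)
      moreover have "k * k * (4 * (x * y)) = 4 * (a * x * (b * y))"
        by (simp add: k(2))
      ultimately have "a * x * (b * y) \<le> z\<^sup>2"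
        by linarith
      then show ?thesis
        unfolding X Y Z_def[symmetric] r using r ab
        by (simp add: ennreal_mult[symmetric] ennreal_power ennreal_le_iff mult_ac)
    qed (simp add: Z_def power2_eq_square ennreal_top_mult)
  qed
qed

text \<open>Induction on the number of coordinates. For fixed values of the new coordinate the
  induction hypothesis applies to the fibres; it says that the fibre integrals \<open>F f\<close>,
  \<open>F g\<close> and \<open>F h\<close> satisfy the hypothesis of the one-dimensional
  inequality. The pointwise hypotheses range over all functions, so that they carry over to
  functions updated at one index.\<close>

lemma prekopa_leindler_PiM:
  fixes f g h :: "('i \<Rightarrow> real) \<Rightarrow> ennreal"
  assumes "finite I"
    and "f \<in> borel_measurable (Pi\<^sub>M I (\<lambda>_. lborel))" "g \<in> borel_measurable (Pi\<^sub>M I (\<lambda>_. lborel))"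
      "h \<in> borel_measurable (Pi\<^sub>M I (\<lambda>_. lborel))"
    and "\<And>x. f x \<le> ennreal M" "\<And>x. g x \<le> ennreal M"
    and "\<And>x i. i \<in> I \<Longrightarrow> R < \<bar>x i\<bar> \<Longrightarrow> f x = 0" "\<And>x i. i \<in> I \<Longrightarrow> R < \<bar>x i\<bar> \<Longrightarrow> g x = 0"
    and "\<And>x y. f x * g y \<le> (h (\<lambda>i. (x i + y i) / 2))\<^sup>2"
  shows "(\<integral>\<^sup>+x. f x \<partial>Pi\<^sub>M I (\<lambda>_. lborel)) * (\<integral>\<^sup>+x. g x \<partial>Pi\<^sub>M I (\<lambda>_. lborel)) \<le> (\<integral>\<^sup>+x. h x \<partial>Pi\<^sub>M I (\<lambda>_. lborel))\<^sup>2"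
  using assms
proof (induction I arbitrary: f g h rule: finite_induct)
  case empty
  interpret product_sigma_finite "\<lambda>_. lborel :: real measure" by standard
  \<comment> \<open>Without coordinates the measure sits at the constantly \<open>undefined\<close>
    function, which is its own midpoint.\<close>
  show ?case
    using empty.prems(8)[of "\<lambda>_. undefined" "\<lambda>_. undefined"] by (simp add: nn_integral_empty)
next
  case (insert i I)
  interpret product_sigma_finite "\<lambda>_. lborel :: real measure" by standard
  note [measurable] = insert.prems(1-3)
  define P where "P = Pi\<^sub>M I (\<lambda>_. lborel :: real measure)"
  define F where "F q y = (\<integral>\<^sup>+x. q (x(i := y)) \<partial>P)" for q :: "('i \<Rightarrow> real) \<Rightarrow> ennreal" and y
  interpret P: sigma_finite_measure P
    unfolding P_def by (rule sigma_finite) (rule insert.hyps)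
  have mF: "F q \<in> borel_measurable borel"
    if [measurable]: "q \<in> borel_measurable (Pi\<^sub>M (insert i I) (\<lambda>_. lborel))" for q :: "_ \<Rightarrow> ennreal"
  proof -
    have "(\<lambda>(y, x). q (x(i := y))) \<in> borel_measurable (lborel \<Otimes>\<^sub>M P)"
      unfolding P_def by measurable
    then have "F q \<in> borel_measurable lborel"
      unfolding F_def by (rule P.borel_measurable_nn_integral)
    then show ?thesis by simp
  qed
  note [measurable] = mF[OF insert.prems(1)] mF[OF insert.prems(2)] mF[OF insert.prems(3)]
  have meas: "(\<lambda>x. q (x(i := y))) \<in> borel_measurable (Pi\<^sub>M I (\<lambda>_. lborel))"
    if [measurable]: "q \<in> borel_measurable (Pi\<^sub>M (insert i I) (\<lambda>_. lborel))" for q :: "_ \<Rightarrow> ennreal" and y :: real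
    by measurable
  \<comment> \<open>The fibre integral is at most \<open>M\<close> times the volume of the box
    containing the support, a finite number.\<close>
  have bnd: "F q y \<le> ennreal (enn2real (ennreal M * (\<Prod>j\<in>I. emeasure lborel {-R..R})))"
    if q: "\<And>x. q x \<le> ennreal M" "\<And>x j. j \<in> insert i I \<Longrightarrow> R < \<bar>x j\<bar> \<Longrightarrow> q x = 0" for q y
  proof -
    have "F q y \<le> (\<integral>\<^sup>+x. ennreal M * indicator (Pi\<^sub>E I (\<lambda>_. {-R..R})) x \<partial>P)"
      unfolding F_def
    proof (rule nn_integral_mono)
      fix x assume "x \<in> space P"
      then have x: "x \<in> extensional I" by (simp add: P_def space_PiM PiE_def)
      show "q (x(i := y)) \<le> ennreal M * indicator (Pi\<^sub>E I (\<lambda>_. {-R..R})) x"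
      proof (cases "\<exists>j\<in>I. R < \<bar>x j\<bar>")
        case True
        then obtain j where j: "j \<in> I" "R < \<bar>x j\<bar>" by auto
        then have "j \<noteq> i" using insert.hyps by auto
        then show ?thesis using q(2)[of j "x(i := y)"] j by simp
      next
        case False
        then have "x \<in> Pi\<^sub>E I (\<lambda>_. {-R..R})" using x by (auto simp: PiE_def abs_le_iff not_less)
        then show ?thesis using q(1) by simp
      qed
    qed
    also have "\<dots> = ennreal M * (\<Prod>j\<in>I. emeasure lborel {-R..R})"
      using insert.hyps unfolding P_def by (subst nn_integral_cmult_indicator) (auto simp: emeasure_PiM intro!: sets_PiM_I_finite)
    also have "\<dots> = ennreal (enn2real \<dots>)"
      by (intro ennreal_enn2real[symmetric]) (auto simp: ennreal_mult_eq_top_iff less_top[symmetric] power_eq_top_ennreal emeasure_lborel_Icc_eq)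
    finally show ?thesis .
  qed
  have "(\<integral>\<^sup>+y. F f y \<partial>lborel) * (\<integral>\<^sup>+y. F g y \<partial>lborel) \<le> (\<integral>\<^sup>+y. F h y \<partial>lborel)\<^sup>2"
  proof (rule prekopa_leindler_real)
    fix y show "F f y \<le> ennreal (enn2real (ennreal M * (\<Prod>j\<in>I. emeasure lborel {-R..R})))"
      "F g y \<le> ennreal (enn2real (ennreal M * (\<Prod>j\<in>I. emeasure lborel {-R..R})))"
      by (intro bnd insert.prems; simp)+
  next
    fix y :: real assume "R < \<bar>y\<bar>"
    then have "f (x(i := y)) = 0" "g (x(i := y)) = 0" for x
      by (auto intro!: insert.prems(6)[of i "x(i := y)"] insert.prems(7)[of i "x(i := y)"])
    then show "F f y = 0" "F g y = 0"
      by (simp_all add: F_def)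
  next
    fix y z :: real
    show "F f y * F g z \<le> (F h ((y + z) / 2))\<^sup>2"
      unfolding F_def P_def
    proof (rule insert.IH)
      fix a b :: "'i \<Rightarrow> real"
      have "(\<lambda>j. ((a(i := y)) j + (b(i := z)) j) / 2) = (\<lambda>j. (a j + b j) / 2)(i := (y + z) / 2)" by auto
      then show "f (a(i := y)) * g (b(i := z)) \<le> (h ((\<lambda>j. (a j + b j) / 2)(i := (y + z) / 2)))\<^sup>2"
        using insert.prems(8)[of "a(i := y)" "b(i := z)"] by metis
    next
      fix x :: "'i \<Rightarrow> real" and j assume "j \<in> I" "R < \<bar>x j\<bar>"
      then have "j \<noteq> i" using insert.hyps by auto
      then show "f (x(i := y)) = 0" "g (x(i := z)) = 0"
        using \<open>j \<in> I\<close> \<open>R < \<bar>x j\<bar>\<close>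
        by (auto intro!: insert.prems(6)[of j "x(i := y)"] insert.prems(7)[of j "x(i := z)"])
    qed (rule meas[OF insert.prems(1)] meas[OF insert.prems(2)] meas[OF insert.prems(3)] insert.prems(4) insert.prems(5))+
  qed auto
  then show ?case
    unfolding F_def P_def using insert.hyps by (simp add: product_nn_integral_insert_rev)
qed

text \<open>Prekopa-Leindler for indicator functions, in the coordinates of the standard basis. The
  multiplicative form suffices for the isodiametric inequality, where the two sets have equal
  volume.\<close>

lemma brunn_minkowski_midpoint:
  fixes A B C :: "'a::euclidean_space set"
  assumes [measurable]: "A \<in> sets borel" "B \<in> sets borel" "C \<in> sets borel"
    and bdd: "bounded A" "bounded B"
    and mid: "\<And>x y. x \<in> A \<Longrightarrow> y \<in> B \<Longrightarrow> (1/2) *\<^sub>R (x + y) \<in> C"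
  shows "emeasure lborel A * emeasure lborel B \<le> (emeasure lborel C)\<^sup>2"
proof -
  define T where "T f = (\<Sum>b\<in>Basis. f b *\<^sub>R b :: 'a)" for f
  have [measurable]: "T \<in> Pi\<^sub>M Basis (\<lambda>_. lborel) \<rightarrow>\<^sub>M borel" unfolding T_def by measurable
  have int: "(\<integral>\<^sup>+f. indicator S (T f) \<partial>Pi\<^sub>M Basis (\<lambda>_. lborel)) = emeasure lborel S" if [measurable]: "S \<in> sets borel" for S
  proof -
    have "emeasure lborel S = (\<integral>\<^sup>+x. indicator S x \<partial>distr (Pi\<^sub>M Basis (\<lambda>_. lborel)) borel T)"
      unfolding T_def by (subst lborel_eq) simp
    also have "\<dots> = (\<integral>\<^sup>+f. indicator S (T f) \<partial>Pi\<^sub>M Basis (\<lambda>_. lborel))"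
      by (rule nn_integral_distr) auto
    finally show ?thesis by simp
  qed
  obtain R where R: "\<And>x. x \<in> A \<union> B \<Longrightarrow> norm x \<le> R"
    using bdd bounded_iff[of "A \<union> B"] by auto
  have TR: "T f \<notin> A \<union> B" if "b \<in> Basis" "R < \<bar>f b\<bar>" for f b
  proof
    assume "T f \<in> A \<union> B"
    then have "\<bar>T f \<bullet> b\<bar> \<le> R" using R Basis_le_norm[OF that(1), of "T f"] by force
    moreover have "T f \<bullet> b = f b" using that(1) by (simp add: T_def)
    ultimately show False using that by simp
  qed
  have "(\<integral>\<^sup>+f. indicator A (T f) \<partial>Pi\<^sub>M Basis (\<lambda>_. lborel)) * (\<integral>\<^sup>+f. indicator B (T f) \<partial>Pi\<^sub>M Basis (\<lambda>_. lborel))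
      \<le> (\<integral>\<^sup>+f. indicator C (T f) \<partial>Pi\<^sub>M Basis (\<lambda>_. lborel))\<^sup>2"
  proof (rule prekopa_leindler_PiM[where M = 1 and R = R])
    fix x :: "'a \<Rightarrow> real" show "indicator A (T x) \<le> ennreal 1" "indicator B (T x) \<le> ennreal 1" by (auto simp: indicator_def)
  next
    fix x y :: "'a \<Rightarrow> real"
    have "T (\<lambda>i. (x i + y i) / 2) = (1/2) *\<^sub>R (T x + T y)"
      by (simp add: T_def scaleR_sum_right sum.distrib[symmetric] scaleR_add_left[symmetric])
    then show "indicator A (T x) * indicator B (T y) \<le> (indicator C (T (\<lambda>i. (x i + y i) / 2)) :: ennreal)\<^sup>2"
      using mid by (auto simp: indicator_def)
  next
    fix x :: "'a \<Rightarrow> real" and i :: 'a assume "i \<in> Basis" "R < \<bar>x i\<bar>"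
    then show "indicator A (T x) = (0::ennreal)" "indicator B (T x) = (0::ennreal)"
      using TR by auto
  qed auto
  then show ?thesis by (simp add: int)
qed

lemma emeasure_lborel_affine_image:
  fixes A :: "'a::euclidean_space set"
  assumes A: "compact A" and "c \<noteq> 0"
  shows "emeasure lborel ((\<lambda>x. t + c *\<^sub>R x) ` A) = ennreal (\<bar>c\<bar> ^ DIM('a)) * emeasure lborel A"
proof -
  have inj: "inj (\<lambda>x. t + c *\<^sub>R x)" using assms by (auto simp: inj_on_def)
  have [measurable]: "(\<lambda>x. t + c *\<^sub>R x) ` A \<in> sets borel"
    using A by (intro borel_closed compact_imp_closed compact_continuous_image continuous_intros)
  have "emeasure lborel ((\<lambda>x. t + c *\<^sub>R x) ` A)
      = emeasure (density (distr lborel borel (\<lambda>x. t + c *\<^sub>R x)) (\<lambda>_. \<bar>c\<bar>^DIM('a))) ((\<lambda>x. t + c *\<^sub>R x) ` A)"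
    using lborel_affine[OF assms(2), of t] by simp
  also have "\<dots> = ennreal (\<bar>c\<bar> ^ DIM('a)) * emeasure (distr lborel borel (\<lambda>x. t + c *\<^sub>R x)) ((\<lambda>x. t + c *\<^sub>R x) ` A)"
    by (subst emeasure_density) (auto simp: nn_integral_cmult)
  also have "emeasure (distr lborel borel (\<lambda>x. t + c *\<^sub>R x)) ((\<lambda>x. t + c *\<^sub>R x) ` A) = emeasure lborel A"
    by (subst emeasure_distr) (auto simp: inj_vimage_image_eq[OF inj])
  finally show ?thesis .
qed

text \<open>The midpoints of \<open>A\<close> and \<open>-A\<close> lie in the ball whose diameter is that of \<open>A\<close>.\<close>

lemma isodiametric:
  fixes A :: "'a::euclidean_space set"
  assumes "compact A" "A \<noteq> {}"
  shows "emeasure lborel A \<le> ennreal (unit_ball_vol (DIM('a)) * (diameter A / 2) ^ DIM('a))"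
proof -
  have [measurable]: "A \<in> sets borel" "uminus ` A \<in> sets borel"
    using assms by (auto intro!: borel_compact compact_negations)
  have "emeasure lborel (uminus ` A) = emeasure lborel A"
    using emeasure_lborel_affine_image[OF assms(1), of "-1" 0] by simp
  moreover have "emeasure lborel A * emeasure lborel (uminus ` A) \<le> (emeasure lborel (cball (0::'a) (diameter A / 2)))\<^sup>2"
  proof (rule brunn_minkowski_midpoint)
    fix x y assume "x \<in> A" "y \<in> uminus ` A"
    then have "norm (x + y) \<le> diameter A"
      using diameter_bounded_bound[OF compact_imp_bounded[OF assms(1)], of x "- y"] by (auto simp: dist_norm)
    then show "(1/2) *\<^sub>R (x + y) \<in> cball 0 (diameter A / 2)" by simp
  qed (use assms in \<open>auto intro!: compact_imp_bounded compact_negations\<close>)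
  ultimately have "(emeasure lborel A)\<^sup>2 \<le> (emeasure lborel (cball (0::'a) (diameter A / 2)))\<^sup>2"
    by (simp add: power2_eq_square)
  then have "emeasure lborel A \<le> emeasure lborel (cball (0::'a) (diameter A / 2))"
    by (cases "emeasure lborel A"; cases "emeasure lborel (cball (0::'a) (diameter A / 2))")
       (auto simp: ennreal_power ennreal_le_iff power2_le_iff_abs_le power2_eq_square ennreal_mult_top top_unique
          simp flip: ennreal_mult dest: power2_le_imp_le[unfolded power2_eq_square])
  also have "\<dots> = ennreal (unit_ball_vol (DIM('a)) * (diameter A / 2) ^ DIM('a))"
    using assms by (intro emeasure_cball) (auto intro!: diameter_ge_0 compact_imp_bounded)
  finally show ?thesis .
qed

text \<open>Closing a bounded covering set makes it compact and keeps its diameter, so the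
  isodiametric inequality bounds its volume by its weight. As this holds for every cover, any mesh
  will do, such as 1.\<close>

lemma lborel_le_hausdorff:
  fixes A :: "'a::euclidean_space set"
  assumes [measurable]: "A \<in> sets borel"
  shows "emeasure lborel A \<le> hausdorff DIM('a) A"
proof -
  have "emeasure lborel A \<le> hausdorff_pre DIM('a) 1 A"
    unfolding hausdorff_pre_def
  proof (rule INF_greatest, safe)
    fix F :: "nat \<Rightarrow> 'a set"
    assume cov: "A \<subseteq> (\<Union>i. F i)" and F: "\<forall>i. bounded (F i) \<and> diameter (F i) \<le> 1"
    have "emeasure lborel A \<le> emeasure lborel (\<Union>i. closure (F i))"
      using cov closure_subset by (intro emeasure_mono) (auto, blast)
    also have "\<dots> \<le> (\<Sum>i. emeasure lborel (closure (F i)))"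
      by (intro emeasure_subadditive_countably) auto
    also have "\<dots> \<le> (\<Sum>i. hausdorff_weight DIM('a) (F i))"
    proof (intro suminf_le)
      fix i
      show "emeasure lborel (closure (F i)) \<le> hausdorff_weight DIM('a) (F i)"
      proof (cases "F i = {}")
        case False
        then show ?thesis
          using isodiametric[of "closure (F i)"] F by (simp add: hausdorff_weight_def diameter_closure compact_closure)
      qed simp
    qed auto
    finally show "emeasure lborel A \<le> (\<Sum>i. hausdorff_weight DIM('a) (F i))" .
  qed
  also have "\<dots> \<le> hausdorff DIM('a) A"
    by (rule hausdorff_pre_le_hausdorff) simp
  finally show ?thesis .
qed

section \<open>Hausdorff measure in full dimension is Lebesgue measure\<close>

lemma hausdorff_weight_cball:
  fixes a :: "'a::euclidean_space"
  assumes "r > 0"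
  shows "hausdorff_weight DIM('a) (cball a r) = emeasure lborel (cball a r)"
  using assms by (simp add: hausdorff_weight_def diameter_cball emeasure_cball)

text \<open>Vitali's covering lemma selects disjoint balls inside an open set of small measure whose
  fivefold enlargements cover \<open>N\<close>. The lemma serves to dispose of the remainder that
  Vitali's covering theorem leaves uncovered.\<close>

lemma hausdorff_pre_null:
  fixes N :: "'a::euclidean_space set"
  assumes N: "N \<in> sets borel" "emeasure lborel N = 0" and \<delta>: "\<delta> > 0"
  shows "hausdorff_pre DIM('a) \<delta> N = 0"
proof -
  have "hausdorff_pre DIM('a) \<delta> N \<le> 0 + ennreal e" if e: "e > 0" for e :: real
  proof -
    define d where "d = DIM('a)"
    \<comment> \<open>The division by \<open>5 ^ d\<close> compensates for the enlargement of the
      balls.\<close>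
    obtain U where U: "open U" "N \<subseteq> U" "emeasure lborel (U - N) < ennreal (e / 5 ^ d)"
      using outer_regular_lborel[OF N(1), of "e / 5 ^ d"] e by auto
    have [measurable]: "U \<in> sets borel" "N \<in> sets borel" using U N by auto
    have "emeasure lborel U \<le> emeasure lborel (U - N) + emeasure lborel N"
      using U(2) by (intro order_trans[OF emeasure_mono emeasure_subadditive]) auto
    then have LU: "emeasure lborel U \<le> ennreal (e / 5 ^ d)"
      using U(3) N(2) by simp
    \<comment> \<open>An enlarged ball has diameter ten times the radius \<open>r\<close>, so it
      respects the mesh \<delta>.\<close>
    define K where "K = {(x, r). x \<in> N \<and> 0 < r \<and> r \<le> \<delta> / 10 \<and> cball x r \<subseteq> U}"
    have cov: "N \<subseteq> (\<Union>p\<in>K. cball (fst p) (snd p))"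
    proof
      fix x assume x: "x \<in> N"
      then obtain r where r: "r > 0" "cball x r \<subseteq> U"
        using U(2) bspec[OF open_contains_cball[THEN iffD1, OF U(1)], of x] that by blast
      have "cball x (min r (\<delta> / 10)) \<subseteq> cball x r" by (rule subset_cball) simp
      then have "(x, min r (\<delta> / 10)) \<in> K"
        using x r \<delta> by (auto simp: K_def)
      then show "x \<in> (\<Union>p\<in>K. cball (fst p) (snd p))"
        using r \<delta> by (intro UN_I[of "(x, min r (\<delta> / 10))"]) auto
    qed
    have Kr: "0 < snd p \<and> snd p \<le> \<delta> / 10" if "p \<in> K" for p using that by (auto simp: K_def)
    obtain C where C: "countable C" "C \<subseteq> K"
        "pairwise (\<lambda>i j. disjnt (cball (fst i) (snd i)) (cball (fst j) (snd j))) C"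
        "N \<subseteq> (\<Union>p\<in>C. cball (fst p) (5 * snd p))"
      by (rule Vitali_covering_lemma_cballs[where S = N and K = K and a = fst and r = snd and B = "\<delta> / 10"])
        (rule cov, erule Kr, rule that)
    have CU: "cball (fst p) (snd p) \<subseteq> U" if "p \<in> C" for p
      using subsetD[OF C(2) that] by (simp add: K_def case_prod_unfold)
    have r0: "snd p > 0" "snd p \<le> \<delta> / 10" if "p \<in> C" for p using that C(2) by (auto simp: K_def)
    have "hausdorff_pre d \<delta> N \<le> (\<integral>\<^sup>+p. hausdorff_weight d (cball (fst p) (5 * snd p)) \<partial>count_space C)"
    proof (rule hausdorff_pre_le_cover)
      fix p assume "p \<in> C"
      then show "diameter (cball (fst p) (5 * snd p)) \<le> \<delta>" using r0[of p] by (simp add: diameter_cball)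
    qed (use C \<delta> in auto)
    also have "\<dots> = (\<integral>\<^sup>+p. ennreal (5 ^ d) * emeasure lborel (cball (fst p) (snd p)) \<partial>count_space C)"
    proof (rule nn_integral_cong)
      fix p assume "p \<in> space (count_space C)"
      then have "snd p > 0" using r0 by simp
      then show "hausdorff_weight d (cball (fst p) (5 * snd p)) = ennreal (5 ^ d) * emeasure lborel (cball (fst p) (snd p))"
        unfolding d_def by (subst hausdorff_weight_cball)
          (auto simp: emeasure_cball ennreal_mult[symmetric] power_mult_distrib mult_ac)
    qed
    also have "\<dots> = ennreal (5 ^ d) * emeasure lborel (\<Union>p\<in>C. cball (fst p) (snd p))"
      using C by (subst emeasure_UN_countable) (auto simp: nn_integral_cmult disjoint_family_on_def pairwise_def disjnt_def)
    also have "\<dots> \<le> ennreal (5 ^ d) * emeasure lborel U"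
      by (intro mult_left_mono emeasure_mono UN_least CU) auto
    also have "\<dots> \<le> ennreal (5 ^ d) * ennreal (e / 5 ^ d)"
      using LU by (rule mult_left_mono) simp
    also have "\<dots> = ennreal e" using e by (simp flip: ennreal_mult)
    finally show ?thesis by (simp add: d_def)
  qed
  then have "hausdorff_pre DIM('a) \<delta> N \<le> 0" by (rule ennreal_le_epsilon)
  then show ?thesis by simp
qed

text \<open>A ball weighs exactly its volume. By Vitali's covering theorem, disjoint small balls
  inside an open set hardly larger than \<open>A\<close> fill \<open>A\<close> up to a null set, and
  null sets cost nothing.\<close>

lemma hausdorff_le_lborel:
  fixes A :: "'a::euclidean_space set"
  assumes A: "A \<in> sets borel"
  shows "hausdorff DIM('a) A \<le> emeasure lborel A"
  unfolding hausdorff_def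
proof (rule SUP_least, rule ennreal_le_epsilon)
  fix \<delta> e :: real assume "\<delta> \<in> {0<..}" and e: "e > 0"
  then have \<delta>: "\<delta> > 0" by simp
  obtain U where U: "open U" "A \<subseteq> U" "emeasure lborel (U - A) < ennreal e"
    using outer_regular_lborel[OF A e] by auto
  have [measurable]: "U \<in> sets borel" "A \<in> sets borel" using U A by auto
  have "emeasure lborel U \<le> emeasure lborel A + emeasure lborel (U - A)"
    using U(2) by (intro order_trans[OF emeasure_mono emeasure_subadditive]) auto
  also have "\<dots> \<le> emeasure lborel A + ennreal e" using U(3) by (intro add_left_mono) simp
  finally have LU: "emeasure lborel U \<le> emeasure lborel A + ennreal e" .
  define K where "K = {(x, r). 0 < r \<and> r \<le> \<delta> / 2 \<and> cball x r \<subseteq> U}"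
  have K: "\<exists>p. p \<in> K \<and> x \<in> cball (fst p) (snd p) \<and> snd p < d" if x: "x \<in> A" "0 < d" for x d
  proof -
    obtain r where r: "r > 0" "cball x r \<subseteq> U"
      using x U(2) bspec[OF open_contains_cball[THEN iffD1, OF U(1)], of x] that by blast
    have "cball x (min r (min (d / 2) (\<delta> / 2))) \<subseteq> cball x r" by (rule subset_cball) simp
    then have "(x, min r (min (d / 2) (\<delta> / 2))) \<in> K"
      using x r \<delta> by (auto simp: K_def)
    then show ?thesis
      using r \<delta> x by (intro exI[of _ "(x, min r (min (d / 2) (\<delta> / 2)))"]) auto
  qed
  have Kpos: "\<And>p. p \<in> K \<Longrightarrow> 0 < snd p" by (auto simp: K_def)
  obtain C where C: "countable C" "C \<subseteq> K"
      "pairwise (\<lambda>i j. disjnt (cball (fst i) (snd i)) (cball (fst j) (snd j))) C"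
      "negligible (A - (\<Union>p\<in>C. cball (fst p) (snd p)))"
    by (rule Vitali_covering_theorem_cballs[where S = A and K = K and a = fst and r = snd])
      (erule Kpos, erule (1) K, rule that)
  have CU: "cball (fst p) (snd p) \<subseteq> U" if "p \<in> C" for p
    using subsetD[OF C(2) that] by (simp add: K_def case_prod_unfold)
  define V where "V = (\<Union>p\<in>C. cball (fst p) (snd p))"
  have [measurable]: "V \<in> sets borel" unfolding V_def using C(1) by auto
  have "emeasure lborel (A - V) = 0"
    using C(4) by (simp add: V_def[symmetric] negligible_iff_emeasure0)
  then have null: "hausdorff_pre DIM('a) \<delta> (A - V) = 0"
    using \<delta> by (intro hausdorff_pre_null) auto
  have "hausdorff_pre DIM('a) \<delta> V \<le> (\<integral>\<^sup>+p. hausdorff_weight DIM('a) (cball (fst p) (snd p)) \<partial>count_space C)"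
  proof (rule hausdorff_pre_le_cover)
    fix p assume "p \<in> C"
    then have "0 < snd p" "snd p \<le> \<delta> / 2" using C(2) by (auto simp: K_def)
    then show "diameter (cball (fst p) (snd p)) \<le> \<delta>" by (simp add: diameter_cball)
  qed (use C \<delta> in \<open>auto simp: V_def\<close>)
  also have "\<dots> = (\<integral>\<^sup>+p. emeasure lborel (cball (fst p) (snd p)) \<partial>count_space C)"
    using C(2) Kpos by (intro nn_integral_cong hausdorff_weight_cball) auto
  also have "\<dots> = emeasure lborel V"
    unfolding V_def using C by (subst emeasure_UN_countable) (auto simp: disjoint_family_on_def pairwise_def disjnt_def)
  also have "\<dots> \<le> emeasure lborel U"
    unfolding V_def by (intro emeasure_mono UN_least CU) auto
  finally have V: "hausdorff_pre DIM('a) \<delta> V \<le> emeasure lborel A + ennreal e" using LU by simp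
  have "hausdorff_pre DIM('a) \<delta> A \<le> hausdorff_pre DIM('a) \<delta> (V \<union> (A - V))"
    by (rule hausdorff_pre_mono) auto
  also have "\<dots> \<le> hausdorff_pre DIM('a) \<delta> V + hausdorff_pre DIM('a) \<delta> (A - V)"
    using \<delta> by (intro hausdorff_pre_Un) simp
  also have "\<dots> \<le> emeasure lborel A + ennreal e" using V null by simp
  finally show "hausdorff_pre DIM('a) \<delta> A \<le> emeasure lborel A + ennreal e" .
qed

lemma hausdorff_eq_lborel:
  fixes A :: "'a::euclidean_space set"
  assumes "A \<in> sets borel"
  shows "hausdorff DIM('a) A = emeasure lborel A"
  using lborel_le_hausdorff hausdorff_le_lborel assms by (intro antisym) auto

section \<open>Prisms over subsets of a hyperplane\<close>

text \<open>\<open>real ^ 'a hyp\<close> serves as a coordinate space for the hyperplanes of \<^typ>\<open>'a\<close>. In dimension 1 the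
  type would be empty; there it has one element and is not used.\<close>

typedef (overloaded) ('a::euclidean_space) hyp =
  "{b \<in> (Basis :: 'a set). b \<noteq> (SOME b. b \<in> Basis) \<or> DIM('a) = 1}"
proof (cases "DIM('a) = 1")
  case True
  then show ?thesis using SOME_Basis by auto
next
  case False
  then have "Basis \<noteq> {SOME b :: 'a. b \<in> Basis}" by (metis card_1_singleton_iff One_nat_def)
  then show ?thesis using nonempty_Basis by blast
qed

instance hyp :: (euclidean_space) finite
proof
  have "UNIV = Abs_hyp ` {b \<in> (Basis :: 'a set). b \<noteq> (SOME b. b \<in> Basis) \<or> DIM('a) = 1}"
    using Abs_hyp_cases by blast
  then show "finite (UNIV :: 'a hyp set)" by (rule ssubst) (intro finite_imageI, simp)
qed

lemma card_hyp:
  assumes "DIM('a::euclidean_space) \<ge> 2"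
  shows "DIM('a) = DIM(real ^ 'a hyp) + 1"
proof -
  have "CARD('a hyp) = card {b \<in> (Basis :: 'a set). b \<noteq> (SOME b. b \<in> Basis) \<or> DIM('a) = 1}"
    by (rule type_definition.card[OF type_definition_hyp])
  also have "{b \<in> (Basis :: 'a set). b \<noteq> (SOME b. b \<in> Basis) \<or> DIM('a) = 1} = Basis - {SOME b. b \<in> Basis}"
    using assms by auto
  also have "card \<dots> = DIM('a) - 1"
    using SOME_Basis by (rule card_Diff_singleton)
  finally show ?thesis using assms by simp
qed

text \<open>Since the dimensions agree, \<open>'b\<close> is isometric to the hyperplane orthogonal
  to \<open>a\<close>; the height above it becomes the second coordinate. Parallel hyperplanes turn
  into level sets of that coordinate.\<close>

lemma cartesian_hyperplane:
  fixes a :: "'a::euclidean_space"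
  assumes a: "norm a = 1" and dim: "DIM('a) = DIM('b::euclidean_space) + 1"
  obtains T :: "'b::euclidean_space \<times> real \<Rightarrow> 'a" and S where "linear T" "linear S" "\<And>p. norm (T p) = norm p"
    "\<And>p. S (T p) = p" "\<And>y. T (S y) = y" "\<And>x s. T (x, s) = T (x, 0) + s *\<^sub>R a" "\<And>x s. a \<bullet> T (x, s) = s"
proof -
  have aa: "a \<bullet> a = 1" using a by (simp add: dot_square_norm)
  have "dim (UNIV :: 'b set) = dim {x. a \<bullet> x = 0}"
    using dim a by (subst dim_hyperplane) auto
  then obtain f :: "'b \<Rightarrow> 'a" and g where fg: "linear f" "linear g" "f ` UNIV = {x. a \<bullet> x = 0}"
      "\<And>x. norm (f x) = norm x" "\<And>x. g (f x) = x" "\<And>x. a \<bullet> x = 0 \<Longrightarrow> f (g x) = x"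
    using isometries_subspaces[OF subspace_UNIV subspace_hyperplane, where 'a = 'b, of a thesis] by auto
  have af: "a \<bullet> f x = 0" for x using fg(3) by auto
  then have fa: "f x \<bullet> a = 0" for x by (simp add: inner_commute)
  define T where "T p = f (fst p) + snd p *\<^sub>R a" for p
  define S where "S y = (g (y - (a \<bullet> y) *\<^sub>R a), a \<bullet> y)" for y
  show ?thesis
  proof
    show "linear T" unfolding T_def
      by (intro linearI) (auto simp: linear_add[OF fg(1)] linear_scale[OF fg(1)] algebra_simps)
    show "linear S" unfolding S_def
      by (intro linearI) (auto simp: linear_add[OF fg(2)] linear_scale[OF fg(2)] linear_diff[OF fg(2)] algebra_simps inner_simps)
    fix p
    have "(norm (T p))\<^sup>2 = (norm (f (fst p)))\<^sup>2 + (snd p)\<^sup>2"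
      unfolding T_def power2_norm_eq_inner by (simp add: inner_simps af fa aa power2_eq_square)
    also have "\<dots> = (norm p)\<^sup>2"
      using fg(4) by (simp add: norm_prod_def)
    finally show "norm (T p) = norm p" by (simp add: power2_eq_iff_nonneg)
    show "S (T p) = p" using fg(5) by (simp add: T_def S_def inner_simps af aa)
  next
    fix y show "T (S y) = y" using fg(6) by (simp add: T_def S_def inner_simps aa)
  next
    fix x s show "T (x, s) = T (x, 0) + s *\<^sub>R a" "a \<bullet> T (x, s) = s"
      using linear_0[OF fg(1)] by (simp_all add: T_def inner_simps af aa)
  qed
qed

text \<open>Here measures of two dimensions meet. An isometry relates \<open>F\<close> to a subset
  of \<open>'b\<close>, whose Hausdorff measure is its Lebesgue measure, and the prism to a product
  set, whose volume factors.\<close>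

lemma prism_lift:
  fixes a :: "'a::euclidean_space" and F :: "'a set" and I :: "real set"
  assumes a: "norm a = 1" and dim: "DIM('a) = DIM('b::euclidean_space) + 1"
    and F: "F \<in> sets borel" "F \<subseteq> {x. a \<bullet> x = b}" and I: "I \<in> sets borel"
  shows "(\<lambda>(z, s). z + s *\<^sub>R a) ` (F \<times> I) \<in> sets borel" (is "?P \<in> _")
    "emeasure lborel ((\<lambda>(z, s). z + s *\<^sub>R a) ` (F \<times> I)) = hausdorff (DIM('a) - 1) F * emeasure lborel I"
proof -
  obtain T :: "'b \<times> real \<Rightarrow> 'a" and S where T: "linear T" "linear S" "\<And>p. norm (T p) = norm p"
    "\<And>p. S (T p) = p" "\<And>y. T (S y) = y" "\<And>x s. T (x, s) = T (x, 0) + s *\<^sub>R a" "\<And>x s. a \<bullet> T (x, s) = s"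
    by (rule cartesian_hyperplane[OF a dim]) (rule that)
  have distT: "dist (T p) (T q) = dist p q" for p q
    by (metis T(1,3) dist_norm linear_diff)
  have [measurable]: "T \<in> borel_measurable borel" "S \<in> borel_measurable borel"
    using T(1,2) by (auto intro!: borel_measurable_continuous_onI linear_continuous_on simp: linear_conv_bounded_linear)
  define F' where "F' = {x. T (x, b) \<in> F}"
  have F'T: "F = (\<lambda>x. T (x, b)) ` F'"
  proof safe
    fix z assume z: "z \<in> F"
    obtain x s where xs: "S z = (x, s)" by (cases "S z")
    then have "z = T (x, s)" by (metis T(5))
    moreover have "s = b" using z F(2) T(7)[of x s] calculation by auto
    ultimately show "z \<in> (\<lambda>x. T (x, b)) ` F'" using z by (auto simp: F'_def)
  qed (simp add: F'_def)
  have [measurable]: "F' \<in> sets borel"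
  proof -
    have "(\<lambda>x. T (x, b)) -` F \<inter> space borel \<in> sets borel"
      by (rule measurable_sets[OF _ F(1)]) measurable
    then show ?thesis by (simp add: F'_def vimage_def)
  qed
  \<comment> \<open>\<open>F\<close> lies at height \<open>b\<close>, and \<open>I\<close> counts
    heights from there.\<close>
  define f where "f p = T (p + (0, b))" for p
  have P: "?P = f ` (F' \<times> I)"
  proof -
    have "T (x, b) + s *\<^sub>R a = f (x, s)" for x s
      using T(6)[of x b] T(6)[of x "s + b"] by (simp add: f_def algebra_simps)
    then show ?thesis unfolding F'T by (force simp: image_iff)
  qed
  have "y = f (S y - (0, b))" "S (f p) - (0, b) = p" for y p
    by (simp_all add: f_def T(4,5))
  then have "?P = (\<lambda>y. S y - (0, b)) -` (F' \<times> I) \<inter> space borel"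
    unfolding P by (auto simp del: vimage_eq intro!: vimageI image_eqI)
  also have "\<dots> \<in> sets borel"
  proof (rule measurable_sets[of _ _ borel])
    have "F' \<times> I \<in> sets (borel \<Otimes>\<^sub>M borel)" using I by auto
    then show "F' \<times> I \<in> sets borel" unfolding borel_prod .
  qed measurable
  finally show "?P \<in> sets borel" .
  have FI: "F' \<times> I \<in> sets borel"
  proof -
    have "F' \<times> I \<in> sets (borel \<Otimes>\<^sub>M borel)" using I by auto
    then show ?thesis unfolding borel_prod .
  qed
  have "hausdorff (DIM('a) - 1) F = hausdorff DIM('b) F'"
    unfolding F'T using dim by (subst hausdorff_isometry) (auto simp: distT dist_Pair_Pair)
  then have HF: "hausdorff (DIM('a) - 1) F = emeasure lborel F'"
    by (simp add: hausdorff_eq_lborel)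
  have "emeasure lborel ?P = hausdorff DIM('a) ?P"
    by (rule hausdorff_eq_lborel[symmetric]) fact
  also have "\<dots> = hausdorff DIM('b \<times> real) (F' \<times> I)"
    unfolding P using dim by (subst hausdorff_isometry) (auto simp: f_def distT)
  also have "\<dots> = emeasure (lborel \<Otimes>\<^sub>M lborel) (F' \<times> I)"
    using hausdorff_eq_lborel[OF FI] by (simp only: lborel_prod)
  also have "\<dots> = emeasure lborel F' * emeasure lborel I"
    using I by (intro lborel.emeasure_pair_measure_Times) auto
  finally show "emeasure lborel ?P = hausdorff (DIM('a) - 1) F * emeasure lborel I"
    by (simp only: HF)
qed

text \<open>The hyperplanes of a line are its points, and no Euclidean space type has dimension 0 to
  serve as their coordinate space. Here \<open>F\<close> has at most one point and its
  zero-dimensional measure is a count. The case arises for the slices of planar bodies.\<close>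

lemma prism_lift_1:
  fixes a :: "'a::euclidean_space" and F :: "'a set" and I :: "real set"
  assumes a: "norm a = 1" and dim: "DIM('a) = 1"
    and F: "F \<subseteq> {x. a \<bullet> x = b}" and I: "I \<in> sets borel"
  shows "(\<lambda>(z, s). z + s *\<^sub>R a) ` (F \<times> I) \<in> sets borel" (is "?P \<in> _")
    "emeasure lborel ((\<lambda>(z, s). z + s *\<^sub>R a) ` (F \<times> I)) = hausdorff (DIM('a) - 1) F * emeasure lborel I"
proof -
  have "?P \<in> sets borel \<and> emeasure lborel ?P = hausdorff 0 F * emeasure lborel I"
  proof (cases "F = {}")
    case False
    have aa: "a \<bullet> a = 1" using a by (simp add: dot_square_norm)
    have "span {a} = UNIV"
      using dim a by (intro dim_eq_full[THEN iffD1]) auto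
    then have "\<exists>k. x = k *\<^sub>R a" for x :: 'a by (metis UNIV_I span_singleton rangeE)
    then have xa: "x = (a \<bullet> x) *\<^sub>R a" for x :: 'a
      using aa by (metis inner_scaleR_right mult.right_neutral)
    have "x = b *\<^sub>R a" if "x \<in> F" for x using xa[of x] F that by auto
    then have FS: "F = {b *\<^sub>R a}" using False by blast
    have HF: "hausdorff 0 F = 1" unfolding FS hausdorff_0 by simp
    define f where "f s = b *\<^sub>R a + s *\<^sub>R a" for s
    have P: "?P = f ` I" by (auto simp: FS f_def)
    have fy: "y = f (a \<bullet> (y - b *\<^sub>R a))" for y
      using xa[of "y - b *\<^sub>R a"] by (simp add: f_def algebra_simps)
    have "a \<bullet> (f s - b *\<^sub>R a) = s" for s
      using aa by (simp add: f_def)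
    then have "?P = (\<lambda>y. a \<bullet> (y - b *\<^sub>R a)) -` I \<inter> space borel"
      unfolding P using fy by auto
    also have "\<dots> \<in> sets borel" using I by measurable
    finally have m: "?P \<in> sets borel" .
    have "emeasure lborel ?P = hausdorff DIM('a) ?P"
      by (rule hausdorff_eq_lborel[symmetric]) fact
    also have "\<dots> = hausdorff DIM(real) I"
      unfolding P using dim a by (subst hausdorff_isometry) (auto simp: f_def dist_norm scaleR_diff_left[symmetric])
    also have "\<dots> = emeasure lborel I" using I by (rule hausdorff_eq_lborel)
    finally show ?thesis using m HF by simp
  qed simp
  then show "?P \<in> sets borel" "emeasure lborel ?P = hausdorff (DIM('a) - 1) F * emeasure lborel I"
    using dim by simp_all
qed

lemma prism:
  fixes a :: "'a::euclidean_space" and F :: "'a set" and I :: "real set"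
  assumes "norm a = 1" "F \<in> sets borel" "F \<subseteq> {x. a \<bullet> x = b}" "I \<in> sets borel"
  shows "(\<lambda>(z, s). z + s *\<^sub>R a) ` (F \<times> I) \<in> sets borel"
    "emeasure lborel ((\<lambda>(z, s). z + s *\<^sub>R a) ` (F \<times> I)) = hausdorff (DIM('a) - 1) F * emeasure lborel I"
proof -
  consider "DIM('a) = 1" | "DIM('a) \<ge> 2" using DIM_positive[where 'a = 'a] by linarith
  then have "(\<lambda>(z, s). z + s *\<^sub>R a) ` (F \<times> I) \<in> sets borel \<and>
    emeasure lborel ((\<lambda>(z, s). z + s *\<^sub>R a) ` (F \<times> I)) = hausdorff (DIM('a) - 1) F * emeasure lborel I"
  proof cases
    case 1 then show ?thesis using prism_lift_1 assms by metis
  next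
    case 2
    show ?thesis using prism_lift[OF assms(1) card_hyp[OF 2] assms(2-4)] by metis
  qed
  then show "(\<lambda>(z, s). z + s *\<^sub>R a) ` (F \<times> I) \<in> sets borel"
    "emeasure lborel ((\<lambda>(z, s). z + s *\<^sub>R a) ` (F \<times> I)) = hausdorff (DIM('a) - 1) F * emeasure lborel I" by auto
qed

section \<open>Surface area and parallel bodies of polytopes\<close>

definition surface :: "'a::euclidean_space set \<Rightarrow> ennreal" where
  "surface S = hausdorff (DIM('a) - 1) (frontier S)"

definition fatten :: "real \<Rightarrow> 'a::metric_space set \<Rightarrow> 'a set" where
  "fatten e S = (\<Union>x\<in>S. cball x e)"

text \<open>The normals themselves index the inequalities: distinct inequalities have distinct
  normals, and a parallel displacement of all facets is a shift of \<open>h\<close>. Redundant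
  inequalities are allowed, so \<open>h\<close> may exceed the support function.\<close>

definition halfspaces :: "'a::real_inner set \<Rightarrow> ('a \<Rightarrow> real) \<Rightarrow> 'a set" where
  "halfspaces A h = {x. \<forall>a\<in>A. a \<bullet> x \<le> h a}"

lemma fatten_mono: "S \<subseteq> T \<Longrightarrow> d \<le> e \<Longrightarrow> fatten d S \<subseteq> fatten e T"
  unfolding fatten_def by (intro UN_mono subset_cball)

lemma subset_fatten: "e \<ge> 0 \<Longrightarrow> S \<subseteq> fatten e S"
  by (auto simp: fatten_def)

lemma fatten_altdef:
  fixes S :: "'a::real_normed_vector set"
  shows "fatten e S = (\<lambda>(x, y). x + y) ` (S \<times> cball 0 e)"
proof safe
  fix x assume "x \<in> fatten e S"
  then obtain y where "y \<in> S" "dist y x \<le> e" by (auto simp: fatten_def)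
  then show "x \<in> (\<lambda>(x, y). x + y) ` (S \<times> cball 0 e)"
    by (intro image_eqI[of _ _ "(y, x - y)"]) (auto simp: dist_norm norm_minus_commute)
next
  fix x y :: 'a assume "x \<in> S" "y \<in> cball 0 e"
  then show "x + y \<in> fatten e S" unfolding fatten_def by (intro UN_I) (auto simp: dist_norm)
qed

lemma compact_fatten:
  fixes S :: "'a::euclidean_space set"
  assumes "compact S" shows "compact (fatten e S)"
  unfolding fatten_altdef case_prod_beta using assms
  by (intro compact_continuous_image compact_Times continuous_intros) auto

lemma convex_fatten:
  fixes S :: "'a::euclidean_space set"
  assumes "convex S" shows "convex (fatten e S)"
proof -
  have "fatten e S = (\<Union>x\<in>S. \<Union>y\<in>cball 0 e. {x + y})"
    by (auto simp: fatten_altdef)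
  then show ?thesis using convex_sums[OF assms convex_cball] by simp
qed

text \<open>As \<open>a\<close> is an outer normal at \<open>x\<close>, the mixed term in the
  expansion of the squared distance is nonnegative.\<close>

lemma closest_point_normal:
  fixes a :: "'a::euclidean_space"
  assumes "convex S" "closed S" "x \<in> S" and a: "\<And>w. w \<in> S \<Longrightarrow> a \<bullet> w \<le> a \<bullet> x" and "t \<ge> 0"
  shows "closest_point S (x + t *\<^sub>R a) = x"
proof (rule closest_point_unique[symmetric])
  show "\<forall>z\<in>S. dist (x + t *\<^sub>R a) x \<le> dist (x + t *\<^sub>R a) z"
  proof
    fix z assume z: "z \<in> S"
    have "(norm (x + t *\<^sub>R a - z))\<^sup>2 = (norm (x - z))\<^sup>2 + 2 * t * (a \<bullet> x - a \<bullet> z) + (norm (t *\<^sub>R a))\<^sup>2"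
      unfolding power2_norm_eq_inner by (simp add: inner_simps inner_commute algebra_simps)
    moreover have "0 \<le> 2 * t * (a \<bullet> x - a \<bullet> z)" using a[OF z] \<open>t \<ge> 0\<close> by simp
    ultimately have "(norm (t *\<^sub>R a))\<^sup>2 \<le> (norm (x + t *\<^sub>R a - z))\<^sup>2" by simp
    then show "dist (x + t *\<^sub>R a) x \<le> dist (x + t *\<^sub>R a) z"
      using power2_le_imp_le[OF _ norm_ge_zero] by (simp add: dist_norm)
  qed
qed (use assms in auto)

text \<open>A ray along an outer normal at a boundary point of \<open>D\<close> must leave the
  bounded set \<open>E\<close> through its frontier, and the nearest-point map of \<open>D\<close>
  takes the exit point back to the start. This map is 1-Lipschitz and cannot increase Hausdorff
  measure.\<close>

lemma surface_mono:
  fixes D E :: "'a::euclidean_space set"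
  assumes D: "convex D" "closed D" "interior D \<noteq> {}" and E: "bounded E" "D \<subseteq> E"
  shows "surface D \<le> surface E"
proof -
  have "D \<noteq> {}" using D(3) interior_subset by blast
  have "frontier D \<subseteq> closest_point D ` frontier E"
  proof
    fix x assume x: "x \<in> frontier D"
    have xD: "x \<in> D" using x D(2) frontier_subset_closed by blast
    have "x \<notin> rel_interior D"
      using x D(3) by (simp add: rel_interior_nonempty_interior frontier_def)
    then obtain a' where a': "a' \<noteq> 0" "\<And>y. y \<in> D \<Longrightarrow> a' \<bullet> x \<le> a' \<bullet> y"
      by (rule supporting_hyperplane_rel_boundary[OF D(1) xD]) (rule that)
    define a where "a = - a'"
    have a: "a \<noteq> 0" "\<And>y. y \<in> D \<Longrightarrow> a \<bullet> y \<le> a \<bullet> x" using a' by (auto simp: a_def)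
    obtain B0 where B0: "\<And>y. y \<in> E \<Longrightarrow> norm y \<le> B0"
      using E(1) by (auto simp: bounded_iff)
    define B where "B = B0 + norm x"
    have B: "norm (y - x) \<le> B" if "y \<in> E" for y
      using norm_triangle_ineq4[of y x] B0[OF that] by (simp add: B_def)
    have "B \<ge> 0" using B0[of x] xD E(2) norm_ge_zero[of x] unfolding B_def by (meson add_nonneg_nonneg order_trans subsetD)
    define T where "T = (\<lambda>t. x + t *\<^sub>R a) ` {0..}"
    have "connected T" unfolding T_def
      by (intro connected_continuous_image continuous_intros connected_Ici)
    moreover have "x \<in> T \<inter> E" using xD E(2) by (auto simp: T_def intro!: image_eqI[of _ _ 0])
    \<comment> \<open>Points of \<open>E\<close> are within distance \<open>B\<close> of
      \<open>x\<close>, whereas this point of the ray has distance \<open>B + 1\<close>.\<close>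
    moreover have "x + ((B + 1) / norm a) *\<^sub>R a \<in> T - E"
    proof
      show "x + ((B + 1) / norm a) *\<^sub>R a \<in> T" using \<open>B \<ge> 0\<close> by (auto simp: T_def)
      have "norm ((x + ((B + 1) / norm a) *\<^sub>R a) - x) = B + 1" using \<open>B \<ge> 0\<close> a by simp
      then show "x + ((B + 1) / norm a) *\<^sub>R a \<notin> E" using B by fastforce
    qed
    ultimately have "T \<inter> frontier E \<noteq> {}" by (intro connected_Int_frontier) auto
    then obtain t where "t \<ge> 0" "x + t *\<^sub>R a \<in> frontier E" by (auto simp: T_def)
    moreover have "closest_point D (x + t *\<^sub>R a) = x"
      using D(1,2) xD a(2) calculation(1) by (rule closest_point_normal)
    ultimately show "x \<in> closest_point D ` frontier E" by (intro image_eqI[of _ _ "x + t *\<^sub>R a"]) auto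
  qed
  then have "surface D \<le> hausdorff (DIM('a) - 1) (closest_point D ` frontier E)"
    unfolding surface_def by (rule hausdorff_mono)
  also have "\<dots> \<le> surface E"
    unfolding surface_def
    using hausdorff_lipschitz_image[of "frontier E" "closest_point D" 1 "DIM('a) - 1"]
      closest_point_lipschitz[OF D(1,2) \<open>D \<noteq> {}\<close>] by simp
  finally show ?thesis .
qed

lemma frontier_scaleR:
  fixes S :: "'a::euclidean_space set"
  assumes "c \<noteq> 0" shows "frontier ((*\<^sub>R) c ` S) = (*\<^sub>R) c ` frontier S"
proof -
  have "inj ((*\<^sub>R) c :: 'a \<Rightarrow> 'a)" using assms by (rule injective_scaleR)
  moreover have "interior ((*\<^sub>R) c ` S) = (*\<^sub>R) c ` interior S"
    using calculation by (intro interior_injective_linear_image) auto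
  ultimately show ?thesis
    by (simp add: frontier_def closure_scaleR[symmetric] image_set_diff)
qed

lemma surface_scaleR:
  fixes S :: "'a::euclidean_space set"
  assumes "c > 0" shows "surface ((*\<^sub>R) c ` S) \<le> ennreal (c ^ (DIM('a) - 1)) * surface S"
  unfolding surface_def frontier_scaleR[OF less_imp_neq[OF assms, symmetric]]
  using assms
  by (intro hausdorff_lipschitz_image) (unfold dist_norm scaleR_diff_right[symmetric] norm_scaleR, simp_all)

lemma emeasure_scaleR:
  fixes S :: "'a::euclidean_space set"
  assumes "c > 0" "compact S" shows "emeasure lborel ((*\<^sub>R) c ` S) = ennreal (c ^ DIM('a)) * emeasure lborel S"
  using emeasure_lborel_affine_image[OF assms(2), of c 0] assms(1) by simp

lemma fatten_scaleR:
  fixes S :: "'a::real_normed_vector set"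
  assumes "c > 0" shows "fatten (c * e) ((*\<^sub>R) c ` S) = (*\<^sub>R) c ` fatten e S"
proof -
  have *: "dist (c *\<^sub>R x) (c *\<^sub>R y) \<le> c * e \<longleftrightarrow> dist x y \<le> e" for x y :: 'a
  proof -
    have "dist (c *\<^sub>R x) (c *\<^sub>R y) = c * dist x y"
      using assms unfolding dist_norm scaleR_diff_right[symmetric] norm_scaleR by simp
    then show ?thesis using assms by simp
  qed
  show ?thesis
  proof safe
    fix y assume "y \<in> fatten (c * e) ((*\<^sub>R) c ` S)"
    then obtain x where x: "x \<in> S" "dist (c *\<^sub>R x) y \<le> c * e" by (auto simp: fatten_def)
    have y: "y = c *\<^sub>R (y /\<^sub>R c)" using assms by simp
    have "dist x (y /\<^sub>R c) \<le> e" by (subst *[symmetric], subst y[symmetric]) (rule x(2))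
    then have "y /\<^sub>R c \<in> fatten e S" using x(1) by (auto simp: fatten_def)
    with y show "y \<in> (*\<^sub>R) c ` fatten e S" by (rule image_eqI)
  next
    fix y assume "y \<in> fatten e S"
    then show "c *\<^sub>R y \<in> fatten (c * e) ((*\<^sub>R) c ` S)" using * by (auto simp: fatten_def)
  qed
qed

section \<open>Polytopes and prisms over their facets\<close>

lemma closed_halfspaces: "closed (halfspaces A h)"
proof -
  have "halfspaces A h = (\<Inter>a\<in>A. {x. a \<bullet> x \<le> h a})" by (auto simp: halfspaces_def)
  then show ?thesis by (simp add: closed_INT closed_halfspace_le)
qed

lemma convex_halfspaces: "convex (halfspaces A h)"
proof -
  have "halfspaces A h = (\<Inter>a\<in>A. {x. a \<bullet> x \<le> h a})" by (auto simp: halfspaces_def)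
  then show ?thesis by (simp add: convex_INT convex_halfspace_le)
qed

text \<open>Where all inequalities are strict they remain so nearby, as there are finitely
  many.\<close>

lemma frontier_halfspaces:
  fixes A :: "'a::euclidean_space set"
  assumes A: "finite A"
  shows "frontier (halfspaces A h) \<subseteq> (\<Union>a\<in>A. halfspaces A h \<inter> {x. a \<bullet> x = h a})"
proof
  fix x assume x: "x \<in> frontier (halfspaces A h)"
  then have xP: "x \<in> halfspaces A h" using frontier_subset_closed[OF closed_halfspaces] by blast
  define U where "U = (\<Inter>a\<in>A. {x. a \<bullet> x < h a})"
  have "open U" using A unfolding U_def by (intro open_INT) (auto simp: open_halfspace_lt)
  moreover have "U \<subseteq> halfspaces A h" by (force simp: U_def halfspaces_def)
  ultimately have "U \<subseteq> interior (halfspaces A h)" by (simp add: interior_maximal)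
  then have "x \<notin> U" using x by (auto simp: frontier_def)
  then show "x \<in> (\<Union>a\<in>A. halfspaces A h \<inter> {x. a \<bullet> x = h a})"
    using xP by (fastforce simp: U_def halfspaces_def)
qed

lemma facet_subset_frontier:
  fixes A :: "'a::euclidean_space set"
  assumes "a \<in> A" "a \<noteq> 0" "x \<in> halfspaces A h" "a \<bullet> x = h a"
  shows "x \<in> frontier (halfspaces A h)"
proof -
  have "x \<notin> interior (halfspaces A h)"
  proof
    assume "x \<in> interior (halfspaces A h)"
    then obtain e where e: "e > 0" "cball x e \<subseteq> halfspaces A h"
      using mem_interior_cball by blast
    then have "x + (e / norm a) *\<^sub>R a \<in> halfspaces A h"
      using assms(2) by (intro subsetD[OF e(2)]) (auto simp: dist_norm)
    then have "a \<bullet> (x + (e / norm a) *\<^sub>R a) \<le> h a" using assms(1) by (auto simp: halfspaces_def)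
    then have "(e / norm a) * (a \<bullet> a) \<le> 0" using assms(4) by (simp add: inner_simps)
    moreover have "(e / norm a) * (a \<bullet> a) > 0" using e assms(2) by simp
    ultimately show False by simp
  qed
  then show ?thesis using assms(3) closure_subset by (auto simp: frontier_def)
qed

text \<open>Erect disjoint prisms of height \<open>\<epsilon>\<close> on the facets: they are disjoint as the base point of
  a prism point is its closest point in the polytope.\<close>

lemma halfspaces_outer:
  fixes A :: "'a::euclidean_space set"
  assumes A: "finite A" "\<And>a. a \<in> A \<Longrightarrow> norm a = 1" and P: "compact (halfspaces A h)" and \<epsilon>: "\<epsilon> > 0"
  shows "emeasure lborel (halfspaces A h) + ennreal \<epsilon> * surface (halfspaces A h)
    \<le> emeasure lborel (fatten \<epsilon> (halfspaces A h))"
proof -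
  define P where "P = halfspaces A h"
  define F where "F a = P \<inter> {x. a \<bullet> x = h a}" for a
  \<comment> \<open>Leaving out height 0 keeps the prisms off the polytope itself.\<close>
  define Q where "Q a = (\<lambda>(z, s). z + s *\<^sub>R a) ` (F a \<times> {0<..\<epsilon>})" for a
  have cP: "closed P" "convex P" unfolding P_def by (rule closed_halfspaces convex_halfspaces)+
  have F: "F a \<in> sets borel" "F a \<subseteq> {x. a \<bullet> x = h a}" for a
    using cP unfolding F_def by (auto intro!: borel_closed closed_Int closed_hyperplane)
  have Q: "Q a \<in> sets borel" "emeasure lborel (Q a) = hausdorff (DIM('a) - 1) (F a) * ennreal \<epsilon>" if "a \<in> A" for a
    using prism[OF A(2)[OF that] F, of "{0<..\<epsilon>}"] \<epsilon> by (auto simp: Q_def)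
  have cl: "closest_point P (z + s *\<^sub>R a) = z" if "a \<in> A" "z \<in> F a" "s > 0" for a z s
    using cP that by (intro closest_point_normal) (auto simp: F_def P_def halfspaces_def)
  have disj: "Q a \<inter> Q c = {}" if ac: "a \<in> A" "c \<in> A" "a \<noteq> c" for a c
  proof (rule ccontr)
    assume "Q a \<inter> Q c \<noteq> {}"
    then obtain z s w t where zw: "z \<in> F a" "s > 0" "w \<in> F c" "t > 0" "z + s *\<^sub>R a = w + t *\<^sub>R c"
      by (auto simp: Q_def)
    then have "z = w" using cl[OF ac(1) zw(1,2)] cl[OF ac(2) zw(3,4)] by simp
    then have eq: "s *\<^sub>R a = t *\<^sub>R c" using zw(5) by simp
    then have "norm (s *\<^sub>R a) = norm (t *\<^sub>R c)" by simp
    then have "s = t" using zw(2,4) A(2) ac by simp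
    then show False using eq zw(2) ac(3) by simp
  qed
  have disjP: "P \<inter> Q a = {}" if "a \<in> A" for a
  proof (rule ccontr)
    assume "P \<inter> Q a \<noteq> {}"
    then obtain z s where zs: "z \<in> F a" "s > 0" "z + s *\<^sub>R a \<in> P" by (auto simp: Q_def)
    then have "a \<bullet> (z + s *\<^sub>R a) \<le> h a" using that by (auto simp: P_def halfspaces_def)
    then show False using zs A(2)[OF that] by (simp add: F_def inner_simps dot_square_norm)
  qed
  \<comment> \<open>The facets cover the frontier; overlaps are harmless, as an upper bound for the
    surface area is wanted here.\<close>
  have "surface P \<le> (\<Sum>a\<in>A. hausdorff (DIM('a) - 1) (F a))"
    unfolding surface_def
    using order_trans[OF hausdorff_mono[OF frontier_halfspaces[OF A(1)]] hausdorff_UN_finite[OF A(1)]]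
    by (simp add: P_def F_def)
  then have "emeasure lborel P + ennreal \<epsilon> * surface P \<le> emeasure lborel P + ennreal \<epsilon> * (\<Sum>a\<in>A. hausdorff (DIM('a) - 1) (F a))"
    by (intro add_left_mono mult_left_mono) auto
  also have "\<dots> = emeasure lborel P + (\<Sum>a\<in>A. emeasure lborel (Q a))"
    using Q by (simp add: sum_distrib_left mult.commute)
  also have "(\<Sum>a\<in>A. emeasure lborel (Q a)) = emeasure lborel (\<Union>a\<in>A. Q a)"
    using A(1) Q disj by (intro sum_emeasure) (auto simp: disjoint_family_on_def)
  also have "emeasure lborel P + \<dots> = emeasure lborel (P \<union> (\<Union>a\<in>A. Q a))"
    using A(1) Q disjP cP by (intro plus_emeasure) (auto intro!: sets.finite_UN)
  also have "\<dots> \<le> emeasure lborel (fatten \<epsilon> P)"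
  proof (rule emeasure_mono)
    have "Q a \<subseteq> fatten \<epsilon> P" if "a \<in> A" for a
      using A(2)[OF that] by (force simp: Q_def F_def fatten_def dist_norm)
    then show "P \<union> (\<Union>a\<in>A. Q a) \<subseteq> fatten \<epsilon> P" using subset_fatten[of \<epsilon> P] \<epsilon> by auto
    show "fatten \<epsilon> P \<in> sets lborel" using compact_fatten[OF P] by (auto simp: P_def intro: borel_compact)
  qed
  finally show ?thesis by (simp add: P_def)
qed

text \<open>A point of the inner layer projects into the facet whose hyperplane is nearest; points with two
  nearest hyperplanes form a null set. The facets are shrunk by \<open>\<sigma>\<close> to keep them at positive
  distance from each other.\<close>

lemma halfspaces_inner:
  fixes A :: "'a::euclidean_space set"
  assumes A: "finite A" "\<And>a. a \<in> A \<Longrightarrow> norm a = 1" and \<epsilon>: "\<epsilon> > 0"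
  shows "emeasure lborel (halfspaces A h)
    \<le> emeasure lborel (halfspaces A (\<lambda>a. h a - \<epsilon>)) + ennreal \<epsilon> * surface (halfspaces A h)"
proof -
  define P where "P = halfspaces A h"
  define Q where "Q = halfspaces A (\<lambda>a. h a - \<epsilon>)"
  have [measurable]: "P \<in> sets borel" "Q \<in> sets borel"
    unfolding P_def Q_def by (auto intro: borel_closed closed_halfspaces)
  define G where "G \<sigma> a = {x. a \<bullet> x = h a \<and> (\<forall>c\<in>A - {a}. c \<bullet> x \<le> h c - \<sigma>)}" for \<sigma> a
  \<comment> \<open>In \<open>W n\<close> the nearest hyperplane leads the others by at least
    \<open>1 / real (Suc n)\<close>. This lead becomes the shrinkage \<sigma> of the facets, and as
    \<open>n\<close> grows the sets exhaust the layer up to the null set \<open>N\<close>.\<close>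
  define W where "W n = {x \<in> P - Q. \<exists>a\<in>A. \<forall>c\<in>A - {a}. h a - a \<bullet> x + 1 / real (Suc n) \<le> h c - c \<bullet> x}" for n
  have W[measurable]: "W n \<in> sets borel" for n
  proof -
    have "W n = (P - Q) \<inter> (\<Union>a\<in>A. \<Inter>c\<in>A - {a}. {x. h a - a \<bullet> x + 1 / real (Suc n) \<le> h c - c \<bullet> x})"
      by (auto simp: W_def)
    also have "\<dots> \<in> sets borel"
      using A(1) by (intro sets.Int sets.Diff borel_closed[OF closed_UN] ballI closed_INT closed_Collect_le continuous_intros) auto
    finally show ?thesis .
  qed
  have Wle: "emeasure lborel (W n) \<le> ennreal \<epsilon> * surface P" for n
  proof -
    define \<sigma> where "\<sigma> = 1 / real (Suc n)"
    have \<sigma>: "\<sigma> > 0" by (simp add: \<sigma>_def)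
    have G: "G \<sigma> a \<in> sets borel" "G \<sigma> a \<subseteq> {x. a \<bullet> x = h a}" for a
    proof -
      have "G \<sigma> a = {x. a \<bullet> x = h a} \<inter> halfspaces (A - {a}) (\<lambda>c. h c - \<sigma>)"
        by (auto simp: G_def halfspaces_def)
      then show "G \<sigma> a \<in> sets borel" by (auto intro: borel_closed closed_Int closed_hyperplane closed_halfspaces)
    qed (auto simp: G_def)
    have GP: "G \<sigma> a \<subseteq> frontier P" if "a \<in> A" for a
    proof
      fix x assume x: "x \<in> G \<sigma> a"
      have "c \<bullet> x \<le> h c" if "c \<in> A" for c
        using x \<sigma> that by (cases "c = a") (force simp: G_def)+
      then show "x \<in> frontier P" unfolding P_def
        using A(2)[OF \<open>a \<in> A\<close>] x \<open>a \<in> A\<close> by (intro facet_subset_frontier[of a]) (auto simp: halfspaces_def G_def)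
    qed
    have sep: "\<sigma> \<le> dist x y" if "a \<in> A" "c \<in> A" "a \<noteq> c" "x \<in> G \<sigma> a" "y \<in> G \<sigma> c" for a c x y
    proof -
      have "\<sigma> \<le> a \<bullet> (x - y)" using that by (force simp: G_def inner_simps)
      also have "\<dots> \<le> norm a * norm (x - y)" by (rule norm_cauchy_schwarz)
      finally show ?thesis using A(2)[OF that(1)] by (simp add: dist_norm)
    qed
    have "W n \<subseteq> (\<Union>a\<in>A. (\<lambda>(z, s). z + s *\<^sub>R a) ` (G \<sigma> a \<times> {-\<epsilon>..0}))"
    proof
      fix x assume "x \<in> W n"
      then obtain a where x: "x \<in> P" "x \<notin> Q" "a \<in> A" "\<And>c. c \<in> A - {a} \<Longrightarrow> h a - a \<bullet> x + \<sigma> \<le> h c - c \<bullet> x"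
        by (auto simp: W_def \<sigma>_def)
      define t where "t = h a - a \<bullet> x"
      obtain c where c: "c \<in> A" "c \<bullet> x > h c - \<epsilon>" using x(2) by (force simp: Q_def halfspaces_def)
      have t: "0 \<le> t" "t \<le> \<epsilon>"
      proof -
        show "0 \<le> t" using x(1,3) by (auto simp: t_def P_def halfspaces_def)
        \<comment> \<open>A point outside \<open>Q\<close> has some slack below \<epsilon>, and the
          slack \<open>t\<close> of the nearest hyperplane is no larger.\<close>
        show "t \<le> \<epsilon>" using x(4)[of c] c \<sigma> by (cases "c = a") (auto simp: t_def)
      qed
      have aa: "a \<bullet> a = 1" using A(2)[OF x(3)] by (simp add: dot_square_norm)
      have "x + t *\<^sub>R a \<in> G \<sigma> a"
        unfolding G_def
      proof (intro CollectI conjI ballI, goal_cases)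
        case 1
        show ?case using aa by (simp add: inner_simps t_def)
      next
        case (2 c)
        \<comment> \<open>Moving by \<open>t\<close> along \<open>a\<close> uses up at most
          \<open>t\<close> of the slack of another inequality, which was at least
          \<open>t + \<sigma>\<close>.\<close>
        have "c \<bullet> a \<le> 1" using norm_cauchy_schwarz[of c a] A(2)[of c] 2 A(2)[OF x(3)] by simp
        then have "t * (c \<bullet> a) \<le> t" using t(1) mult_left_mono[of "c \<bullet> a" 1 t] by simp
        then show ?case using x(4)[of c] 2 by (simp add: inner_simps t_def)
      qed
      then have "x \<in> (\<lambda>(z, s). z + s *\<^sub>R a) ` (G \<sigma> a \<times> {-\<epsilon>..0})"
        using t by (intro image_eqI[of _ _ "(x + t *\<^sub>R a, - t)"]) auto
      then show "x \<in> (\<Union>a\<in>A. (\<lambda>(z, s). z + s *\<^sub>R a) ` (G \<sigma> a \<times> {-\<epsilon>..0}))"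
        using x(3) by blast
    qed
    then have "emeasure lborel (W n) \<le> emeasure lborel (\<Union>a\<in>A. (\<lambda>(z, s). z + s *\<^sub>R a) ` (G \<sigma> a \<times> {-\<epsilon>..0}))"
      using A(1) prism(1)[OF A(2) G] by (intro emeasure_mono) (auto intro!: sets.finite_UN)
    also have "\<dots> \<le> (\<Sum>a\<in>A. emeasure lborel ((\<lambda>(z, s). z + s *\<^sub>R a) ` (G \<sigma> a \<times> {-\<epsilon>..0})))"
      using A(1) prism(1)[OF A(2) G] by (intro emeasure_subadditive_finite) auto
    also have "\<dots> = (\<Sum>a\<in>A. hausdorff (DIM('a) - 1) (G \<sigma> a) * ennreal \<epsilon>)"
      using \<epsilon> by (intro sum.cong refl, subst prism(2)[OF A(2) G]) auto
    also have "\<dots> = ennreal \<epsilon> * (\<Sum>a\<in>A. hausdorff (DIM('a) - 1) (G \<sigma> a))"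
      by (simp add: sum_distrib_left mult.commute)
    also have "\<dots> \<le> ennreal \<epsilon> * surface P"
    proof (rule mult_left_mono)
      have "(\<Sum>a\<in>A. hausdorff (DIM('a) - 1) (G \<sigma> a)) \<le> hausdorff (DIM('a) - 1) (\<Union>a\<in>A. G \<sigma> a)"
      proof (rule hausdorff_UN_separated[OF A(1) \<sigma>])
        fix a c x y assume "a \<in> A" "c \<in> A" "a \<noteq> c" "x \<in> G \<sigma> a" "y \<in> G \<sigma> c"
        then show "\<sigma> \<le> dist x y" by (rule sep)
      qed
      also have "\<dots> \<le> surface P"
        unfolding surface_def by (intro hausdorff_mono UN_least GP)
      finally show "(\<Sum>a\<in>A. hausdorff (DIM('a) - 1) (G \<sigma> a)) \<le> surface P" .
    qed simp
    finally show ?thesis .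
  qed
  \<comment> \<open>Equal slacks for \<open>a\<close> and \<open>c\<close> describe a hyperplane
    with normal \<open>a - c\<close>, which is nonzero for distinct normals.\<close>
  define N where "N = (\<Union>a\<in>A. \<Union>c\<in>A - {a}. {x. (a - c) \<bullet> x = h a - h c})"
  have N: "N \<in> null_sets lborel"
  proof -
    have inner: "negligible (\<Union>c\<in>A - {a}. {x. (a - c) \<bullet> x = h a - h c})" for a
    proof (rule negligible_Union)
      show "finite ((\<lambda>c. {x. (a - c) \<bullet> x = h a - h c}) ` (A - {a}))" using A(1) by simp
      fix S assume "S \<in> (\<lambda>c. {x. (a - c) \<bullet> x = h a - h c}) ` (A - {a})"
      then obtain c where c: "c \<in> A - {a}" and S: "S = {x. (a - c) \<bullet> x = h a - h c}" by (rule imageE)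
      show "negligible S" unfolding S using c by (intro negligible_hyperplane) auto
    qed
    have "negligible N" unfolding N_def
    proof (rule negligible_Union)
      fix S assume "S \<in> (\<lambda>a. \<Union>c\<in>A - {a}. {x. (a - c) \<bullet> x = h a - h c}) ` A"
      then obtain a where S: "S = (\<Union>c\<in>A - {a}. {x. (a - c) \<bullet> x = h a - h c})" by (rule imageE)
      show "negligible S" unfolding S by (rule inner)
    qed (use A(1) in simp)
    moreover have "N \<in> sets borel" unfolding N_def
      using A(1) by (intro sets.finite_UN finite_Diff borel_closed closed_hyperplane)
    ultimately show ?thesis by (simp add: negligible_iff_null_sets null_sets_completion_iff)
  qed
  have inc: "incseq W"
  proof (rule incseq_SucI, rule subsetI)
    fix n x assume "x \<in> W n"
    then obtain a where a: "a \<in> A" "\<And>c. c \<in> A - {a} \<Longrightarrow> h a - a \<bullet> x + 1 / real (Suc n) \<le> h c - c \<bullet> x" "x \<in> P - Q"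
      unfolding W_def by blast
    have "1 / real (Suc (Suc n)) \<le> 1 / real (Suc n)" by (intro divide_left_mono) auto
    then have "h a - a \<bullet> x + 1 / real (Suc (Suc n)) \<le> h c - c \<bullet> x" if "c \<in> A - {a}" for c
      using a(2)[OF that] by linarith
    then show "x \<in> W (Suc n)" unfolding W_def using a(1,3) by blast
  qed
  have cov: "P - Q \<subseteq> (\<Union>n. W n) \<union> N"
  proof
    fix x assume x: "x \<in> P - Q"
    then obtain c0 where "c0 \<in> A" by (auto simp: Q_def halfspaces_def)
    then have "Min ((\<lambda>a. h a - a \<bullet> x) ` A) \<in> (\<lambda>a. h a - a \<bullet> x) ` A"
      using A(1) by (intro Min_in) auto
    then obtain a where a: "a \<in> A" "Min ((\<lambda>a. h a - a \<bullet> x) ` A) = h a - a \<bullet> x" by (rule imageE)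
    have amin: "h a - a \<bullet> x \<le> h c - c \<bullet> x" if "c \<in> A" for c
      unfolding a(2)[symmetric] using A(1) that by (intro Min_le) auto
    show "x \<in> (\<Union>n. W n) \<union> N"
    proof (cases "x \<in> N")
      case False
      have less: "h a - a \<bullet> x < h c - c \<bullet> x" if "c \<in> A - {a}" for c
      proof -
        have "(a - c) \<bullet> x \<noteq> h a - h c" using False a(1) that by (auto simp: N_def)
        then have "h a - a \<bullet> x \<noteq> h c - c \<bullet> x" by (simp add: inner_simps)
        then show ?thesis using amin[of c] that by simp
      qed
      define m where "m = Min (insert 1 ((\<lambda>c. (h c - c \<bullet> x) - (h a - a \<bullet> x)) ` (A - {a})))"
      have "m > 0" unfolding m_def using A(1) less by (subst Min_gr_iff) auto
      then obtain n where n: "1 / real (Suc n) < m" using nat_approx_posE by blast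
      have "m \<le> (h c - c \<bullet> x) - (h a - a \<bullet> x)" if "c \<in> A - {a}" for c
        unfolding m_def using A(1) that by (intro Min_le) auto
      then have "h a - a \<bullet> x + 1 / real (Suc n) \<le> h c - c \<bullet> x" if "c \<in> A - {a}" for c
        using n that by fastforce
      then have "x \<in> W n" using x a(1) unfolding W_def by blast
      then show ?thesis by blast
    qed simp
  qed
  have "emeasure lborel P \<le> emeasure lborel (Q \<union> ((\<Union>n. W n) \<union> N))"
    using cov null_setsD2[OF N] by (intro emeasure_mono) auto
  also have "\<dots> \<le> emeasure lborel Q + emeasure lborel ((\<Union>n. W n) \<union> N)"
    using null_setsD2[OF N] by (intro emeasure_subadditive) auto
  also have "emeasure lborel ((\<Union>n. W n) \<union> N) = emeasure lborel (\<Union>n. W n)"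
    using N by (intro emeasure_Un_null_set) auto
  also have "\<dots> = (SUP n. emeasure lborel (W n))"
    using inc by (intro SUP_emeasure_incseq[symmetric]) auto
  also have "\<dots> \<le> ennreal \<epsilon> * surface P" by (intro SUP_least Wle)
  finally show ?thesis by (simp add: P_def Q_def add_left_mono)
qed

section \<open>From polytopes to convex bodies\<close>

text \<open>Every frontier point of the dilate lies outside \<open>D\<close> and is cut off by a
  half-space containing \<open>D\<close>; by compactness finitely many of these cut off the whole
  frontier. Their intersection is connected, contains 0 and misses the frontier of the dilate, hence
  stays inside the dilate.\<close>

lemma halfspaces_approx:
  fixes D :: "'a::euclidean_space set"
  assumes D: "compact D" "convex D" and 0: "0 \<in> interior D" and \<eta>: "\<eta> > 0"
  obtains A h where "finite A" "\<And>a. a \<in> A \<Longrightarrow> norm a = 1" "D \<subseteq> halfspaces A h"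
    "halfspaces A h \<subseteq> (*\<^sub>R) (1 + \<eta>) ` D"
proof -
  define E where "E = (*\<^sub>R) (1 + \<eta>) ` D"
  have E: "compact E" unfolding E_def using D(1) by (rule compact_scaling)
  have DE: "D \<inter> frontier E = {}"
  proof (rule ccontr)
    assume "D \<inter> frontier E \<noteq> {}"
    then obtain x where x: "x \<in> D" "x \<in> frontier E" by auto
    then obtain d where d: "x = (1 + \<eta>) *\<^sub>R d" "d \<in> frontier D"
      unfolding E_def using \<eta> by (subst (asm) frontier_scaleR) auto
    \<comment> \<open>Shrinking \<open>x\<close> towards the interior point 0 by the factor
      \<open>1 / (1 + \<eta>)\<close> produces an interior point, yet the result is the frontier
      point \<open>d\<close>.\<close>
    have "x - (\<eta> / (1 + \<eta>)) *\<^sub>R (x - 0) \<in> interior D"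
      using D(2) 0 x(1) \<eta> by (intro mem_interior_convex_shrink) auto
    also have "x - (\<eta> / (1 + \<eta>)) *\<^sub>R (x - 0) = (1 - \<eta> / (1 + \<eta>)) *\<^sub>R x" by (simp add: algebra_simps)
    also have "\<dots> = ((1 - \<eta> / (1 + \<eta>)) * (1 + \<eta>)) *\<^sub>R d" by (simp add: d(1))
    also have "(1 - \<eta> / (1 + \<eta>)) * (1 + \<eta>) = 1" using \<eta> by (simp add: field_simps)
    finally show False using d(2) by (simp add: frontier_def)
  qed
  have "D \<noteq> {}" using 0 interior_subset by blast
  define h where "h a = (SUP x\<in>D. a \<bullet> x)" for a :: 'a
  have bdd: "bdd_above ((\<lambda>x. a \<bullet> x) ` D)" for a :: 'a
    by (intro bounded_imp_bdd_above compact_imp_bounded compact_continuous_image continuous_intros D(1))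
  have Dh: "D \<subseteq> halfspaces A h" for A
    using bdd by (auto simp: halfspaces_def h_def intro!: cSUP_upper)
  have cover: "frontier E \<subseteq> (\<Union>a\<in>sphere 0 1. {z. h a < a \<bullet> z})"
  proof
    fix y assume "y \<in> frontier E"
    then have "y \<notin> D" using DE by auto
    then obtain a b where ab: "a \<bullet> y < b" "\<forall>x\<in>D. a \<bullet> x > b"
      using separating_hyperplane_closed_point[OF D(2) compact_imp_closed[OF D(1)]] by blast
    have "a \<noteq> 0" using ab \<open>D \<noteq> {}\<close> by auto
    \<comment> \<open>The separating hyperplane has \<open>D\<close> on its upper side; the change
      of sign makes the normal point away from \<open>D\<close>.\<close>
    define c where "c = - (a /\<^sub>R norm a)"
    have "h c \<le> - b / norm a"
      unfolding h_def using \<open>D \<noteq> {}\<close>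
    proof (rule cSUP_least)
      fix x assume "x \<in> D"
      then have "a \<bullet> x > b" using ab by auto
      then show "c \<bullet> x \<le> - b / norm a" using \<open>a \<noteq> 0\<close> by (simp add: c_def field_simps)
    qed
    also have "\<dots> < c \<bullet> y" using ab \<open>a \<noteq> 0\<close> by (simp add: c_def field_simps)
    finally have "y \<in> {z. h c < c \<bullet> z}" by simp
    moreover have "c \<in> sphere 0 1" using \<open>a \<noteq> 0\<close> by (simp add: c_def)
    ultimately show "y \<in> (\<Union>a\<in>sphere 0 1. {z. h a < a \<bullet> z})" by blast
  qed
  have cf: "compact (frontier E)" using E compact_frontier by blast
  obtain A where A: "A \<subseteq> sphere 0 1" "finite A" "frontier E \<subseteq> (\<Union>a\<in>A. {z. h a < a \<bullet> z})"
    using cf cover by (rule compactE_image[OF _ open_halfspace_gt]) (rule that)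
  have "halfspaces A h \<subseteq> E"
  proof (rule ccontr)
    assume "\<not> halfspaces A h \<subseteq> E"
    moreover have "0 \<in> halfspaces A h \<inter> E"
      using 0 interior_subset Dh by (force simp: E_def image_iff)
    ultimately have "halfspaces A h \<inter> frontier E \<noteq> {}"
      by (intro connected_Int_frontier convex_connected convex_halfspaces) auto
    then show False using A(3) by (force simp: halfspaces_def)
  qed
  moreover have "norm a = 1" if "a \<in> A" for a using A(1) that by auto
  ultimately show ?thesis using A(2) Dh that[of A h] by (auto simp: E_def)
qed

text \<open>The errors of polytope approximation and of finite \<epsilon> are all collected in a
  factor \<open>(1 + \<eta>) ^ d\<close>, which tends to 1.\<close>

lemma ennreal_le_dilation_limit:
  fixes X Y :: ennreal
  assumes "\<And>\<eta>. \<eta> > 0 \<Longrightarrow> X \<le> ennreal ((1 + \<eta>) ^ d) * Y"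
  shows "X \<le> Y"
proof (cases Y rule: ennreal_cases)
  case (real y)
  have lim: "(\<lambda>n. ennreal ((1 + 1 / real (Suc n)) ^ d * y)) \<longlonglongrightarrow> ennreal ((1 + 0) ^ d * y)"
    by (intro tendsto_ennrealI tendsto_intros LIMSEQ_Suc[OF lim_1_over_n])
  have "X \<le> ennreal ((1 + 1 / real (Suc n)) ^ d * y)" for n
    using assms[of "1 / real (Suc n)"] real by (simp add: ennreal_mult)
  then have "X \<le> ennreal ((1 + 0) ^ d * y)" by (intro LIMSEQ_le_const[OF lim]) blast
  then show ?thesis using real by simp
qed simp

text \<open>Passing from \<open>D\<close> to a circumscribed polytope increases volume and surface
  area. The parallel body of a polytope inside the dilate of \<open>D\<close> lies in the dilate of
  the parallel body of \<open>D\<close>, which costs only a power of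
  \<open>1 + \<eta>\<close>.\<close>

lemma minkowski_lower_0:
  fixes D :: "'a::euclidean_space set"
  assumes D: "compact D" "convex D" "0 \<in> interior D" and \<epsilon>: "\<epsilon> > 0"
  shows "emeasure lborel D + ennreal \<epsilon> * surface D \<le> emeasure lborel (fatten \<epsilon> D)"
proof (rule ennreal_le_dilation_limit[where d = "DIM('a)"])
  fix \<eta> :: real assume \<eta>: "\<eta> > 0"
  obtain A h where A: "finite A" "\<And>a. a \<in> A \<Longrightarrow> norm a = 1" "D \<subseteq> halfspaces A h"
    "halfspaces A h \<subseteq> (*\<^sub>R) (1 + \<eta>) ` D"
    by (rule halfspaces_approx[OF D \<eta>]) (rule that)
  define P where "P = halfspaces A h"
  have P: "compact P"
    using compact_Int_closed[OF compact_scaling[OF D(1), of "1 + \<eta>"] closed_halfspaces[of A h]] A(4)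
    by (simp add: P_def inf.absorb2)
  have "emeasure lborel D + ennreal \<epsilon> * surface D \<le> emeasure lborel P + ennreal \<epsilon> * surface P"
    using A(3) D P by (intro add_mono mult_left_mono emeasure_mono surface_mono)
      (auto simp: P_def[symmetric] compact_imp_bounded compact_imp_closed borel_compact)
  also have "\<dots> \<le> emeasure lborel (fatten \<epsilon> P)"
    unfolding P_def using A P \<epsilon> by (intro halfspaces_outer) (auto simp: P_def)
  also have "\<dots> \<le> emeasure lborel (fatten ((1 + \<eta>) * \<epsilon>) ((*\<^sub>R) (1 + \<eta>) ` D))"
  proof (intro emeasure_mono fatten_mono)
    show "P \<subseteq> (*\<^sub>R) (1 + \<eta>) ` D" using A(4) by (simp add: P_def)
    show "\<epsilon> \<le> (1 + \<eta>) * \<epsilon>" using \<eta> \<epsilon> by (simp add: algebra_simps)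
    show "fatten ((1 + \<eta>) * \<epsilon>) ((*\<^sub>R) (1 + \<eta>) ` D) \<in> sets lborel"
      unfolding sets_lborel by (intro borel_compact compact_fatten compact_scaling D(1))
  qed
  also have "\<dots> = ennreal ((1 + \<eta>) ^ DIM('a)) * emeasure lborel (fatten \<epsilon> D)"
    using \<eta> D(1) by (simp add: fatten_scaleR emeasure_scaleR compact_fatten)
  finally show "emeasure lborel D + ennreal \<epsilon> * surface D \<le> ennreal ((1 + \<eta>) ^ DIM('a)) * emeasure lborel (fatten \<epsilon> D)" .
qed

text \<open>Moving the inequalities of a circumscribed polytope \<open>P\<close> outwards by
  \<epsilon> gives a set \<open>P'\<close> that contains the parallel body of \<open>D\<close>, and
  the layer between them has volume at most \<epsilon> times the surface area of \<open>P'\<close>.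
  The inner ball controls that area: right-hand sides are at least \<open>r\<close>, so adding
  \<epsilon> to them is at most a dilation by \<open>1 + \<epsilon> / r\<close>.\<close>

lemma minkowski_upper_0:
  fixes D :: "'a::euclidean_space set"
  assumes D: "compact D" "convex D" "cball 0 r \<subseteq> D" and r: "r > 0" and \<epsilon>: "\<epsilon> > 0"
  shows "emeasure lborel (fatten \<epsilon> D) \<le> emeasure lborel D + ennreal (\<epsilon> * (1 + \<epsilon> / r) ^ (DIM('a) - 1)) * surface D"
proof (rule ennreal_le_dilation_limit[where d = "DIM('a)"])
  fix \<eta> :: real assume \<eta>: "\<eta> > 0"
  define d where "d = DIM('a)"
  have 0: "0 \<in> interior D" using subsetD[OF interior_mono[OF D(3)], of 0] r by simp
  obtain A h where A: "finite A" "\<And>a. a \<in> A \<Longrightarrow> norm a = 1" "D \<subseteq> halfspaces A h"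
    "halfspaces A h \<subseteq> (*\<^sub>R) (1 + \<eta>) ` D"
    by (rule halfspaces_approx[OF D(1,2) 0 \<eta>]) (rule that)
  define P where "P = halfspaces A h"
  define P' where "P' = halfspaces A (\<lambda>a. h a + \<epsilon>)"
  define c where "c = 1 + \<epsilon> / r"
  have c: "c > 0" using r \<epsilon> by (simp add: c_def add_pos_pos)
  have hr: "r \<le> h a" if "a \<in> A" for a
  proof -
    have "r *\<^sub>R a \<in> halfspaces A h" using A(2)[OF that] r by (intro subsetD[OF A(3)] subsetD[OF D(3)]) auto
    then have "a \<bullet> (r *\<^sub>R a) \<le> h a" using that by (auto simp: halfspaces_def)
    then show ?thesis using A(2)[OF that] by (simp add: dot_square_norm)
  qed
  have P: "compact P"
    using compact_Int_closed[OF compact_scaling[OF D(1), of "1 + \<eta>"] closed_halfspaces[of A h]] A(4)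
    by (simp add: P_def inf.absorb2)
  have P'P: "P' \<subseteq> (*\<^sub>R) c ` P"
  proof
    fix x assume x: "x \<in> P'"
    have "a \<bullet> (x /\<^sub>R c) \<le> h a" if "a \<in> A" for a
    proof -
      have "\<epsilon> \<le> \<epsilon> / r * h a" using hr[OF that] r \<epsilon> by (simp add: field_simps)
      then have "h a + \<epsilon> \<le> c * h a" by (simp add: c_def algebra_simps)
      then have "a \<bullet> x \<le> c * h a" using x that by (force simp: P'_def halfspaces_def)
      then show ?thesis using c by (simp add: field_simps)
    qed
    then have "x /\<^sub>R c \<in> P" by (simp add: P_def halfspaces_def)
    then show "x \<in> (*\<^sub>R) c ` P" using c by (intro image_eqI[of _ _ "x /\<^sub>R c"]) auto
  qed
  have iD: "interior D \<noteq> {}" using 0 by auto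
  have DP': "D \<subseteq> P'" using A(3) \<epsilon> by (force simp: P'_def halfspaces_def)
  have "surface P' \<le> surface ((*\<^sub>R) c ` P)"
    using P'P P iD interior_mono[OF DP'] unfolding P'_def
    by (intro surface_mono convex_halfspaces closed_halfspaces compact_imp_bounded compact_scaling) auto
  also have "\<dots> \<le> ennreal (c ^ (d - 1)) * surface P" unfolding d_def by (rule surface_scaleR[OF c])
  also have "surface P \<le> surface ((*\<^sub>R) (1 + \<eta>) ` D)"
    using A(3,4) iD interior_mono[OF A(3)] D(1) unfolding P_def
    by (intro surface_mono convex_halfspaces closed_halfspaces compact_imp_bounded compact_scaling) auto
  also have "\<dots> \<le> ennreal ((1 + \<eta>) ^ (d - 1)) * surface D"
    unfolding d_def using \<eta> by (intro surface_scaleR) auto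
  \<comment> \<open>Raising the exponent to that of the volume lets one factor serve both
    terms.\<close>
  also have "\<dots> \<le> ennreal ((1 + \<eta>) ^ d) * surface D"
    using \<eta> by (intro mult_right_mono ennreal_leI power_increasing) auto
  finally have S: "surface P' \<le> ennreal (c ^ (d - 1)) * (ennreal ((1 + \<eta>) ^ d) * surface D)"
    by (simp add: mult_left_mono)
  have "emeasure lborel (fatten \<epsilon> D) \<le> emeasure lborel P'"
  proof (rule emeasure_mono)
    show "fatten \<epsilon> D \<subseteq> P'"
    proof
      fix y assume "y \<in> fatten \<epsilon> D"
      then obtain x where x: "x \<in> D" "dist x y \<le> \<epsilon>" by (auto simp: fatten_def)
      have "a \<bullet> y \<le> h a + \<epsilon>" if "a \<in> A" for a
      proof -
        have "a \<bullet> y = a \<bullet> x + a \<bullet> (y - x)" by (simp add: inner_simps)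
        moreover have "a \<bullet> (y - x) \<le> norm a * norm (y - x)" by (rule norm_cauchy_schwarz)
        moreover have "a \<bullet> x \<le> h a" using A(3) x(1) that by (auto simp: halfspaces_def)
        ultimately show ?thesis using x(2) A(2)[OF that] by (simp add: dist_norm norm_minus_commute)
      qed
      then show "y \<in> P'" by (simp add: P'_def halfspaces_def)
    qed
    show "P' \<in> sets lborel" by (auto simp: P'_def intro: borel_closed closed_halfspaces)
  qed
  \<comment> \<open>The inner parallel set of \<open>P'\<close> at distance \<epsilon> is
    \<open>P\<close>.\<close>
  also have "\<dots> \<le> emeasure lborel P + ennreal \<epsilon> * surface P'"
    using halfspaces_inner[OF A(1,2) \<epsilon>, of "\<lambda>a. h a + \<epsilon>"] by (simp add: P_def P'_def)
  also have "\<dots> \<le> ennreal ((1 + \<eta>) ^ d) * emeasure lborel D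
      + ennreal \<epsilon> * (ennreal (c ^ (d - 1)) * (ennreal ((1 + \<eta>) ^ d) * surface D))"
  proof (intro add_mono mult_left_mono S)
    have "emeasure lborel P \<le> emeasure lborel ((*\<^sub>R) (1 + \<eta>) ` D)"
      using A(4) D(1) by (intro emeasure_mono) (auto simp: P_def intro!: borel_compact compact_scaling)
    then show "emeasure lborel P \<le> ennreal ((1 + \<eta>) ^ d) * emeasure lborel D"
      using \<eta> D(1) by (simp add: emeasure_scaleR d_def)
  qed auto
  also have "\<dots> = ennreal ((1 + \<eta>) ^ d) * (emeasure lborel D + ennreal (\<epsilon> * c ^ (d - 1)) * surface D)"
    using \<epsilon> c by (simp add: distrib_left ennreal_mult mult_ac)
  finally show "emeasure lborel (fatten \<epsilon> D) \<le> ennreal ((1 + \<eta>) ^ DIM('a)) *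
      (emeasure lborel D + ennreal (\<epsilon> * (1 + \<epsilon> / r) ^ (DIM('a) - 1)) * surface D)"
    by (simp add: d_def c_def)
qed

lemma surface_translation:
  fixes S :: "'a::euclidean_space set"
  shows "surface ((+) p ` S) = surface S"
  unfolding surface_def frontier_translation by (rule hausdorff_isometry) simp

lemma emeasure_translation_compact:
  fixes S :: "'a::euclidean_space set"
  assumes "compact S" shows "emeasure lborel ((+) p ` S) = emeasure lborel S"
  using emeasure_lborel_affine_image[OF assms, of 1 p] by simp

lemma fatten_translation:
  fixes S :: "'a::real_normed_vector set"
  shows "fatten e ((+) p ` S) = (+) p ` fatten e S"
proof -
  have "fatten e ((+) p ` S) = (\<Union>x\<in>S. (+) p ` cball x e)"
    by (simp only: fatten_def image_image cball_translation[symmetric])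
  then show ?thesis by (simp only: fatten_def image_UN)
qed

lemma minkowski_lower:
  fixes D :: "'a::euclidean_space set"
  assumes D: "compact D" "convex D" "interior D \<noteq> {}" and \<epsilon>: "\<epsilon> > 0"
  shows "emeasure lborel D + ennreal \<epsilon> * surface D \<le> emeasure lborel (fatten \<epsilon> D)"
proof -
  obtain p where p: "p \<in> interior D" using D(3) by blast
  define E where "E = (+) (- p) ` D"
  have "compact E" unfolding E_def by (rule compact_translation[OF D(1)])
  moreover have "convex E" "0 \<in> interior E"
    using D(2) p unfolding E_def interior_translation by auto
  ultimately have E: "compact E" "convex E" "0 \<in> interior E" by simp_all
  have DE: "D = (+) p ` E" by (simp add: E_def image_image)
  have "emeasure lborel E + ennreal \<epsilon> * surface E \<le> emeasure lborel (fatten \<epsilon> E)"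
    using E \<epsilon> by (rule minkowski_lower_0)
  then show ?thesis
    unfolding DE fatten_translation surface_translation using E(1)
    by (simp add: emeasure_translation_compact compact_fatten)
qed

lemma minkowski_upper:
  fixes D :: "'a::euclidean_space set"
  assumes D: "compact D" "convex D" "cball p r \<subseteq> D" and r: "r > 0" and \<epsilon>: "\<epsilon> > 0"
  shows "emeasure lborel (fatten \<epsilon> D) \<le> emeasure lborel D + ennreal (\<epsilon> * (1 + \<epsilon> / r) ^ (DIM('a) - 1)) * surface D"
proof -
  define E where "E = (+) (- p) ` D"
  have "cball 0 r = (+) (- p) ` cball p r" using cball_translation[of "- p" p r] by (simp only: left_minus)
  then have "cball 0 r \<subseteq> E" "convex E" using D(2,3) unfolding E_def by auto
  moreover have "compact E" unfolding E_def by (rule compact_translation[OF D(1)])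
  ultimately have E: "compact E" "convex E" "cball 0 r \<subseteq> E" by simp_all
  have DE: "D = (+) p ` E" by (simp add: E_def image_image)
  have "emeasure lborel (fatten \<epsilon> E) \<le> emeasure lborel E + ennreal (\<epsilon> * (1 + \<epsilon> / r) ^ (DIM('a) - 1)) * surface E"
    using E r \<epsilon> by (rule minkowski_upper_0)
  then show ?thesis
    unfolding DE fatten_translation surface_translation using E(1)
    by (simp add: emeasure_translation_compact compact_fatten)
qed

section \<open>Positivity and finiteness of volume and surface area\<close>

lemma emeasure_pos_interior:
  fixes D :: "'a::euclidean_space set"
  assumes "D \<in> sets borel" "interior D \<noteq> {}" shows "emeasure lborel D > 0"
proof -
  obtain x e where e: "e > 0" "cball x e \<subseteq> D" using assms(2) mem_interior_cball by blast
  have "0 < emeasure lborel (cball x e)" using e(1) by (simp add: emeasure_cball)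
  also have "\<dots> \<le> emeasure lborel D" using assms(1) e(2) by (intro emeasure_mono) auto
  finally show ?thesis .
qed

text \<open>The lower bound puts the surface area below the volume of the parallel body at distance
  1.\<close>

lemma surface_finite:
  fixes D :: "'a::euclidean_space set"
  assumes D: "compact D" "convex D" "interior D \<noteq> {}"
  shows "surface D < top"
proof -
  have "surface D \<le> emeasure lborel D + ennreal 1 * surface D" by simp
  also have "\<dots> \<le> emeasure lborel (fatten 1 D)" using D by (intro minkowski_lower) auto
  also have "\<dots> < top" using emeasure_compact_finite[OF compact_fatten[OF D(1)]] by simp
  finally show ?thesis .
qed

text \<open>If the surface area were zero, no parallel body would exceed \<open>D\<close> in volume
  by the upper bound; but a large one contains the double of \<open>D\<close>.\<close>

lemma surface_pos:
  fixes D :: "'a::euclidean_space set"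
  assumes D: "compact D" "convex D" "interior D \<noteq> {}"
  shows "surface D > 0"
proof (rule ccontr)
  assume "\<not> surface D > 0"
  then have S0: "surface D = 0" by simp
  obtain p r where r: "r > 0" "cball p r \<subseteq> D" using D(3) mem_interior_cball by blast
  obtain B where B: "B > 0" "\<And>x. x \<in> D \<Longrightarrow> norm x \<le> B"
    using compact_imp_bounded[OF D(1)] by (auto simp: bounded_pos)
  have "(*\<^sub>R) 2 ` D \<subseteq> fatten B D"
  proof
    fix y assume "y \<in> (*\<^sub>R) 2 ` D"
    then obtain x where "x \<in> D" "y = x + x" by (auto simp: scaleR_2)
    then show "y \<in> fatten B D" using B(2) unfolding fatten_def by (intro UN_I[of x]) (auto simp: dist_norm)
  qed
  then have "emeasure lborel ((*\<^sub>R) 2 ` D) \<le> emeasure lborel (fatten B D)"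
    using D(1) by (intro emeasure_mono) (auto intro: borel_compact compact_fatten)
  also have "\<dots> \<le> emeasure lborel D"
    using minkowski_upper[OF D(1,2) r(2,1) B(1)] S0 by simp
  finally have le: "ennreal (2 ^ DIM('a)) * emeasure lborel D \<le> emeasure lborel D"
    using D(1) by (simp add: emeasure_scaleR)
  obtain v where v: "emeasure lborel D = ennreal v" "v \<ge> 0"
    using emeasure_compact_finite[OF D(1)] by (cases "emeasure lborel D") auto
  have "v > 0" using emeasure_pos_interior[OF borel_compact[OF D(1)] D(3)] v by simp
  have "ennreal (2 ^ DIM('a) * v) \<le> ennreal v"
    using le v(2) unfolding v(1) by (subst ennreal_mult) auto
  then have "2 ^ DIM('a) * v \<le> v" using v(2) by (subst (asm) ennreal_le_iff) auto
  moreover have "(1::real) < 2 ^ DIM('a)" by (rule one_less_power) auto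
  then have "1 * v < 2 ^ DIM('a) * v" using \<open>v > 0\<close> by (rule mult_strict_right_mono)
  ultimately show False by simp
qed

section \<open>Slices of a body along a direction\<close>

text \<open>For compact convex \<open>K\<close> and t \<ge> 0, these are the points over which
  \<open>K\<close> has vertical length at least t. Phrased with two points of \<open>K\<close>, the
  set is the projection of the intersection of \<open>K\<close> with a vertical translate, and so
  inherits compactness and convexity.\<close>

definition slice :: "real \<Rightarrow> ('b \<times> real) set \<Rightarrow> 'b set" where
  "slice t K = {x. \<exists>s. (x, s) \<in> K \<and> (x, s + t) \<in> K}"

text \<open>For compact convex \<open>K\<close>, this is \<open>K\<close> with every vertical chord
  moved so as to start at height 0; its horizontal sections are the slices. As
  \<open>slice t K\<close> is even in t, the restriction to t \<ge> 0 prevents counting the volume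
  twice.\<close>

definition slices :: "('b \<times> real) set \<Rightarrow> ('b \<times> real) set" where
  "slices K = {(x, t). 0 \<le> t \<and> x \<in> slice t K}"

lemma compact_slice:
  fixes K :: "('b::euclidean_space \<times> real) set"
  assumes "compact K" shows "compact (slice t K)"
proof -
  have "slice t K = fst ` (K \<inter> (\<lambda>p. p - (0, t)) ` K)"
  proof safe
    fix x assume "x \<in> slice t K"
    then obtain s where "(x, s) \<in> K" "(x, s + t) \<in> K" by (auto simp: slice_def)
    then show "x \<in> fst ` (K \<inter> (\<lambda>p. p - (0, t)) ` K)"
      by (intro image_eqI[of _ _ "(x, s)"] IntI image_eqI[of _ _ "(x, s + t)"]) auto
  next
    fix x s y r assume "(x, s) \<in> K" "(y, r) \<in> K" "(x, s) = (y, r) - (0, t)"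
    then show "fst (x, s) \<in> slice t K" by (auto simp: slice_def)
  qed
  moreover have "compact (K \<inter> (\<lambda>p. p - (0, t)) ` K)"
    using assms by (intro compact_Int compact_continuous_image continuous_intros)
  ultimately show ?thesis
    using compact_continuous_image[OF continuous_on_fst[OF continuous_on_id]] by simp
qed

lemma convex_slice:
  fixes K :: "('b::euclidean_space \<times> real) set"
  assumes "convex K" shows "convex (slice t K)"
proof (rule convexI)
  fix x y :: 'b and u v :: real assume xy: "x \<in> slice t K" "y \<in> slice t K" "0 \<le> u" "0 \<le> v" "u + v = 1"
  then obtain r s where rs: "(x, r) \<in> K" "(x, r + t) \<in> K" "(y, s) \<in> K" "(y, s + t) \<in> K"
    by (auto simp: slice_def)
  have "u *\<^sub>R (x, r) + v *\<^sub>R (y, s) \<in> K" "u *\<^sub>R (x, r + t) + v *\<^sub>R (y, s + t) \<in> K"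
    by (rule convexD[OF assms rs(1) rs(3) xy(3-5)], rule convexD[OF assms rs(2) rs(4) xy(3-5)])
  moreover have "u * (r + t) + v * (s + t) = u * r + v * s + (u + v) * t"
    by (simp add: algebra_simps)
  then have "u * (r + t) + v * (s + t) = u * r + v * s + t"
    using xy(5) by simp
  ultimately show "u *\<^sub>R x + v *\<^sub>R y \<in> slice t K"
    unfolding slice_def by (intro CollectI exI[of _ "u * r + v * s"]) simp
qed

lemma compact_slices:
  fixes K :: "('b::euclidean_space \<times> real) set"
  assumes "compact K" shows "compact (slices K)"
proof -
  have "slices K = (\<lambda>(p, q). (fst p, snd q - snd p)) ` ((K \<times> K) \<inter> {z. fst (fst z) = fst (snd z) \<and> snd (fst z) \<le> snd (snd z)})"
    (is "_ = ?f ` (_ \<inter> ?Z)")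
  proof safe
    fix x t assume "(x, t) \<in> slices K"
    then obtain s where "(x, s) \<in> K" "(x, s + t) \<in> K" "0 \<le> t" by (auto simp: slices_def slice_def)
    then show "(x, t) \<in> ?f ` ((K \<times> K) \<inter> ?Z)"
      by (intro image_eqI[of _ _ "((x, s), (x, s + t))"]) auto
  next
    fix x s y t assume "(x, s) \<in> K" "(y, t) \<in> K" "fst (fst ((x, s), (y, t))) = fst (snd ((x, s), (y, t)))"
      "snd (fst ((x, s), (y, t))) \<le> snd (snd ((x, s), (y, t)))"
    then show "(fst (x, s), snd (y, t) - snd (x, s)) \<in> slices K"
      by (auto simp: slices_def slice_def intro!: exI[of _ s])
  qed
  moreover have "closed ?Z"
    by (intro closed_Collect_conj closed_Collect_eq closed_Collect_le continuous_intros)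
  ultimately show ?thesis
    using assms unfolding case_prod_beta
    by (simp only:) (intro compact_continuous_image compact_Int_closed compact_Times continuous_intros)
qed

lemma compact_in_sets_pair:
  fixes M :: "('b::euclidean_space \<times> real) set"
  assumes "compact M" shows "M \<in> sets (lborel \<Otimes>\<^sub>M lborel)"
  unfolding lborel_prod sets_lborel using assms by (rule borel_compact)

text \<open>Over a point of the base, both sets have an interval of the same length as fibre.\<close>

lemma emeasure_slices:
  fixes K :: "('b::euclidean_space \<times> real) set"
  assumes K: "compact K" "convex K"
  shows "emeasure lborel (slices K) = emeasure lborel K"
proof -
  have fibre: "emeasure lborel (Pair x -` slices K) = emeasure lborel (Pair x -` K)" for x
  proof -
    have "compact (snd ` (K \<inter> {p. fst p = x}))"
      using K(1) by (intro compact_continuous_image compact_Int_closed closed_Collect_eq continuous_intros)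
    also have "snd ` (K \<inter> {p. fst p = x}) = Pair x -` K"
    proof safe
      fix s assume "(x, s) \<in> K"
      then show "s \<in> snd ` (K \<inter> {p. fst p = x})" by (intro image_eqI[of _ _ "(x, s)"]) auto
    qed auto
    finally have c: "compact (Pair x -` K)" .
    have conv: "convex (Pair x -` K)"
    proof (rule convexI)
      fix s t u v :: real assume "s \<in> Pair x -` K" "t \<in> Pair x -` K" "0 \<le> u" "0 \<le> v" and uv: "u + v = 1"
      then have "u *\<^sub>R (x, s) + v *\<^sub>R (x, t) \<in> K" by (intro convexD[OF K(2)]) auto
      moreover have "u *\<^sub>R x + v *\<^sub>R x = x" unfolding scaleR_left_distrib[symmetric] uv by simp
      ultimately show "u *\<^sub>R s + v *\<^sub>R t \<in> Pair x -` K" by simp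
    qed
    then obtain a b where ab: "Pair x -` K = {a..b}"
      using c convex_connected[OF conv] connected_compact_interval_1[of "Pair x -` K"] by auto
    have mem: "(x, s) \<in> K \<longleftrightarrow> a \<le> s \<and> s \<le> b" for s using ab by (auto simp: set_eq_iff)
    \<comment> \<open>An empty fibre means \<open>b < a\<close>, and then \<open>{0..b - a}\<close>
      is empty as well.\<close>
    have "Pair x -` slices K = {0..b - a}"
    proof (rule set_eqI, rule iffI)
      fix t assume "t \<in> Pair x -` slices K"
      then obtain s where "0 \<le> t" "(x, s) \<in> K" "(x, s + t) \<in> K" by (auto simp: slices_def slice_def)
      then show "t \<in> {0..b - a}" using mem[of s] mem[of "s + t"] by simp
    next
      fix t assume "t \<in> {0..b - a}"
      then have "0 \<le> t" "(x, a) \<in> K" "(x, a + t) \<in> K" using mem[of a] mem[of "a + t"] by simp_all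
      then show "t \<in> Pair x -` slices K" by (auto simp: slices_def slice_def)
    qed
    then show ?thesis unfolding ab by (simp del: emeasure_lborel_Icc add: emeasure_lborel_Icc_eq)
  qed
  have "emeasure (lborel \<Otimes>\<^sub>M lborel) (slices K) = emeasure (lborel \<Otimes>\<^sub>M lborel) K"
    using compact_in_sets_pair[OF compact_slices[OF K(1)]] compact_in_sets_pair[OF K(1)]
    by (simp only: lborel.emeasure_pair_measure_alt fibre)
  then show ?thesis by (simp only: lborel_prod)
qed

text \<open>Both points of a vertical pair are shifted by the same horizontal vector of length at
  most \<open>e\<close>, which keeps their distance t.\<close>

lemma fatten_slice_subset: "fatten e (slice t K) \<subseteq> slice t (fatten e K)"
proof
  fix y assume "y \<in> fatten e (slice t K)"
  then obtain x s where "dist x y \<le> e" "(x, s) \<in> K" "(x, s + t) \<in> K" by (auto simp: fatten_def slice_def)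
  then show "y \<in> slice t (fatten e K)"
    unfolding slice_def fatten_def
    by (intro CollectI exI[of _ s] conjI UN_I[of "(x, s)"] UN_I[of "(x, s + t)"]) (auto simp: dist_Pair_Pair)
qed

lemma emeasure_convex_no_interior:
  fixes D :: "'a::euclidean_space set"
  assumes "compact D" "convex D" "interior D = {}" shows "emeasure lborel D = 0"
proof -
  have "D \<subseteq> frontier D" using assms closure_subset by (auto simp: frontier_def)
  then have "negligible D" using negligible_convex_frontier[OF assms(2)] negligible_subset by blast
  then have "D \<in> null_sets lborel"
    using assms(1) by (simp add: negligible_iff_null_sets null_sets_completion_iff borel_compact)
  then show ?thesis by auto
qed

text \<open>The slices of \<open>K\<close> grow by at least the factor \<open>1 + \<epsilon> / h\<close> when \<open>K\<close> is fattened by \<open>\<epsilon>\<close>,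
  so \<open>K\<close> itself does, and its surface area is the rate of this growth.\<close>

lemma volume_le_surface:
  fixes K :: "('b::euclidean_space \<times> real) set"
  assumes h: "h > 0" "\<And>D. compact D \<Longrightarrow> convex D \<Longrightarrow> interior D \<noteq> {} \<Longrightarrow> D \<subseteq> C \<Longrightarrow>
      emeasure lborel D \<le> ennreal h * surface D"
    and K: "compact K" "convex K" "interior K \<noteq> {}" "fst ` K \<subseteq> C"
  shows "emeasure lborel K \<le> ennreal h * surface K"
proof -
  have grow: "ennreal (1 + \<epsilon> / h) * emeasure lborel K \<le> emeasure lborel (fatten \<epsilon> K)" if \<epsilon>: "\<epsilon> > 0" for \<epsilon>
  proof -
    have D: "ennreal (1 + \<epsilon> / h) * emeasure lborel (slice t K) \<le> emeasure lborel (slice t (fatten \<epsilon> K))" for t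
    proof (cases "interior (slice t K) = {}")
      \<comment> \<open>A slice without interior is a null set; the hypothesis on \<open>h\<close>
        speaks of the other slices.\<close>
      case True
      then show ?thesis
        using emeasure_convex_no_interior[OF compact_slice[OF K(1)] convex_slice[OF K(2)]] by simp
    next
      case False
      have sC: "slice t K \<subseteq> C" using K(4) by (force simp: slice_def)
      have "ennreal (\<epsilon> / h) * emeasure lborel (slice t K) \<le> ennreal (\<epsilon> / h) * (ennreal h * surface (slice t K))"
        using False sC by (intro mult_left_mono h(2) compact_slice convex_slice K) auto
      also have "\<dots> = ennreal \<epsilon> * surface (slice t K)"
        using h(1) \<epsilon> by (simp add: mult.assoc[symmetric] ennreal_mult[symmetric])
      finally have "ennreal (1 + \<epsilon> / h) * emeasure lborel (slice t K) \<le> emeasure lborel (slice t K) + ennreal \<epsilon> * surface (slice t K)"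
        using h(1) \<epsilon> by (simp add: ennreal_plus distrib_right add_left_mono)
      also have "\<dots> \<le> emeasure lborel (fatten \<epsilon> (slice t K))"
        using False \<epsilon> by (intro minkowski_lower compact_slice convex_slice K)
      also have "\<dots> \<le> emeasure lborel (slice t (fatten \<epsilon> K))"
        unfolding sets_lborel by (intro emeasure_mono fatten_slice_subset) (auto intro: borel_compact compact_slice compact_fatten K)
      finally show ?thesis .
    qed
    have sec: "(\<lambda>x. (x, t)) -` slices M = (if 0 \<le> t then slice t M else {})" for t and M :: "('b \<times> real) set"
      by (auto simp: slices_def)
    have m: "slices M \<in> sets (lborel \<Otimes>\<^sub>M lborel)" if "compact M" for M :: "('b \<times> real) set"
      using that by (intro compact_in_sets_pair compact_slices)
    have alt: "emeasure lborel M = (\<integral>\<^sup>+t. emeasure lborel ((\<lambda>x. (x, t)) -` slices M) \<partial>lborel)"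
      if "compact M" "convex M" for M :: "('b \<times> real) set"
      unfolding lborel_pair.emeasure_pair_measure_alt2[OF m[OF that(1)], symmetric] lborel_prod
      by (rule emeasure_slices[OF that, symmetric])
    have "ennreal (1 + \<epsilon> / h) * emeasure lborel K
        = (\<integral>\<^sup>+t. ennreal (1 + \<epsilon> / h) * emeasure lborel ((\<lambda>x. (x, t)) -` slices K) \<partial>lborel)"
      unfolding alt[OF K(1,2)] using lborel_pair.measurable_emeasure_Pair2[OF m[OF K(1)]]
      by (intro nn_integral_cmult[symmetric]) auto
    also have "\<dots> \<le> (\<integral>\<^sup>+t. emeasure lborel ((\<lambda>x. (x, t)) -` slices (fatten \<epsilon> K)) \<partial>lborel)"
      using D by (intro nn_integral_mono) (auto simp: sec)
    also have "\<dots> = emeasure lborel (fatten \<epsilon> K)"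
      by (rule alt[symmetric]) (intro compact_fatten convex_fatten K)+
    finally show ?thesis .
  qed
  \<comment> \<open>With finite volume and surface area, the volume can be subtracted from the two
    bounds.\<close>
  obtain k where k: "emeasure lborel K = ennreal k" "k \<ge> 0"
    using emeasure_compact_finite[OF K(1)] by (cases "emeasure lborel K") auto
  obtain s where s: "surface K = ennreal s" "s \<ge> 0"
    using surface_finite[OF K(1-3)] by (cases "surface K") auto
  obtain p r where r: "r > 0" "cball p r \<subseteq> K" using K(3) mem_interior_cball by blast
  define m where "m = DIM('b \<times> real) - 1"
  have "ennreal (k / h) \<le> ennreal ((1 + \<eta>) ^ m) * surface K" if \<eta>: "\<eta> > 0" for \<eta>
  proof -
    \<comment> \<open>This choice turns \<open>(1 + \<epsilon> / r) ^ m\<close> into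
      \<open>(1 + \<eta>) ^ m\<close>.\<close>
    define \<epsilon> where "\<epsilon> = \<eta> * r"
    have \<epsilon>: "\<epsilon> > 0" "\<epsilon> / r = \<eta>" using \<eta> r(1) by (auto simp: \<epsilon>_def)
    have "ennreal (1 + \<epsilon> / h) * ennreal k \<le> ennreal k + ennreal (\<epsilon> * (1 + \<eta>) ^ m) * ennreal s"
      using order_trans[OF grow[OF \<epsilon>(1)] minkowski_upper[OF K(1,2) r(2,1) \<epsilon>(1)]] unfolding k s \<epsilon>(2) m_def .
    also have "\<dots> = ennreal (k + \<epsilon> * (1 + \<eta>) ^ m * s)"
      using k s \<epsilon> \<eta> by (simp add: ennreal_mult[symmetric] ennreal_plus[symmetric] del: ennreal_plus)
    also have "ennreal (1 + \<epsilon> / h) * ennreal k = ennreal ((1 + \<epsilon> / h) * k)"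
      using k \<epsilon> h by (intro ennreal_mult[symmetric]) auto
    finally have "(1 + \<epsilon> / h) * k \<le> k + \<epsilon> * (1 + \<eta>) ^ m * s"
      using k s \<epsilon> \<eta> by (subst (asm) ennreal_le_iff) auto
    then have "\<epsilon> * (k / h) \<le> \<epsilon> * ((1 + \<eta>) ^ m * s)" by (simp add: algebra_simps)
    then have "k / h \<le> (1 + \<eta>) ^ m * s" using \<epsilon>(1) by (rule mult_left_le_imp_le)
    then show ?thesis
      unfolding s using s(2) \<eta> by (subst ennreal_mult[symmetric]) (auto intro: ennreal_leI)
  qed
  then have "ennreal (k / h) \<le> surface K" by (rule ennreal_le_dilation_limit)
  then have "ennreal h * ennreal (k / h) \<le> ennreal h * surface K" by (rule mult_left_mono) simp
  also have "ennreal h * ennreal (k / h) = ennreal k"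
    using h(1) k(2) by (subst ennreal_mult[symmetric]) auto
  finally show ?thesis using k by simp
qed

section \<open>Volume and surface area of cylinders\<close>

lemma emeasure_Times:
  fixes C :: "'b::euclidean_space set" and I :: "real set"
  assumes "compact C" "compact I"
  shows "emeasure lborel (C \<times> I) = emeasure lborel C * emeasure lborel I"
  unfolding lborel_prod[symmetric] using assms
  by (intro lborel.emeasure_pair_measure_Times) (auto intro: borel_compact)

text \<open>Instead of splitting the boundary into two lids and a wall, the proof compares volumes:
  the parallel body of the cylinder lies in the product of the parallel bodies of base and segment.
  The lower bound for the cylinder and the upper bound for the base then agree in the volume and are
  compared in the terms of first order in \<epsilon>.\<close>

lemma surface_cylinder:
  fixes C :: "'b::euclidean_space set"
  assumes C: "compact C" "convex C" "interior C \<noteq> {}" and L: "L > 0"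
  shows "surface (C \<times> {0..L}) \<le> 2 * emeasure lborel C + ennreal L * surface C"
proof -
  define K where "K = C \<times> {0..L}"
  have K: "compact K" "convex K" "interior K \<noteq> {}"
    using C L by (auto simp: K_def compact_Times convex_Times interior_Times)
  obtain c where c: "emeasure lborel C = ennreal c" "c \<ge> 0"
    using emeasure_compact_finite[OF C(1)] by (cases "emeasure lborel C") auto
  obtain p where p: "surface C = ennreal p" "p \<ge> 0"
    using surface_finite[OF C] by (cases "surface C") auto
  obtain s where s: "surface K = ennreal s" "s \<ge> 0"
    using surface_finite[OF K] by (cases "surface K") auto
  obtain q r where r: "r > 0" "cball q r \<subseteq> C" using C(3) mem_interior_cball by blast
  define m where "m = DIM('b) - 1"
  have "surface K \<le> ennreal ((1 + \<eta>) ^ Suc m) * ennreal (2 * c + L * p)" if \<eta>: "\<eta> > 0" for \<eta>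
  proof -
    \<comment> \<open>The relative errors \<open>\<epsilon> / r\<close> in the base and
      \<open>2 * \<epsilon> / L\<close> in the height both become at most \<eta>.\<close>
    define \<epsilon> where "\<epsilon> = \<eta> * min r (L / 2)"
    have \<epsilon>: "\<epsilon> > 0" "\<epsilon> \<le> \<eta> * r" "2 * \<epsilon> \<le> \<eta> * L"
      using \<eta> r(1) L mult_left_mono[of "min r (L / 2)" r \<eta>] mult_left_mono[of "min r (L / 2)" "L / 2" \<eta>]
      by (auto simp: \<epsilon>_def)
    define q where "q = (1 + \<epsilon> / r) ^ m"
    have q: "0 \<le> q" "q \<le> (1 + \<eta>) ^ m"
    proof -
      have "1 + \<epsilon> / r \<le> 1 + \<eta>" "0 \<le> 1 + \<epsilon> / r" using \<epsilon> r(1) by (simp_all add: field_simps)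
      then show "0 \<le> q" "q \<le> (1 + \<eta>) ^ m" by (simp_all only: q_def zero_le_power power_mono)
    qed
    have "ennreal (c * L + \<epsilon> * s) = emeasure lborel K + ennreal \<epsilon> * surface K"
      using c s L \<epsilon>(1) C(1) by (simp add: K_def emeasure_Times ennreal_mult ennreal_plus)
    also have "\<dots> \<le> emeasure lborel (fatten \<epsilon> K)"
      using K \<epsilon>(1) by (rule minkowski_lower)
    also have "\<dots> \<le> emeasure lborel (fatten \<epsilon> C \<times> {-\<epsilon>..L + \<epsilon>})"
    proof (rule emeasure_mono)
      show "fatten \<epsilon> C \<times> {-\<epsilon>..L + \<epsilon>} \<in> sets lborel"
        unfolding sets_lborel by (intro borel_compact compact_Times compact_fatten C) auto
      show "fatten \<epsilon> K \<subseteq> fatten \<epsilon> C \<times> {-\<epsilon>..L + \<epsilon>}"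
      proof
        fix y assume "y \<in> fatten \<epsilon> K"
        then obtain x where x: "x \<in> K" "dist x y \<le> \<epsilon>" by (auto simp: fatten_def)
        have "dist (fst x) (fst y) \<le> \<epsilon>" "dist (snd x) (snd y) \<le> \<epsilon>"
          using dist_fst_le[of x y] dist_snd_le[of x y] x(2) by linarith+
        then show "y \<in> fatten \<epsilon> C \<times> {-\<epsilon>..L + \<epsilon>}"
          using x(1) by (cases x; cases y) (auto simp: K_def fatten_def dist_real_def)
      qed
    qed
    also have "\<dots> = emeasure lborel (fatten \<epsilon> C) * ennreal (L + 2 * \<epsilon>)"
      using C(1) L \<epsilon>(1) by (subst emeasure_Times) (auto simp: compact_fatten add.commute)
    also have "\<dots> \<le> (ennreal c + ennreal (\<epsilon> * q) * ennreal p) * ennreal (L + 2 * \<epsilon>)"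
      using minkowski_upper[OF C(1,2) r(2,1) \<epsilon>(1)] by (intro mult_right_mono) (auto simp: c p q_def m_def)
    also have "\<dots> = ennreal ((c + \<epsilon> * q * p) * (L + 2 * \<epsilon>))"
      using c p q L \<epsilon>(1) by (simp add: ennreal_mult ennreal_plus)
    finally have "c * L + \<epsilon> * s \<le> (c + \<epsilon> * q * p) * (L + 2 * \<epsilon>)"
      using c p q L \<epsilon>(1) by (subst (asm) ennreal_le_iff) auto
    \<comment> \<open>The volume \<open>c * L\<close> cancels, and every other term carries a factor
      \<epsilon>.\<close>
    then have "\<epsilon> * s \<le> \<epsilon> * (2 * c + q * p * (L + 2 * \<epsilon>))" by (simp add: algebra_simps)
    then have "s \<le> 2 * c + q * p * (L + 2 * \<epsilon>)" using \<epsilon>(1) by (rule mult_left_le_imp_le)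
    also have "\<dots> \<le> (1 + \<eta>) ^ Suc m * (2 * c) + (1 + \<eta>) ^ m * p * (L * (1 + \<eta>))"
    proof (rule add_mono)
      have "1 * (2 * c) \<le> (1 + \<eta>) ^ Suc m * (2 * c)"
        using \<eta> c by (intro mult_right_mono one_le_power) auto
      then show "2 * c \<le> (1 + \<eta>) ^ Suc m * (2 * c)" by simp
      have "L + 2 * \<epsilon> \<le> L * (1 + \<eta>)" using \<epsilon>(3) by (simp add: algebra_simps)
      moreover have "q * p \<le> (1 + \<eta>) ^ m * p" using q(2) p(2) by (rule mult_right_mono)
      ultimately show "q * p * (L + 2 * \<epsilon>) \<le> (1 + \<eta>) ^ m * p * (L * (1 + \<eta>))"
        using p \<eta> L \<epsilon>(1) by - (rule mult_mono, auto)
    qed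
    also have "\<dots> = (1 + \<eta>) ^ Suc m * (2 * c + L * p)" by (simp add: algebra_simps)
    finally show ?thesis
      unfolding s using \<eta> c p L by (subst ennreal_mult[symmetric]) (auto intro: ennreal_leI)
  qed
  then have "surface K \<le> ennreal (2 * c + L * p)" by (rule ennreal_le_dilation_limit)
  also have "\<dots> = 2 * emeasure lborel C + ennreal L * surface C"
    using c p L by (simp add: ennreal_plus ennreal_mult)
  finally show ?thesis by (simp add: K_def)
qed

section \<open>The canal class\<close>

lemma compact_linear_image:
  fixes f :: "'a::euclidean_space \<Rightarrow> 'b::real_normed_vector"
  assumes "compact S" "linear f" shows "compact (f ` S)"
  using assms by (intro compact_continuous_image linear_continuous_on) (simp add: linear_conv_bounded_linear)

lemma rel_frontier_linear_image:
  fixes f :: "'a::euclidean_space \<Rightarrow> 'b::euclidean_space"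
  assumes "linear f" "inj f" shows "rel_frontier (f ` S) = f ` rel_frontier S"
  using assms unfolding rel_frontier_def
  by (simp add: closure_injective_linear_image[symmetric] rel_interior_injective_linear_image
      linear_linear image_set_diff)

text \<open>In the coordinates given by \<open>T\<close> the direction \<open>u\<close> is vertical
  and its hyperplane is \<open>'b\<close>. Isometry invariance turns the Hausdorff measures of the
  statement into \<open>emeasure lborel\<close> and \<open>surface\<close>; these are positive and
  finite on convex bodies with interior, so the quotients can be treated as quotients of
  reals.\<close>

lemma canal_class_sup:
  fixes u :: "'a::euclidean_space"
  assumes u: "norm u = 1" and dim: "DIM('a) = DIM('b::euclidean_space) + 1"
    and C: "convex_body C" "C \<subseteq> {u}\<^sup>\<bottom>" "aff_dim C = int (DIM('a) - 1)" "cheeger_set C"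
  shows "(SUP K \<in> canal_class u C. hausdorff DIM('a) K / hausdorff (DIM('a) - 1) (rel_frontier K))
    = hausdorff (DIM('a) - 1) C / hausdorff (DIM('a) - 2) (rel_frontier C)"
proof -
  obtain T :: "'b \<times> real \<Rightarrow> 'a" and S where T: "linear T" "linear S" "\<And>p. norm (T p) = norm p"
    "\<And>p. S (T p) = p" "\<And>y. T (S y) = y" "\<And>x s. T (x, s) = T (x, 0) + s *\<^sub>R u" "\<And>x s. u \<bullet> T (x, s) = s"
    by (rule cartesian_hyperplane[OF u dim]) (rule that)
  have distT: "dist (T p) (T q) = dist p q" for p q
    using T(3)[of "p - q"] by (simp add: dist_norm linear_diff[OF T(1)])
  have bijT: "bij T" using T(4,5) by (intro o_bij[of S T]) (auto simp: fun_eq_iff)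
  define J where "J x = T (x, 0)" for x
  have J: "linear J" unfolding J_def
  proof (rule linearI)
    fix x y :: 'b and r :: real
    show "T (x + y, 0) = T (x, 0) + T (y, 0)" "T (r *\<^sub>R x, 0) = r *\<^sub>R T (x, 0)"
      using linear_add[OF T(1), of "(x, 0)" "(y, 0)"] linear_scale[OF T(1), of r "(x, 0)"] by simp_all
  qed
  have distJ: "dist (J x) (J y) = dist x y" for x y by (simp add: J_def distT dist_Pair_Pair)
  have injJ: "inj J" by (rule injI) (metis distJ dist_eq_0_iff)
  have projT: "proj_perp u (T p) = J (fst p)" for p
    using T(6)[of "fst p" "snd p"] T(7)[of "fst p" "snd p"] by (simp add: proj_perp_def J_def)
  define C' where "C' = {x. J x \<in> C}"
  have CJ: "C = J ` C'"
  proof safe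
    fix z assume z: "z \<in> C"
    then have "u \<bullet> z = 0" using C(2) by (auto simp: orthogonal_comp_def orthogonal_def)
    then have "snd (S z) = 0" using T(7)[of "fst (S z)" "snd (S z)"] T(5)[of z] by simp
    then have "J (fst (S z)) = z" using T(5)[of z] by (metis J_def prod.collapse)
    then show "z \<in> J ` C'" using z by (intro image_eqI[of _ _ "fst (S z)"]) (simp_all add: C'_def)
  qed (simp add: C'_def)
  have C'S: "C' = (\<lambda>z. fst (S z)) ` C"
    unfolding CJ image_image by (simp add: J_def T(4))
  have lfS: "linear (\<lambda>z. fst (S z))"
    using linear_add[OF T(2)] linear_scale[OF T(2)] by (intro linearI) simp_all
  have C': "compact C'" "convex C'" "C' \<noteq> {}"
    using C(1) unfolding C'S convex_body_def
    by (auto intro: compact_linear_image convex_linear_image lfS)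
  have "aff_dim C' = int DIM('b)"
    using C(3) dim aff_dim_injective_linear_image[OF J injJ, of C'] CJ by simp
  then have iC': "interior C' \<noteq> {}"
    using interior_rel_interior[of C'] rel_interior_eq_empty[OF C'(2)] C'(3) by simp
  have k: "nat (aff_dim C) = DIM('b)" using C(3) dim by simp
  have affC: "affine hull C = range J"
  proof -
    have "affine hull C' = UNIV" using aff_dim_eq_full \<open>aff_dim C' = int DIM('b)\<close> by blast
    then show ?thesis
      unfolding CJ using affine_hull_linear_image[of J C'] J by (simp add: linear_conv_bounded_linear)
  qed
  have HJ: "hausdorff DIM('b) (J ` D) = emeasure lborel D" if "compact D" for D
    using hausdorff_isometry[of D J] distJ hausdorff_eq_lborel[OF borel_compact[OF that]] by simp
  have SJ: "hausdorff (DIM('b) - 1) (rel_frontier (J ` D)) = surface D" if "interior D \<noteq> {}" for D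
    unfolding rel_frontier_linear_image[OF J injJ] rel_frontier_nonempty_interior[OF that] surface_def
    using hausdorff_isometry[of _ J] distJ by simp
  have HT: "hausdorff DIM('a) (T ` K) = emeasure lborel K" if "compact K" for K
    using hausdorff_isometry[of K T "DIM('a)"] distT hausdorff_eq_lborel[OF borel_compact[OF that]] dim by simp
  have ST: "hausdorff (DIM('a) - 1) (rel_frontier (T ` K)) = surface K" if "interior K \<noteq> {}" for K
    unfolding rel_frontier_linear_image[OF T(1) bij_is_inj[OF bijT]] rel_frontier_nonempty_interior[OF that] surface_def
    using hausdorff_isometry[of _ T] distT dim by simp
  obtain c where c: "emeasure lborel C' = ennreal c" "c > 0"
    using emeasure_compact_finite[OF C'(1)] emeasure_pos_interior[OF borel_compact[OF C'(1)] iC']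
    by (cases "emeasure lborel C'") auto
  obtain p where p: "surface C' = ennreal p" "p > 0"
    using surface_finite[OF C'(1,2) iC'] surface_pos[OF C'(1,2) iC'] by (cases "surface C'") auto
  define h where "h = c / p"
  have h: "h > 0" using c p by (simp add: h_def)
  have rhs: "hausdorff DIM('b) C / hausdorff (DIM('b) - 1) (rel_frontier C) = ennreal h"
    unfolding CJ HJ[OF C'(1)] SJ[OF iC'] c(1) p(1) h_def using c p by (intro divide_ennreal) auto
  have cheeger: "cheeger_constant C = ennreal h"
    using C(4) unfolding cheeger_set_def k Let_def rhs .
  \<comment> \<open>This is the Cheeger property in coordinates, with the denominator
    cleared.\<close>
  have slice_bound: "emeasure lborel D \<le> ennreal h * surface D"
    if D: "compact D" "convex D" "interior D \<noteq> {}" "D \<subseteq> C'" for D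
  proof -
    obtain d where d: "emeasure lborel D = ennreal d" "d \<ge> 0"
      using emeasure_compact_finite[OF D(1)] by (cases "emeasure lborel D") auto
    obtain q where q: "surface D = ennreal q" "q > 0"
      using surface_finite[OF D(1-3)] surface_pos[OF D(1-3)] by (cases "surface D") auto
    have "affine hull (J ` D) = range J"
    proof -
      have "affine hull D = UNIV" using D(3) by (rule affine_hull_nonempty_interior)
      then show ?thesis
        using affine_hull_linear_image[of J D] J by (simp add: linear_conv_bounded_linear)
    qed
    \<comment> \<open>As \<open>D\<close> has interior, its image spans the affine hull of
      \<open>C\<close>; the boundary in the definition of the Cheeger constant is then the relative
      frontier.\<close>
    then have bd: "top_of_set (affine hull C) frontier_of (J ` D) = rel_frontier (J ` D)"
      using affC rel_frontier_eq_frontier_of[of "J ` D"] by simp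
    have "hausdorff DIM('b) (J ` D) / hausdorff (DIM('b) - 1) (top_of_set (affine hull C) frontier_of (J ` D)) \<le> cheeger_constant C"
      unfolding cheeger_constant_def k Let_def
    proof (rule SUP_upper, intro CollectI conjI)
      show "J ` D \<subseteq> C" using D(4) CJ by blast
      show "closed (J ` D)" using D(1) J by (intro compact_imp_closed compact_linear_image)
      show "0 < hausdorff (DIM('b) - 1) (top_of_set (affine hull C) frontier_of (J ` D))"
        unfolding bd SJ[OF D(3)] q(1) using q(2) by simp
    qed
    then have "ennreal d / ennreal q \<le> ennreal h"
      unfolding bd SJ[OF D(3)] HJ[OF D(1)] q(1) d(1) cheeger .
    then have "ennreal (d / q) \<le> ennreal h" using d q by (simp add: divide_ennreal)
    then have "d / q \<le> h" using h by (subst (asm) ennreal_le_iff) auto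
    then have "d \<le> h * q" using q by (simp add: field_simps)
    then have "ennreal d \<le> ennreal (h * q)" by (rule ennreal_leI)
    then show ?thesis unfolding d(1) q(1) using h q by (simp add: ennreal_mult)
  qed
  have "(SUP K \<in> canal_class u C. hausdorff DIM('a) K / hausdorff (DIM('a) - 1) (rel_frontier K)) = ennreal h"
  proof (rule antisym)
    show "(SUP K \<in> canal_class u C. hausdorff DIM('a) K / hausdorff (DIM('a) - 1) (rel_frontier K)) \<le> ennreal h"
    proof (rule SUP_least)
      fix K assume "K \<in> canal_class u C"
      then have K: "compact K" "convex K" "interior K \<noteq> {}" "proj_perp u ` K = C"
        by (auto simp: canal_class_def convex_body_def)
      define M where "M = S ` K"
      have KM: "K = T ` M" by (simp add: M_def image_image T(5))
      have M: "compact M" "convex M"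
        using K T(2) unfolding M_def by (auto intro: compact_linear_image convex_linear_image)
      have "interior K = T ` interior M"
        unfolding KM by (rule interior_bijective_linear_image[OF T(1) bijT])
      then have iM: "interior M \<noteq> {}" using K(3) by auto
      have "fst ` M \<subseteq> C'"
      proof safe
        fix x s assume "(x, s) \<in> M"
        then have "proj_perp u (T (x, s)) \<in> C" using K(4) KM by blast
        then show "fst (x, s) \<in> C'" by (simp add: projT C'_def)
      qed
      then have le: "emeasure lborel M \<le> ennreal h * surface M"
        using h slice_bound M iM by (intro volume_le_surface[where C = C']) auto
      obtain v where v: "emeasure lborel M = ennreal v" "v \<ge> 0"
        using emeasure_compact_finite[OF M(1)] by (cases "emeasure lborel M") auto
      obtain s where s: "surface M = ennreal s" "s > 0"
        using surface_finite[OF M iM] surface_pos[OF M iM] by (cases "surface M") auto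
      have "ennreal v \<le> ennreal (h * s)" using le h s unfolding v(1) s(1) by (simp add: ennreal_mult)
      then have "v / s \<le> h" using h s by (subst (asm) ennreal_le_iff) (auto simp: field_simps)
      then have "ennreal v / ennreal s \<le> ennreal h"
        using v s by (subst divide_ennreal) (auto intro: ennreal_leI)
      then show "hausdorff DIM('a) K / hausdorff (DIM('a) - 1) (rel_frontier K) \<le> ennreal h"
        unfolding KM HT[OF M(1)] ST[OF iM] v(1) s(1) .
    qed
    show "ennreal h \<le> (SUP K \<in> canal_class u C. hausdorff DIM('a) K / hausdorff (DIM('a) - 1) (rel_frontier K))" (is "_ \<le> ?sup")
    proof -
      \<comment> \<open>In a cylinder of height \<open>n + 1\<close> the two lids contribute at most
        \<open>2 * c\<close> to the surface area, a share that vanishes as the height grows.\<close>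
      have cyl: "ennreal (c * real (Suc n) / (2 * c + real (Suc n) * p)) \<le> ?sup" for n
      proof -
        define L where "L = real (Suc n)"
        have L: "L > 0" by (simp add: L_def)
        define M where "M = C' \<times> {0..L}"
        have M: "compact M" "convex M" "interior M \<noteq> {}"
          using C' iC' L by (auto simp: M_def compact_Times convex_Times interior_Times)
        have mem: "T ` M \<in> canal_class u C"
          unfolding canal_class_def
        proof (intro CollectI conjI)
          show "convex_body (T ` M)"
            using M C'(3) L T(1) by (auto simp: convex_body_def M_def[symmetric] intro: compact_linear_image convex_linear_image)
          show "interior (T ` M) \<noteq> {}"
            using interior_bijective_linear_image[OF T(1) bijT, of M] M(3) by simp
          have "fst ` M = C'" using L by (simp add: M_def)
          then show "proj_perp u ` T ` M = C"
            unfolding image_image projT CJ by (metis image_image)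
        qed
        obtain s where s: "surface M = ennreal s" "s > 0"
          using surface_finite[OF M] surface_pos[OF M] by (cases "surface M") auto
        have "ennreal s \<le> 2 * ennreal c + ennreal L * ennreal p"
          using surface_cylinder[OF C'(1,2) iC' L] by (simp add: s c p M_def[symmetric])
        also have "\<dots> = ennreal (2 * c + L * p)"
          using c p L by (simp add: ennreal_plus ennreal_mult)
        finally have "s \<le> 2 * c + L * p" using c p L by (subst (asm) ennreal_le_iff) auto
        then have "c * L / (2 * c + L * p) \<le> c * L / s"
          using s c L by (intro divide_left_mono) (auto intro!: mult_pos_pos add_pos_pos p)
        then have "ennreal (c * L / (2 * c + L * p)) \<le> ennreal (c * L) / ennreal s"
          using s c L by (subst divide_ennreal) (auto intro: ennreal_leI)
        also have "ennreal (c * L) = emeasure lborel M"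
          using C'(1) c L by (simp add: M_def emeasure_Times ennreal_mult)
        also have "emeasure lborel M / ennreal s = hausdorff DIM('a) (T ` M) / hausdorff (DIM('a) - 1) (rel_frontier (T ` M))"
          unfolding HT[OF M(1)] ST[OF M(3)] s(1) ..
        also have "\<dots> \<le> ?sup" using mem by (rule SUP_upper)
        finally show ?thesis by (simp add: L_def)
      qed
      \<comment> \<open>Numerator and denominator are divided by the height, which makes the limit
        \<open>c / p\<close> visible.\<close>
      have "(\<lambda>n. c / (2 * c * (1 / real (Suc n)) + p)) \<longlonglongrightarrow> c / (2 * c * 0 + p)"
        using p by (intro tendsto_intros LIMSEQ_Suc[OF lim_1_over_n]) auto
      moreover have "c / (2 * c * (1 / real (Suc n)) + p) = c * real (Suc n) / (2 * c + real (Suc n) * p)" for n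
      proof -
        have "2 * c * (1 / real (Suc n)) + p = (2 * c + real (Suc n) * p) / real (Suc n)"
          by (simp add: field_simps)
        then show ?thesis by simp
      qed
      ultimately have "(\<lambda>n. c * real (Suc n) / (2 * c + real (Suc n) * p)) \<longlonglongrightarrow> h"
        by (simp add: h_def)
      then have "(\<lambda>n. ennreal (c * real (Suc n) / (2 * c + real (Suc n) * p))) \<longlonglongrightarrow> ennreal h"
        by (rule tendsto_ennrealI)
      then show ?thesis by (rule LIMSEQ_le_const2) (use cyl in blast)
    qed
  qed
  then show ?thesis using rhs dim by simp
qed

theorem theorem2:
  fixes u :: "real ^ 'n" and C :: "(real ^ 'n) set"
  assumes "CARD('n) \<ge> 2"
    and "u \<in> sphere 0 1"
    and "convex_body C"
    and "C \<subseteq> {u}\<^sup>\<bottom>"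
    and "aff_dim C = int (CARD('n) - 1)"
    and "cheeger_set C"
  shows "(SUP K \<in> canal_class u C.
            hausdorff CARD('n) K / hausdorff (CARD('n) - 1) (rel_frontier K))
         = hausdorff (CARD('n) - 1) C / hausdorff (CARD('n) - 2) (rel_frontier C)"
proof -
  have "DIM(real ^ 'n) \<ge> 2" using assms(1) by simp
  \<comment> \<open>The equation \<open>card_hyp\<close> selects \<open>'b\<close>, the coordinate
    space of the hyperplane.\<close>
  from canal_class_sup[OF _ card_hyp[OF this] assms(3,4) _ assms(6)] show ?thesis
    using assms(2,5) by simp
qed

end
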